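(* Assume that all of the following hold. (A1) The Markov kernel $Q_{\theta^\star}$ is positive Harris recurrent. (A4) For every $\theta\not\sim\theta^\star$ there is a neighborhood $\mathcal U_\theta$ of $\theta$ such that $\sup_{\theta'\in\mathcal U_\theta}|q_{\theta'}|_\infty<\infty$ and $\bar{\mathbb E}_{\theta^\star}[\sup_{\theta'\in\mathcal U_\theta}\sup_{x\in\mathsf X}(\log g_{\theta'}(x,Y_0))^+]<\infty$, and there is an integer $r_\theta$ such that $\bar{\mathbb E}_{\theta^\star}[\sup_{\theta'\in\mathcal U_\theta}(\log p^\lambda(Y_0^{r_\theta};\theta'))^+]<\infty$. (A6$'$) For every $\theta\not\sim\theta^\star$ such that $p^\lambda(Y_0^{r_\theta};\theta)>0$ $\bar{\mathbb P}_{\theta^\star}$-a.s., there exists a function $V_\theta\ge1$ such that $Q_\theta$ is $V_\theta$-uniformly ergodic, $\bar{\mathbb P}^Y_\theta\ne\bar{\mathbb P}^Y_{\theta^\star}$, and $$\bar{\mathbb P}_{\theta^\star}\Big(\int V_\theta(x_{r_\theta+1})\,p^\lambda(dx_{r_\theta+1},Y_0^{r_\theta};\theta)<\infty\Big)>0 .$$ Then for every $\theta\not\sim\theta^\star$ such that $p^\lambda(Y_0^{r_\theta};\theta)>0$ $\bar{\mathbb P}_{\theta^\star}$-a.s., there is a sequence of sets $A_n\in\mathcal Y^{\otimes(n+1)}$ such that $$\liminf_{n\to\infty}\bar{\mathbb P}_{\theta^\star}(Y_0^n\in A_n)>0,\qquad \limsup_{n\to\infty}n^{-1}\log\tilde{\mathbb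 P}^\lambda_\theta(Y_0^n\in A_n)<0 .$$
   Context: Spaces: $\mathsf X$ and $\mathsf Y$ are Polish spaces with Borel $\sigma$-fields $\mathcal X,\mathcal Y$; $\Theta$ is a compact metric space with its Borel $\sigma$-field, endowed with a given equivalence relation $\sim$ (a prescribed binary relation saying which parameters count as equivalent; transitivity is not required). Model: $Q:\Theta\times\mathsf X\times\mathcal X\to[0,1]$ is a transition kernel (written $Q_\theta(x,A)$, with $m$-th iterate $Q_\theta^m$), $\mu$ is a positive $\sigma$-finite measure on $(\mathsf Y,\mathcal Y)$, and $g:\Theta\times\mathsf X\times\mathsf Y\to\mathbb R_+$ is measurable with $\int g_\theta(x,y)\,\mu(dy)=1$ for all $\theta,x$. For $\theta\in\Theta$ and a probability measure $\nu$ on $(\mathsf X,\mathcal X)$, $\mathbb P^\nu_\theta$ is the law on $(\mathsf X\times\mathsf Y)^{\mathbb N}$ under which the coordinate process $(X_k,Y_k)_{k\ge0}$ is a time-homogeneous Markov process with initial law $\mathbb P^\nu_\theta((X_0,Y_0)\in C)=\int\mathbf 1_C(x,y)g_\theta(x,y)\mu(dy)\nu(dx)$ and transition kernel $T_\theta[(x,y),C]=\int\mathbf 1_C(x',y')g_\theta(x',y')\mu(dy')Q_\theta(x,dx')$. $\mathbb P^{\nu,Y}_\theta$ is the marginal law of $(Y_k)_{k\ge0}$. A distinguished $\theta^\star\in\Theta$ is fixed, and $Q_{\theta^\star}$ is assumed to possess a unique invariant probability measure $\pi_{\theta^\star}$. Whenever $Q_\theta$ has a unique invariant probability measure $\pi_\theta$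 (in particular when $Q_\theta$ is $V_\theta$-uniformly ergodic), $\bar{\mathbb P}_\theta=\mathbb P^{\pi_\theta}_\theta$, $\bar{\mathbb E}_\theta$ is its expectation and $\bar{\mathbb P}_\theta^Y=\mathbb P_\theta^{\pi_\theta,Y}$. Likelihoods: $a_s^t=(a_s,\dots,a_t)$; $dy$ abbreviates $\mu(dy)$ and $dy_s^t=\prod_{i=s}^t\mu(dy_i)$. For a positive $\sigma$-finite measure $\rho$ on $(\mathsf X,\mathcal X)$, $p^\rho(dx_{t+1},y_s^t;\theta)=\int\rho(dx_s)\prod_{u=s}^t g_\theta(x_u,y_u)Q_\theta(x_u,dx_{u+1})$ (integrating over $x_s,\dots,x_t$) and $p^\rho(y_s^t;\theta)=\int p^\rho(dx_{t+1},y_s^t;\theta)$. Also $\bar p(y_s^t;\theta^\star)=p^{\pi_{\theta^\star}}(y_s^t;\theta^\star)$. $|f|_\infty$ denotes the supremum norm. Suprema over parameters are universally measurable and expectations are extended accordingly. The measure $\lambda$ and density $q$: there are an integer $l\ge1$, a measurable $q:\Theta\times\mathsf X\times\mathsf X\to\mathbb R_+$ and a $\sigma$-finite measure $\lambda$ on $(\mathsf X,\mathcal X)$ such that $|q_\theta|_\infty<\infty$ and $Q^l_\theta(x,A)=\int\mathbf 1_A(x')q_\theta(x,x')\lambda(dx')$ for all $\theta\not\sim\theta^\star$, $x\in\mathsf X$, $A\in\mathcal X$. Normalized law: for $\theta\not\sim\theta^\star$ with $p^\lambda(Y_0^{r_\theta};\theta)>0$ $\bar{\mathbb P}_{\theta^\star}$-a.s.,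 $\tilde{\mathbb P}^\lambda_\theta$ is the probability measure on $(\mathsf Y^{\mathbb N},\mathcal Y^{\otimes\mathbb N})$ determined by $\tilde{\mathbb P}^\lambda_\theta(Y_0^n\in A)=\int\mathbf 1_A(y_0^n)\frac{p^\lambda(y_0^n;\theta)}{p^\lambda(y_0^{r_\theta};\theta)}\,\bar p(y_0^{r_\theta};\theta^\star)\,dy_0^n$ for all $n\ge r_\theta$, $A\in\mathcal Y^{\otimes(n+1)}$, the integrand being read as $0$ where $\bar p(y_0^{r_\theta};\theta^\star)=0$ (it is well defined under (A4)). $V$-uniform ergodicity: for $V_\theta:\mathsf X\to[1,\infty)$ (measurable), $Q_\theta$ is $V_\theta$-uniformly ergodic if it has an invariant probability measure $\pi_\theta$ and there are constants $R_\theta<\infty$, $\alpha_\theta>1$ with $\|Q_\theta^m(x,\cdot)-\pi_\theta\|_{V_\theta}\le R_\theta\alpha_\theta^{-m}V_\theta(x)$ for all $x\in\mathsf X$, $m\in\mathbb N$, where $\|\mathbb P-\mathbb Q\|_V=\sup_{|f|\le V}|\int f\,d\mathbb P-\int f\,d\mathbb Q|$. *)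

theory Defs
  imports "HOL-Probability.Probability"
begin

section \<open>Markov chains\<close>

text \<open>
  Law on sequences of the time-homogeneous Markov chain with state space \<open>M\<close>, initial law \<open>\<nu>\<close>
  and transition kernel \<open>K\<close>, obtained from the Ionescu-Tulcea construction of
  \<^theory>\<open>HOL-Probability.Projective_Family\<close>.
\<close>
definition markov_law :: "'a measure \<Rightarrow> 'a measure \<Rightarrow> ('a \<Rightarrow> 'a measure) \<Rightarrow> (nat \<Rightarrow> 'a) measure" where
  "markov_law M \<nu> K =
     projective_family.lim UNIV
       (Ionescu_Tulcea.CI (\<lambda>n \<omega>. case n of 0 \<Rightarrow> \<nu> | Suc m \<Rightarrow> K (\<omega> m)) (\<lambda>_. M)) (\<lambda>_. M)"

primrec kernel_iter :: "('a \<Rightarrow> 'a measure) \<Rightarrow> nat \<Rightarrow> 'a \<Rightarrow> 'a::topological_space measure" where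
  "kernel_iter K 0 x = return borel x"
| "kernel_iter K (Suc m) x = kernel_iter K m x \<bind> K"

definition invariant_prob :: "('a \<Rightarrow> 'a measure) \<Rightarrow> 'a::topological_space measure \<Rightarrow> bool" where
  "invariant_prob K \<pi> \<longleftrightarrow> prob_space \<pi> \<and> sets \<pi> = sets borel \<and>
     (\<forall>A\<in>sets borel. (\<integral>\<^sup>+x. emeasure (K x) A \<partial>\<pi>) = emeasure \<pi> A)"

definition stationary_dist :: "('a \<Rightarrow> 'a measure) \<Rightarrow> 'a::topological_space measure" where
  "stationary_dist K = (THE \<pi>. invariant_prob K \<pi>)"

text \<open>
  Harris recurrence in the usual sense: for some nontrivial \<open>\<sigma>\<close>-finite measure \<open>\<phi>\<close>, every set charged
  by \<open>\<phi>\<close> is visited infinitely often with probability one from every starting point.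
  Aperiodicity is not part of the notion.
\<close>
definition positive_harris_recurrent :: "('a::topological_space \<Rightarrow> 'a measure) \<Rightarrow> bool" where
  "positive_harris_recurrent K \<longleftrightarrow>
     (\<exists>\<phi>. sigma_finite_measure \<phi> \<and> sets \<phi> = sets borel \<and> emeasure \<phi> (space \<phi>) > 0 \<and>
        (\<forall>A\<in>sets borel. emeasure \<phi> A > 0 \<longrightarrow>
           (\<forall>x. AE \<omega> in markov_law borel (return borel x) K. infinite {n. \<omega> n \<in> A}))) \<and>
     (\<exists>\<pi>. invariant_prob K \<pi>)"

text \<open>
  The Bochner integral of a non-integrable function is \<open>0\<close>, so the supremum is only used when \<open>V\<close>,
  and hence every \<open>f\<close> with \<open>\<bar>f\<bar> \<le> V\<close>, is integrable under both measures; otherwise the distance is \<open>\<infinity>\<close>.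
\<close>
definition V_dist :: "('a \<Rightarrow> real) \<Rightarrow> 'a measure \<Rightarrow> 'a::topological_space measure \<Rightarrow> ennreal" where
  "V_dist V P P' =
     (if integrable P V \<and> integrable P' V
      then (SUP f \<in> {f \<in> borel_measurable borel. \<forall>x. \<bar>f x\<bar> \<le> V x}.
              ennreal \<bar>(\<integral>x. f x \<partial>P) - (\<integral>x. f x \<partial>P')\<bar>)
      else \<infinity>)"

definition V_uniformly_ergodic :: "('a \<Rightarrow> 'a measure) \<Rightarrow> ('a::topological_space \<Rightarrow> real) \<Rightarrow> bool" where
  "V_uniformly_ergodic K V \<longleftrightarrow>
     V \<in> borel_measurable borel \<and> (\<forall>x. 1 \<le> V x) \<and>
     (\<exists>\<pi>. invariant_prob K \<pi> \<and>
        (\<exists>R \<alpha>. 0 \<le> R \<and> 1 < \<alpha> \<and>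
           (\<forall>x m. V_dist V (kernel_iter K m x) \<pi> \<le> ennreal (R / \<alpha> ^ m * V x))))"


section \<open>Hidden Markov models\<close>

text \<open>
  Throughout, \<open>K\<close> and \<open>G\<close> stand for \<open>Q\<^sub>\<theta>\<close> and \<open>g\<^sub>\<theta>\<close> at a fixed parameter.  The law below is
  \<open>C \<mapsto> \<integral>\<integral> \<one>\<^sub>C(x,y) G(x,y) \<mu>(dy) \<nu>(dx)\<close>; it serves both as initial law and, with \<open>\<nu> = K x\<close>, as
  transition kernel of the joint chain.
\<close>
definition joint_law :: "'y measure \<Rightarrow> ('x \<Rightarrow> 'y \<Rightarrow> real) \<Rightarrow> 'x measure \<Rightarrow> ('x \<times> 'y) measure" where
  "joint_law \<mu> G \<nu> = density (\<nu> \<Otimes>\<^sub>M \<mu>) (\<lambda>(x, y). ennreal (G x y))"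

definition hmm_law ::
  "('x \<Rightarrow> 'x measure) \<Rightarrow> 'y measure \<Rightarrow> ('x \<Rightarrow> 'y \<Rightarrow> real) \<Rightarrow> 'x measure
     \<Rightarrow> (nat \<Rightarrow> 'x::topological_space \<times> 'y::topological_space) measure" where
  "hmm_law K \<mu> G \<nu> =
     markov_law (borel \<Otimes>\<^sub>M borel) (joint_law \<mu> G \<nu>) (\<lambda>(x, y). joint_law \<mu> G (K x))"

definition hmm_stat ::
  "('x \<Rightarrow> 'x measure) \<Rightarrow> 'y measure \<Rightarrow> ('x \<Rightarrow> 'y \<Rightarrow> real)
     \<Rightarrow> (nat \<Rightarrow> 'x::topological_space \<times> 'y::topological_space) measure" where
  "hmm_stat K \<mu> G = hmm_law K \<mu> G (stationary_dist K)"

definition obs :: "(nat \<Rightarrow> 'x \<times> 'y) \<Rightarrow> nat \<Rightarrow> 'y" where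
  "obs \<omega> k = snd (\<omega> k)"

definition hmm_stat_obs ::
  "('x \<Rightarrow> 'x measure) \<Rightarrow> 'y measure \<Rightarrow> ('x::topological_space \<Rightarrow> 'y \<Rightarrow> real)
     \<Rightarrow> (nat \<Rightarrow> 'y::topological_space) measure" where
  "hmm_stat_obs K \<mu> G = distr (hmm_stat K \<mu> G) (PiM UNIV (\<lambda>_. borel)) obs"

text \<open>
  \<open>lik_measure K G \<rho> y t\<close> is the unnormalized measure \<open>p\<^sup>\<rho>(dx\<^bsub>t+1\<^esub>, y\<^bsub>0\<^esub>\<dots>y\<^bsub>t\<^esub>)\<close> and \<open>lik K G \<rho> y t\<close> is
  its total mass; both depend on \<open>y\<close> only through \<open>y 0, \<dots>, y t\<close>.  The measure \<open>\<rho>\<close> need not be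
  finite, and the likelihood may be \<open>\<infinity>\<close>.
\<close>
primrec lik_measure ::
  "('x \<Rightarrow> 'x measure) \<Rightarrow> ('x \<Rightarrow> 'y \<Rightarrow> real) \<Rightarrow> 'x measure \<Rightarrow> (nat \<Rightarrow> 'y) \<Rightarrow> nat \<Rightarrow> 'x measure" where
  "lik_measure K G \<rho> y 0 = density \<rho> (\<lambda>x. ennreal (G x (y 0))) \<bind> K"
| "lik_measure K G \<rho> y (Suc t) =
     density (lik_measure K G \<rho> y t) (\<lambda>x. ennreal (G x (y (Suc t)))) \<bind> K"

definition lik ::
  "('x \<Rightarrow> 'x measure) \<Rightarrow> ('x \<Rightarrow> 'y \<Rightarrow> real) \<Rightarrow> 'x measure \<Rightarrow> (nat \<Rightarrow> 'y) \<Rightarrow> nat \<Rightarrow> ennreal" where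
  "lik K G \<rho> y t = emeasure (lik_measure K G \<rho> y t) (space (lik_measure K G \<rho> y t))"

text \<open>
  The normalized law; \<open>Ks\<close>, \<open>Gs\<close> are the kernel and density at the true parameter.  Since
  \<open>a * 0 = 0\<close> in \<^typ>\<open>ennreal\<close> even for \<open>a = \<infinity>\<close>, the integrand vanishes wherever the stationary
  likelihood of \<open>y\<^bsub>0\<^esub>\<dots>y\<^bsub>r\<^esub>\<close> does.
\<close>
definition normalized_law ::
  "('x::topological_space \<Rightarrow> 'x measure) \<Rightarrow> ('x \<Rightarrow> 'y \<Rightarrow> real) \<Rightarrow> 'x measure \<Rightarrow> nat
     \<Rightarrow> ('x \<Rightarrow> 'x measure) \<Rightarrow> ('x \<Rightarrow> 'y \<Rightarrow> real) \<Rightarrow> 'y measure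
     \<Rightarrow> (nat \<Rightarrow> 'y::topological_space) measure" where
  "normalized_law K G lam r Ks Gs \<mu> =
     (THE P. prob_space P \<and> sets P = sets (PiM UNIV (\<lambda>_. borel)) \<and>
        (\<forall>n\<ge>r. \<forall>A\<in>sets (PiM {..n} (\<lambda>_. borel)).
           emeasure P {y \<in> space P. restrict y {..n} \<in> A} =
             (\<integral>\<^sup>+y. indicator A y *
                 (lik K G lam y n / lik K G lam y r * lik Ks Gs (stationary_dist Ks) y r)
               \<partial>PiM {..n} (\<lambda>_. \<mu>))))"


section \<open>Extended logarithms\<close>

definition log_ennreal :: "ennreal \<Rightarrow> ereal" where
  "log_ennreal x =
     (if x = 0 then -\<infinity> else if x = \<infinity> then \<infinity> else ereal (ln (enn2real x)))"

definition log_pos :: "ennreal \<Rightarrow> ennreal" where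
  "log_pos x = e2ennreal (max 0 (log_ennreal x))"

end

(*
  A bounded statistic h of finitely many observations has mean 0 under the stationary law at theta
  and mean 1 under the one at theta-star.  A_n asks that its sums over long blocks after time r are
  large and that the V-moment of the filter at time r is bounded.  At theta-star this keeps positive
  probability by a weak law of large numbers, for which uniqueness of the invariant law suffices.
  At theta the block sums have exponential moments: the operator
  f(x) -> E_x[exp(eps H) f(X_b)] of one block of length b multiplies the weight 1 + eta V by at most
  exp(eps b / 4) for b large and eps small, because V-uniform ergodicity makes the mean of the block
  sum H of order V uniformly in b.  Since A_n asks for H of size b / 2 per block, the Chernoff bound
  decays exponentially.  Under the normalized law, the chain after time r is
  the hidden Markov model started from the filter.
*)
theory Submission
  imports Defs
begin

section \<open>The law of a Markov chain\<close>

text \<open>The deviation bound must hold for every start law, since the filter at time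
  \<open>r\<close> varies with the data and \<open>lam\<close> is only \<sigma>-finite; hence the
  factor that integrates \<open>1 + \<eta> * V\<close> over the start law, which the condition on
  the filter keeps bounded. The weight is linear because uniform ergodicity makes \<open>V\<close>
  integrable but says nothing about its exponential. A block leaves out its last \<open>s\<close>
  window positions: blocks then share no observation and their exponential moments separate exactly
  at multiples of \<open>b\<close>, for a loss of \<open>s * C\<close> per block that a large
  \<open>b\<close> absorbs. At \<open>\<theta>s\<close> neither a rate of mixing nor aperiodicity is
  at hand, so the law of large numbers rests on averages alone: a mean ergodic theorem, proved by
  minimizing the L2 norm over averages of an orbit, yields second moments of smaller order than the
  square of n. Positive probability then needs no independence: the filter condition has a fixed
  probability p > 0, and the block condition fails with probability tending to 0.\<close>

locale markov_kernel =
  fixes M :: "'a measure" and K :: "'a \<Rightarrow> 'a measure"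
  assumes kernel [measurable]: "K \<in> M \<rightarrow>\<^sub>M prob_algebra M"
begin

section \<open>Finite prefixes of the chain\<close>

definition step_kernel :: "'a measure \<Rightarrow> nat \<Rightarrow> (nat \<Rightarrow> 'a) \<Rightarrow> 'a measure" where
  "step_kernel \<nu> n \<omega> = (case n of 0 \<Rightarrow> \<nu> | Suc m \<Rightarrow> K (\<omega> m))"

lemma measurable_step_kernel [measurable]:
  assumes [measurable]: "\<kappa> \<in> N \<rightarrow>\<^sub>M prob_algebra M"
  shows "(\<lambda>(x, \<omega>). step_kernel (\<kappa> x) n \<omega>) \<in> N \<Otimes>\<^sub>M PiM {0..<n} (\<lambda>_. M) \<rightarrow>\<^sub>M prob_algebra M"
  by (cases n) (simp_all add: step_kernel_def)

lemma Ionescu_Tulcea_step_kernel: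
  assumes "\<nu> \<in> space (prob_algebra M)"
  shows "Ionescu_Tulcea (step_kernel \<nu>) (\<lambda>_. M)"
proof -
  have *: "step_kernel \<nu> n \<in> PiM {0..<n} (\<lambda>_. M) \<rightarrow>\<^sub>M prob_algebra M" for n
    using assms by (cases n) (simp_all add: step_kernel_def[abs_def])
  then show ?thesis
    using measurable_space[OF *]
    by (intro Ionescu_Tulcea.intro measurable_prob_algebraD) (auto simp: space_prob_algebra)
qed

text \<open>The law of the coordinates in \<open>{0..<n}\<close>;
  \<open>\<lambda>_. undefined\<close> is the only point of the product over the empty index
  set.\<close>

definition prefix_law :: "'a measure \<Rightarrow> nat \<Rightarrow> (nat \<Rightarrow> 'a) measure" where
  "prefix_law \<nu> n = Ionescu_Tulcea.C (step_kernel \<nu>) (\<lambda>_. M) 0 n (\<lambda>_. undefined)"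

lemma prefix_law_0: "\<nu> \<in> space (prob_algebra M) \<Longrightarrow>
    prefix_law \<nu> 0 = return (PiM {0..<0} (\<lambda>_. M)) (\<lambda>_. undefined)"
  unfolding prefix_law_def
  by (simp add: Ionescu_Tulcea.C.simps[OF Ionescu_Tulcea_step_kernel])

lemma prefix_law_Suc:
  assumes "\<nu> \<in> space (prob_algebra M)"
  shows "prefix_law \<nu> (Suc n) = prefix_law \<nu> n \<bind>
    (\<lambda>\<omega>. distr (step_kernel \<nu> n \<omega>) (PiM {0..<Suc n} (\<lambda>_. M)) (fun_upd \<omega> n))"
  unfolding prefix_law_def
  by (simp add: Ionescu_Tulcea.C.simps[OF Ionescu_Tulcea_step_kernel[OF assms]]
      Ionescu_Tulcea.eP_def[OF Ionescu_Tulcea_step_kernel[OF assms], abs_def])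

text \<open>The law started from \<open>K x\<close> must itself be a kernel in \<open>x\<close>
  before the first step can be split off. The recursion for \<open>prefix_law\<close> holds for
  probability measures only, so measurability is proved for its right-hand side and carried over on
  that domain.\<close>

lemma measurable_prefix_law:
  assumes \<kappa> [measurable]: "\<kappa> \<in> N \<rightarrow>\<^sub>M prob_algebra M"
  shows "(\<lambda>x. prefix_law (\<kappa> x) n) \<in> N \<rightarrow>\<^sub>M prob_algebra (PiM {0..<n} (\<lambda>_. M))"
proof (induction n)
  case 0
  have "(\<lambda>x. return (PiM {0..<0::nat} (\<lambda>_. M)) (\<lambda>_. undefined)) \<in> N \<rightarrow>\<^sub>M prob_algebra (PiM {0..<0} (\<lambda>_. M))"
    by (rule measurable_const) (auto simp: space_prob_algebra space_PiM intro!: prob_space_return)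
  then show ?case
    by (rule measurable_cong[THEN iffD1, rotated])
      (use measurable_space[OF \<kappa>] in \<open>simp add: prefix_law_0\<close>)
next
  case (Suc n)
  note Suc.IH [measurable]
  have fu [measurable]: "(\<lambda>(x, z). fun_upd (snd x) n z) \<in> (N \<Otimes>\<^sub>M PiM {0..<n} (\<lambda>_. M)) \<Otimes>\<^sub>M M \<rightarrow>\<^sub>M PiM {0..<Suc n} (\<lambda>_. M)"
    unfolding split_beta by (rule measurable_fun_upd[where J="{0..<n}"]) auto
  have [measurable]: "(\<lambda>x. distr (step_kernel (\<kappa> (fst x)) n (snd x)) (PiM {0..<Suc n} (\<lambda>_. M)) (fun_upd (snd x) n))
     \<in> N \<Otimes>\<^sub>M PiM {0..<n} (\<lambda>_. M) \<rightarrow>\<^sub>M prob_algebra (PiM {0..<Suc n} (\<lambda>_. M))"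
    by (rule measurable_distr_prob_space2[OF _ fu])
      (use measurable_step_kernel[OF \<kappa>] in \<open>simp add: split_beta\<close>)
  have "(\<lambda>x. prefix_law (\<kappa> x) n \<bind>
    (\<lambda>\<omega>. distr (step_kernel (\<kappa> x) n \<omega>) (PiM {0..<Suc n} (\<lambda>_. M)) (fun_upd \<omega> n)))
     \<in> N \<rightarrow>\<^sub>M prob_algebra (PiM {0..<Suc n} (\<lambda>_. M))"
    by (rule measurable_bind_prob_space2[OF Suc.IH]) (simp add: split_beta)
  then show ?case
    by (rule measurable_cong[THEN iffD1, rotated])
      (use measurable_space[OF \<kappa>] in \<open>simp add: prefix_law_Suc\<close>)
qed

lemma measurable_prefix_law' [measurable]:
  "(\<lambda>\<nu>. prefix_law \<nu> n) \<in> prob_algebra M \<rightarrow>\<^sub>M prob_algebra (PiM {0..<n} (\<lambda>_. M))"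
  by (rule measurable_prefix_law) simp

lemma measurable_step_kernel_prob [measurable]:
  "\<nu> \<in> space (prob_algebra M) \<Longrightarrow> step_kernel \<nu> n \<in> PiM {0..<n} (\<lambda>_. M) \<rightarrow>\<^sub>M prob_algebra M"
  by (cases n) (simp_all add: step_kernel_def[abs_def])

lemma nn_integral_prefix_law_Suc:
  assumes \<nu>: "\<nu> \<in> space (prob_algebra M)"
    and F [measurable]: "F \<in> borel_measurable (PiM {0..<Suc n} (\<lambda>_. M))"
  shows "(\<integral>\<^sup>+\<omega>. F \<omega> \<partial>prefix_law \<nu> (Suc n)) =
    (\<integral>\<^sup>+\<omega>. \<integral>\<^sup>+z. F (fun_upd \<omega> n z) \<partial>step_kernel \<nu> n \<omega> \<partial>prefix_law \<nu> n)"
proof -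
  note [measurable] = measurable_step_kernel_prob[OF \<nu>]
  have sp: "sets (prefix_law \<nu> n) = sets (PiM {0..<n} (\<lambda>_. M))"
    using measurable_space[OF measurable_prefix_law' \<nu>] by (simp add: space_prob_algebra)
  have fu [measurable]: "(\<lambda>(\<omega>, z). fun_upd \<omega> n z) \<in> PiM {0..<n} (\<lambda>_. M) \<Otimes>\<^sub>M M \<rightarrow>\<^sub>M PiM {0..<Suc n} (\<lambda>_. M)"
    unfolding split_beta by (rule measurable_fun_upd[where J="{0..<n}"]) auto
  have [measurable]: "(\<lambda>\<omega>. distr (step_kernel \<nu> n \<omega>) (PiM {0..<Suc n} (\<lambda>_. M)) (fun_upd \<omega> n))
     \<in> PiM {0..<n} (\<lambda>_. M) \<rightarrow>\<^sub>M subprob_algebra (PiM {0..<Suc n} (\<lambda>_. M))"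
    by (intro measurable_prob_algebraD) measurable
  show ?thesis
    unfolding prefix_law_Suc[OF \<nu>]
  proof (subst nn_integral_bind[where B="PiM {0..<Suc n} (\<lambda>_. M)"])
    show "(\<lambda>\<omega>. distr (step_kernel \<nu> n \<omega>) (PiM {0..<Suc n} (\<lambda>_. M)) (fun_upd \<omega> n))
      \<in> prefix_law \<nu> n \<rightarrow>\<^sub>M subprob_algebra (PiM {0..<Suc n} (\<lambda>_. M))"
      by (simp add: measurable_cong_sets[OF sp])
    show "(\<integral>\<^sup>+\<omega>. \<integral>\<^sup>+y. F y \<partial>distr (step_kernel \<nu> n \<omega>) (PiM {0..<Suc n} (\<lambda>_. M)) (fun_upd \<omega> n) \<partial>prefix_law \<nu> n)
      = (\<integral>\<^sup>+\<omega>. \<integral>\<^sup>+z. F (fun_upd \<omega> n z) \<partial>step_kernel \<nu> n \<omega> \<partial>prefix_law \<nu> n)"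
    proof (intro nn_integral_cong)
      fix \<omega> assume "\<omega> \<in> space (prefix_law \<nu> n)"
      then have \<omega>: "\<omega> \<in> space (PiM {0..<n} (\<lambda>_. M))"
        by (simp add: sets_eq_imp_space_eq[OF sp])
      then have "sets (step_kernel \<nu> n \<omega>) = sets M"
        using measurable_space[OF measurable_step_kernel_prob[OF \<nu>] \<omega>] by (simp add: space_prob_algebra)
      then have "fun_upd \<omega> n \<in> step_kernel \<nu> n \<omega> \<rightarrow>\<^sub>M PiM {0..<Suc n} (\<lambda>_. M)"
        using measurable_Pair2[OF fu \<omega>] by (simp cong: measurable_cong_sets)
      then show "(\<integral>\<^sup>+y. F y \<partial>distr (step_kernel \<nu> n \<omega>) (PiM {0..<Suc n} (\<lambda>_. M)) (fun_upd \<omega> n))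
        = (\<integral>\<^sup>+z. F (fun_upd \<omega> n z) \<partial>step_kernel \<nu> n \<omega>)"
        by (subst nn_integral_distr) auto
    qed
  qed simp
qed

lemma measurable_case_nat_prefix [measurable]:
  "(\<lambda>(x, \<omega>). case_nat x \<omega>) \<in> M \<Otimes>\<^sub>M PiM {0..<n} (\<lambda>_. M) \<rightarrow>\<^sub>M PiM {0..<Suc n} (\<lambda>_. M)"
proof (rule measurable_PiM_single')
  fix i assume i: "i \<in> {0..<Suc n}"
  show "(\<lambda>p. (case p of (x, \<omega>) \<Rightarrow> case_nat x \<omega>) i) \<in> M \<Otimes>\<^sub>M PiM {0..<n} (\<lambda>_. M) \<rightarrow>\<^sub>M M"
    using i by (cases i) (auto simp: split_beta)
qed (auto simp: space_pair_measure space_PiM PiE_iff extensional_def split: nat.splits)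

text \<open>The construction appends coordinates at the end, while the Markov property splits off
  the first. Induction on \<open>n\<close> reconciles the two: the last coordinate is integrated
  out, which leaves a function of a shorter prefix to which the hypothesis applies.\<close>

lemma nn_integral_prefix_law_first:
  assumes \<nu>: "\<nu> \<in> space (prob_algebra M)"
    and F: "F \<in> borel_measurable (PiM {0..<Suc n} (\<lambda>_. M))"
  shows "(\<integral>\<^sup>+\<omega>. F \<omega> \<partial>prefix_law \<nu> (Suc n)) =
    (\<integral>\<^sup>+x. \<integral>\<^sup>+\<omega>. F (case_nat x \<omega>) \<partial>prefix_law (K x) n \<partial>\<nu>)"
  using F
proof (induction n arbitrary: F)
  case (0 F)
  note 0 [measurable]
  have sp: "sets \<nu> = sets M" and "prob_space \<nu>"
    using \<nu> by (auto simp: space_prob_algebra)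
  have s: "space \<nu> = space M" by (rule sets_eq_imp_space_eq[OF sp])
  have e: "fun_upd (\<lambda>_. undefined) 0 x = case_nat x (\<lambda>_. undefined)" for x :: 'a
    by (auto simp: fun_eq_iff split: nat.split)
  have sk: "step_kernel \<nu> 0 (\<lambda>_. undefined) = \<nu>" by (simp add: step_kernel_def)
  have fu [measurable]: "(\<lambda>(\<omega>, z). fun_upd \<omega> 0 z) \<in> PiM {0..<0::nat} (\<lambda>_. M) \<Otimes>\<^sub>M M \<rightarrow>\<^sub>M PiM {0..<Suc 0} (\<lambda>_. M)"
    unfolding split_beta by (rule measurable_fun_upd[where J="{0..<0}"]) auto
  have m: "(\<lambda>\<omega>. \<integral>\<^sup>+z. F (fun_upd \<omega> 0 z) \<partial>step_kernel \<nu> 0 \<omega>) \<in> borel_measurable (PiM {0..<0::nat} (\<lambda>_. M))"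
    by (rule nn_integral_measurable_subprob_algebra2[OF _ measurable_prob_algebraD[OF measurable_step_kernel_prob[OF \<nu>]]])
       measurable
  have "(\<integral>\<^sup>+\<omega>. F \<omega> \<partial>prefix_law \<nu> (Suc 0)) = (\<integral>\<^sup>+z. F (case_nat z (\<lambda>_. undefined)) \<partial>\<nu>)"
    unfolding nn_integral_prefix_law_Suc[OF \<nu> 0] prefix_law_0[OF \<nu>]
    by (subst nn_integral_return[OF _ m]) (auto simp: sk e space_PiM)
  also have "\<dots> = (\<integral>\<^sup>+x. \<integral>\<^sup>+\<omega>. F (case_nat x \<omega>) \<partial>prefix_law (K x) 0 \<partial>\<nu>)"
  proof (rule nn_integral_cong)
    fix x assume "x \<in> space \<nu>"
    then have x: "x \<in> space M" by (simp add: s)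
    have "(\<lambda>\<omega>. F (case_nat x \<omega>)) \<in> borel_measurable (PiM {0..<0::nat} (\<lambda>_. M))"
      using measurable_Pair2[OF measurable_compose[OF measurable_case_nat_prefix 0] x] by simp
    then show "F (case_nat x (\<lambda>_. undefined)) = (\<integral>\<^sup>+\<omega>. F (case_nat x \<omega>) \<partial>prefix_law (K x) 0)"
      unfolding prefix_law_0[OF measurable_space[OF kernel x]]
      by (subst nn_integral_return) (auto simp: space_PiM)
  qed
  finally show ?case .
next
  case (Suc n F)
  note Suc.prems [measurable]
  have sp: "sets \<nu> = sets M" and "prob_space \<nu>"
    using \<nu> by (auto simp: space_prob_algebra)
  have s: "space \<nu> = space M" by (rule sets_eq_imp_space_eq[OF sp])
  have fu [measurable]: "(\<lambda>(\<omega>, z). fun_upd \<omega> (Suc n) z) \<in> PiM {0..<Suc n} (\<lambda>_. M) \<Otimes>\<^sub>M M \<rightarrow>\<^sub>M PiM {0..<Suc (Suc n)} (\<lambda>_. M)"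
    unfolding split_beta by (rule measurable_fun_upd[where J="{0..<Suc n}"]) auto
  define F' where "F' \<omega> = (\<integral>\<^sup>+z. F (fun_upd \<omega> (Suc n) z) \<partial>K (\<omega> n))" for \<omega>
  have F': "F' \<in> borel_measurable (PiM {0..<Suc n} (\<lambda>_. M))"
    unfolding F'_def
    by (rule nn_integral_measurable_subprob_algebra2[where N=M])
       (measurable, intro measurable_prob_algebraD, measurable)
  have "(\<integral>\<^sup>+\<omega>. F \<omega> \<partial>prefix_law \<nu> (Suc (Suc n))) = (\<integral>\<^sup>+\<omega>. F' \<omega> \<partial>prefix_law \<nu> (Suc n))"
    unfolding nn_integral_prefix_law_Suc[OF \<nu> Suc.prems] F'_def by (simp add: step_kernel_def)
  also have "\<dots> = (\<integral>\<^sup>+x. \<integral>\<^sup>+\<omega>. F' (case_nat x \<omega>) \<partial>prefix_law (K x) n \<partial>\<nu>)"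
    by (rule Suc.IH[OF F'])
  also have "\<dots> = (\<integral>\<^sup>+x. \<integral>\<^sup>+\<omega>. F (case_nat x \<omega>) \<partial>prefix_law (K x) (Suc n) \<partial>\<nu>)"
  proof (rule nn_integral_cong)
    fix x assume "x \<in> space \<nu>"
    then have x: "x \<in> space M" by (simp add: s)
    have m: "(\<lambda>\<omega>. F (case_nat x \<omega>)) \<in> borel_measurable (PiM {0..<Suc n} (\<lambda>_. M))"
      using measurable_Pair2[OF measurable_compose[OF measurable_case_nat_prefix Suc.prems] x] by simp
    \<comment> \<open>Prepending \<open>x\<close> and appending \<open>z\<close> commute, up to the
      shift of the index.\<close>
    have e: "fun_upd (case_nat x \<omega>) (Suc n) z = case_nat x (fun_upd \<omega> n z)" for \<omega> z
      by (auto simp: fun_eq_iff split: nat.split)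
    show "(\<integral>\<^sup>+\<omega>. F' (case_nat x \<omega>) \<partial>prefix_law (K x) n) = (\<integral>\<^sup>+\<omega>. F (case_nat x \<omega>) \<partial>prefix_law (K x) (Suc n))"
      unfolding nn_integral_prefix_law_Suc[OF measurable_space[OF kernel x] m] F'_def e
      \<comment> \<open>The split on \<open>n\<close> covers the boundary: for \<open>n = 0\<close>
        the step kernel is the initial law \<open>K x\<close>, and \<open>F'\<close> reads the same
        kernel off \<open>case_nat x \<omega> 0 = x\<close>.\<close>
      by (intro nn_integral_cong) (simp add: step_kernel_def split: nat.split)
  qed
  finally show ?case .
qed

text \<open>The mass of a cylinder is decided by finitely many coordinates; taking none of them
  (\<open>n = 0\<close>) gives total mass one.\<close>

lemma sets_markov_law [simp, measurable_cong]: "\<nu> \<in> space (prob_algebra M) \<Longrightarrow> sets (markov_law M \<nu> K) = sets (PiM UNIV (\<lambda>_. M))"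
  and prob_space_markov_law: "\<nu> \<in> space (prob_algebra M) \<Longrightarrow> prob_space (markov_law M \<nu> K)"
  and emeasure_markov_law_prefix: "\<nu> \<in> space (prob_algebra M) \<Longrightarrow> J \<subseteq> {0..<n} \<Longrightarrow> X \<in> sets (PiM J (\<lambda>_. M)) \<Longrightarrow>
    emeasure (markov_law M \<nu> K) (prod_emb UNIV (\<lambda>_. M) J X) =
    emeasure (prefix_law \<nu> n) (prod_emb {0..<n} (\<lambda>_. M) J X)"
proof -
  assume \<nu>: "\<nu> \<in> space (prob_algebra M)"
  interpret IT: Ionescu_Tulcea "step_kernel \<nu>" "\<lambda>_. M"
    by (rule Ionescu_Tulcea_step_kernel[OF \<nu>])
  have eq: "markov_law M \<nu> K = IT.PF.lim"
    unfolding markov_law_def step_kernel_def[abs_def] ..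
  show "sets (markov_law M \<nu> K) = sets (PiM UNIV (\<lambda>_. M))"
    by (simp add: eq)
  have **: "emeasure (markov_law M \<nu> K) (prod_emb UNIV (\<lambda>_. M) J X) =
    emeasure (prefix_law \<nu> n) (prod_emb {0..<n} (\<lambda>_. M) J X)"
    if "J \<subseteq> {0..<n}" "X \<in> sets (PiM J (\<lambda>_. M))" for J X n
    using that IT.emeasure_CI[OF that] IT.lim[OF finite_subset[OF that(1)] that(2)]
    by (simp add: eq prefix_law_def)
  then show "J \<subseteq> {0..<n} \<Longrightarrow> X \<in> sets (PiM J (\<lambda>_. M)) \<Longrightarrow>
    emeasure (markov_law M \<nu> K) (prod_emb UNIV (\<lambda>_. M) J X) =
    emeasure (prefix_law \<nu> n) (prod_emb {0..<n} (\<lambda>_. M) J X)" .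
  show "prob_space (markov_law M \<nu> K)"
  proof
    have "space (markov_law M \<nu> K) = prod_emb UNIV (\<lambda>_. M) {} (space (PiM {} (\<lambda>_. M)))"
      by (auto simp: eq prod_emb_def space_PiM)
    moreover have "emeasure (markov_law M \<nu> K) (prod_emb UNIV (\<lambda>_. M) {} (space (PiM {} (\<lambda>_. M)))) =
      emeasure (prefix_law \<nu> 0) (prod_emb {0..<0} (\<lambda>_. M) {} (space (PiM {} (\<lambda>_. M))))"
      by (rule **[OF _ sets.top]) simp
    moreover have "\<dots> = 1"
      unfolding prefix_law_0[OF \<nu>]
      by (subst emeasure_return) (auto simp: sets_PiM_empty prod_emb_iff space_PiM)
    ultimately show "emeasure (markov_law M \<nu> K) (space (markov_law M \<nu> K)) = 1"
      by simp
  qed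
qed

text \<open>Cylinders form an intersection-stable generator of the product \<sigma>-field, and the
  mass of each one is a measurable function of \<open>\<nu>\<close> through
  \<open>prefix_law\<close>.\<close>

lemma measurable_markov_law [measurable]:
  "(\<lambda>\<nu>. markov_law M \<nu> K) \<in> prob_algebra M \<rightarrow>\<^sub>M prob_algebra (PiM UNIV (\<lambda>_. M))"
proof (rule measurable_prob_algebra_generated[OF sets_PiM Int_stable_prod_algebra prod_algebra_sets_into_space])
  fix A assume "A \<in> prod_algebra (UNIV::nat set) (\<lambda>_. M)"
  from prod_algebraE[OF this] obtain J E where A: "A = prod_emb UNIV (\<lambda>_. M) J (PiE J E)"
    and J: "finite J" and E: "\<And>i. i \<in> J \<Longrightarrow> E i \<in> sets M" by metis
  from J obtain n where n: "J \<subseteq> {0..<n}"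
    using finite_nat_set_iff_bounded by (auto simp: subset_eq)
  have X: "PiE J E \<in> sets (PiM J (\<lambda>_. M))" using J E by (intro sets_PiM_I_finite) auto
  have "prod_emb {0..<n} (\<lambda>_. M) J (PiE J E) \<in> sets (PiM {0..<n} (\<lambda>_. M))"
    using n X by (rule measurable_prod_emb)
  then have "(\<lambda>\<nu>. emeasure (prefix_law \<nu> n) (prod_emb {0..<n} (\<lambda>_. M) J (PiE J E))) \<in> borel_measurable (prob_algebra M)"
    by (intro measurable_emeasure_kernel[OF measurable_prob_algebraD]) auto
  then show "(\<lambda>\<nu>. emeasure (markov_law M \<nu> K) A) \<in> borel_measurable (prob_algebra M)"
    by (rule measurable_cong[THEN iffD1, rotated]) (simp add: A emeasure_markov_law_prefix[OF _ n X])
qed (auto simp: prob_space_markov_law)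

text \<open>Finite measures on the infinite product are equal once they agree on cylinders, and a
  cylinder reduces to \<open>nn_integral_prefix_law_first\<close>. The equality of measures then
  serves every measurable integrand.\<close>

lemma markov_law_first_step:
  assumes \<nu>: "\<nu> \<in> space (prob_algebra M)"
  shows "markov_law M \<nu> K = \<nu> \<bind> (\<lambda>x. distr (markov_law M (K x) K) (PiM UNIV (\<lambda>_. M)) (case_nat x))"
    (is "_ = \<nu> \<bind> ?D")
proof -
  have D: "?D \<in> M \<rightarrow>\<^sub>M prob_algebra (PiM UNIV (\<lambda>_. M))"
    by measurable
  note b = sets_bind'[OF \<nu> D] prob_space_bind'[OF \<nu> D] emeasure_bind_prob_algebra[OF \<nu> D]
  have s: "space \<nu> = space M"
    using \<nu> by (intro sets_eq_imp_space_eq) (simp add: space_prob_algebra)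
  show ?thesis
  proof (rule measure_eqI_PiM_infinite)
    show "finite_measure (markov_law M \<nu> K)"
      using prob_space_markov_law[OF \<nu>] by (simp add: prob_space_def)
    fix A and J :: "nat set" assume J: "finite J" and A: "\<And>i. i \<in> J \<Longrightarrow> A i \<in> sets M"
    from J obtain n where n: "J \<subseteq> {0..<Suc n}"
      using finite_nat_set_iff_bounded by (auto simp: subset_eq) (metis less_Suc_eq)
    have X: "PiE J A \<in> sets (PiM J (\<lambda>_. M))" using J A by (intro sets_PiM_I_finite) auto
    let ?E = "prod_emb UNIV (\<lambda>_. M) J (PiE J A)"
    let ?En = "prod_emb {0..<Suc n} (\<lambda>_. M) J (PiE J A)"
    have E [measurable]: "?E \<in> sets (PiM UNIV (\<lambda>_. M))"
      using X by (intro measurable_prod_emb) auto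
    have En [measurable]: "?En \<in> sets (PiM {0..<Suc n} (\<lambda>_. M))"
      using n X by (rule measurable_prod_emb)
    have sp: "sets (prefix_law \<nu> (Suc n)) = sets (PiM {0..<Suc n} (\<lambda>_. M))"
      using measurable_space[OF measurable_prefix_law' \<nu>] by (simp add: space_prob_algebra)
    have "emeasure (markov_law M \<nu> K) ?E = emeasure (prefix_law \<nu> (Suc n)) ?En"
      by (rule emeasure_markov_law_prefix[OF \<nu> n X])
    also have "\<dots> = (\<integral>\<^sup>+\<omega>. indicator ?En \<omega> \<partial>prefix_law \<nu> (Suc n))"
      by (rule nn_integral_indicator[symmetric]) (simp add: sp)
    also have "\<dots> = (\<integral>\<^sup>+x. \<integral>\<^sup>+\<omega>. indicator ?En (case_nat x \<omega>) \<partial>prefix_law (K x) n \<partial>\<nu>)"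
      by (rule nn_integral_prefix_law_first[OF \<nu>]) simp
    also have "\<dots> = (\<integral>\<^sup>+x. emeasure (?D x) ?E \<partial>\<nu>)"
    proof (rule nn_integral_cong)
      fix x assume "x \<in> space \<nu>"
      then have x: "x \<in> space M" by (simp add: s)
      note Kx = measurable_space[OF kernel x]
      have sK: "sets (prefix_law (K x) n) = sets (PiM {0..<n} (\<lambda>_. M))"
        using measurable_space[OF measurable_prefix_law' Kx] by (simp add: space_prob_algebra)
      have c1: "case_nat x \<in> PiM {0..<n} (\<lambda>_. M) \<rightarrow>\<^sub>M PiM {0..<Suc n} (\<lambda>_. M)"
        using measurable_Pair2[OF measurable_case_nat_prefix x] by simp
      have c2: "case_nat x \<in> PiM UNIV (\<lambda>_. M) \<rightarrow>\<^sub>M PiM UNIV (\<lambda>_. M)"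
        using x by measurable
      let ?Y = "case_nat x -` ?En \<inter> space (PiM {0..<n} (\<lambda>_. M))"
      have Y: "?Y \<in> sets (PiM {0..<n} (\<lambda>_. M))"
        using c1 En by (rule measurable_sets)
      have id: "prod_emb {0..<n} (\<lambda>_. M) {0..<n} ?Y = ?Y"
        using sets.sets_into_space[OF Y] by (intro prod_emb_id) (auto simp: space_PiM)
      \<comment> \<open>Pulling the cylinder back along \<open>case_nat x\<close> lowers its indices
        by one, so that the first \<open>n\<close> coordinates of the tail decide
        membership.\<close>
      have em: "prod_emb UNIV (\<lambda>_. M) {0..<n} ?Y = case_nat x -` ?E \<inter> space (PiM UNIV (\<lambda>_. M))"
      proof -
        have r: "restrict (case_nat x (restrict \<omega> {0..<n})) J = restrict (case_nat x \<omega>) J" for \<omega>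
          using n by (auto simp: fun_eq_iff restrict_def split: nat.split)
        have ex: "case_nat x (restrict \<omega> {0..<n}) \<in> extensional {0..<Suc n}" for \<omega>
          by (auto simp: extensional_def split: nat.split)
        have sp: "i < Suc n \<Longrightarrow> case_nat x (restrict \<omega> {0..<n}) i \<in> space M" "case_nat x \<omega> i \<in> space M"
          if "\<forall>i. \<omega> i \<in> space M" for \<omega> and i
          using x that by (auto split: nat.split)
        show ?thesis
          using x sp by (intro set_eqI) (auto simp: prod_emb_iff r ex space_PiM PiE_iff)
      qed
      have "(\<integral>\<^sup>+\<omega>. indicator ?En (case_nat x \<omega>) \<partial>prefix_law (K x) n) = (\<integral>\<^sup>+\<omega>. indicator ?Y \<omega> \<partial>prefix_law (K x) n)"
        by (intro nn_integral_cong) (simp add: sets_eq_imp_space_eq[OF sK] indicator_def)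
      also have "\<dots> = emeasure (prefix_law (K x) n) ?Y"
        using Y by (simp add: sK)
      also have "\<dots> = emeasure (markov_law M (K x) K) (prod_emb UNIV (\<lambda>_. M) {0..<n} ?Y)"
        using emeasure_markov_law_prefix[OF Kx order_refl Y] id by simp
      also have "\<dots> = emeasure (?D x) ?E"
        using c2 Kx by (subst emeasure_distr) (auto simp: em sets_eq_imp_space_eq[OF sets_markov_law[OF Kx]] cong: measurable_cong_sets)
      finally show "(\<integral>\<^sup>+\<omega>. indicator ?En (case_nat x \<omega>) \<partial>prefix_law (K x) n) = emeasure (?D x) ?E" .
    qed
    also have "\<dots> = emeasure (\<nu> \<bind> ?D) ?E"
      by (rule b(3)[symmetric]) simp
    finally show "emeasure (markov_law M \<nu> K) ?E = emeasure (\<nu> \<bind> ?D) ?E" .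
  qed (simp_all add: b \<nu>)
qed

lemma nn_integral_markov_law_first_step:
  assumes \<nu>: "\<nu> \<in> space (prob_algebra M)" and F [measurable]: "F \<in> borel_measurable (PiM UNIV (\<lambda>_. M))"
  shows "(\<integral>\<^sup>+\<omega>. F \<omega> \<partial>markov_law M \<nu> K) = (\<integral>\<^sup>+x. \<integral>\<^sup>+\<omega>. F (case_nat x \<omega>) \<partial>markov_law M (K x) K \<partial>\<nu>)"
proof -
  have sp: "sets \<nu> = sets M" using \<nu> by (simp add: space_prob_algebra)
  have D: "(\<lambda>x. distr (markov_law M (K x) K) (PiM UNIV (\<lambda>_. M)) (case_nat x)) \<in> \<nu> \<rightarrow>\<^sub>M subprob_algebra (PiM UNIV (\<lambda>_. M))"
    unfolding measurable_cong_sets[OF sp refl] by (intro measurable_prob_algebraD) measurable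
  show ?thesis
    unfolding markov_law_first_step[OF \<nu>] nn_integral_bind[OF F D]
  proof (rule nn_integral_cong)
    fix x assume "x \<in> space \<nu>"
    then have x: "x \<in> space M" by (simp add: sets_eq_imp_space_eq[OF sp])
    have "case_nat x \<in> PiM UNIV (\<lambda>_. M) \<rightarrow>\<^sub>M PiM UNIV (\<lambda>_. M)"
      using x by measurable
    then show "(\<integral>\<^sup>+\<omega>. F \<omega> \<partial>distr (markov_law M (K x) K) (PiM UNIV (\<lambda>_. M)) (case_nat x)) =
      (\<integral>\<^sup>+\<omega>. F (case_nat x \<omega>) \<partial>markov_law M (K x) K)"
      using measurable_space[OF kernel x] by (intro nn_integral_distr) (auto cong: measurable_cong_sets)
  qed
qed

end

section \<open>Hidden Markov models\<close>

definition seq_shift :: "nat \<Rightarrow> (nat \<Rightarrow> 'a) \<Rightarrow> nat \<Rightarrow> 'a" where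
  "seq_shift n \<omega> k = \<omega> (k + n)"

lemma measurable_seq_shift [measurable]: "seq_shift n \<in> PiM UNIV (\<lambda>_. M) \<rightarrow>\<^sub>M PiM UNIV (\<lambda>_. M)"
  unfolding seq_shift_def[abs_def]
  by (rule measurable_PiM_single') (auto simp: space_PiM PiE_iff)

lemma seq_shift_0 [simp]: "seq_shift 0 \<omega> = \<omega>"
  by (simp add: seq_shift_def fun_eq_iff)

lemma seq_shift_seq_shift: "seq_shift m (seq_shift n \<omega>) = seq_shift (m + n) \<omega>"
  by (simp add: seq_shift_def fun_eq_iff add.assoc)

lemma seq_shift_case_nat: "seq_shift (Suc 0) (case_nat z \<omega>) = \<omega>"
  by (simp add: seq_shift_def fun_eq_iff)

lemma measurable_obs [measurable]:
  "obs \<in> PiM UNIV (\<lambda>_. M \<Otimes>\<^sub>M N) \<rightarrow>\<^sub>M PiM UNIV (\<lambda>_. N)"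
  unfolding obs_def[abs_def]
  by (rule measurable_PiM_single') (auto simp: space_PiM PiE_iff space_pair_measure Pi_iff mem_Times_iff)

lemma kernel_nn_integral:
  assumes "N \<in> M \<rightarrow>\<^sub>M prob_algebra B" "f \<in> borel_measurable B" "\<nu> \<in> space (prob_algebra M)"
  shows "(\<integral>\<^sup>+x. f x \<partial>(\<nu> \<bind> N)) = (\<integral>\<^sup>+x. \<integral>\<^sup>+y. f y \<partial>N x \<partial>\<nu>)"
proof (rule nn_integral_bind[OF assms(2)])
  have s: "sets \<nu> = sets M" using assms(3) by (simp add: space_prob_algebra)
  show "N \<in> \<nu> \<rightarrow>\<^sub>M subprob_algebra B"
    unfolding measurable_cong_sets[OF s refl] by (rule measurable_prob_algebraD[OF assms(1)])
qed

lemma measurable_nn_integral_kernel [measurable (raw)]: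
  assumes "(\<lambda>(x, y). f x y) \<in> borel_measurable (M \<Otimes>\<^sub>M N)" "L \<in> M \<rightarrow>\<^sub>M prob_algebra N"
  shows "(\<lambda>x. \<integral>\<^sup>+y. f x y \<partial>L x) \<in> borel_measurable M"
  using assms by (intro nn_integral_measurable_subprob_algebra2 measurable_prob_algebraD)

lemma measurable_return_borel [measurable]: "return borel \<in> borel \<rightarrow>\<^sub>M prob_algebra borel"
  by (rule measurable_return_prob_space)

lemma return_in_prob_algebra [simp]: "return borel x \<in> space (prob_algebra borel)"
  by (simp add: space_prob_algebra prob_space_return)

lemma invariant_probD:
  "invariant_prob K \<pi> \<Longrightarrow> \<pi> \<in> space (prob_algebra borel)"
  by (simp add: invariant_prob_def space_prob_algebra)

lemma invariant_prob_bind: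
  assumes [measurable]: "K \<in> borel \<rightarrow>\<^sub>M prob_algebra borel" and \<pi>: "invariant_prob K \<pi>"
  shows "\<pi> \<bind> K = \<pi>"
  using \<pi> sets_bind'[OF invariant_probD[OF \<pi>] assms(1)]
  by (intro measure_eqI)
    (auto simp: emeasure_bind_prob_algebra[OF invariant_probD[OF \<pi>] assms(1)] invariant_prob_def)

lemma measurable_kernel_iter [measurable]:
  assumes [measurable]: "K \<in> borel \<rightarrow>\<^sub>M prob_algebra borel"
  shows "kernel_iter K m \<in> borel \<rightarrow>\<^sub>M prob_algebra borel"
proof (induction m)
  case (Suc m)
  have "kernel_iter K (Suc m) = (\<lambda>x. kernel_iter K m x \<bind> K)" by (simp add: fun_eq_iff)
  then show ?case by (simp only: measurable_bind_prob_space[OF Suc assms])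
next
  case 0
  have "kernel_iter K 0 = return borel" by (simp add: fun_eq_iff)
  then show ?case by (simp only: measurable_return_borel)
qed

locale hmm =
  fixes K :: "'x::polish_space \<Rightarrow> 'x measure" and \<mu> :: "'y::polish_space measure"
    and G :: "'x \<Rightarrow> 'y \<Rightarrow> real"
  assumes kernel [measurable]: "K \<in> borel \<rightarrow>\<^sub>M prob_algebra borel"
    and sets_\<mu> [simp, measurable_cong]: "sets \<mu> = sets borel"
    and sigma_finite_\<mu>: "sigma_finite_measure \<mu>"
    and G_measurable [measurable]: "(\<lambda>(x, y). G x y) \<in> borel_measurable (borel \<Otimes>\<^sub>M borel)"
    and G_nonneg: "\<And>x y. 0 \<le> G x y"
    and G_int: "\<And>x. (\<integral>\<^sup>+y. ennreal (G x y) \<partial>\<mu>) = 1"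
begin

sublocale \<mu>: sigma_finite_measure \<mu> by (rule sigma_finite_\<mu>)

abbreviation XY :: "('x \<times> 'y) measure" where "XY \<equiv> borel \<Otimes>\<^sub>M borel"
abbreviation paths :: "(nat \<Rightarrow> 'x \<times> 'y) measure" where "paths \<equiv> PiM UNIV (\<lambda>_. XY)"

lemma space_\<mu> [simp]: "space \<mu> = UNIV"
  using sets_eq_imp_space_eq[OF sets_\<mu>] by simp

text \<open>The conditional law of an observation given the hidden state. As a kernel it brings
  \<open>joint_law\<close> under the measurability rules for \<open>bind\<close>.\<close>

definition emission :: "'x \<Rightarrow> 'y measure" where
  "emission x = density \<mu> (\<lambda>y. ennreal (G x y))"

lemma sets_emission [simp, measurable_cong]: "sets (emission x) = sets borel"
  by (simp add: emission_def)

lemma nn_integral_emission: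
  assumes [measurable]: "f \<in> borel_measurable borel"
  shows "(\<integral>\<^sup>+y. f y \<partial>emission x) = (\<integral>\<^sup>+y. ennreal (G x y) * f y \<partial>\<mu>)"
  unfolding emission_def by (subst nn_integral_density) auto

lemma measurable_emission [measurable]: "emission \<in> borel \<rightarrow>\<^sub>M prob_algebra borel"
proof (rule measurable_prob_algebraI)
  show p: "prob_space (emission x)" for x
    by (rule prob_spaceI) (simp add: emission_def emeasure_density G_int)
  show "emission \<in> borel \<rightarrow>\<^sub>M subprob_algebra borel"
  proof (rule measurable_subprob_algebra)
    fix A :: "'y set" assume A [measurable]: "A \<in> sets borel"
    have "(\<lambda>x. \<integral>\<^sup>+y. ennreal (G x y) * indicator A y \<partial>\<mu>) \<in> borel_measurable borel"
      by measurable
    then show "(\<lambda>x. emeasure (emission x) A) \<in> borel_measurable borel"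
      by (simp add: emission_def emeasure_density)
  qed (auto intro: p prob_space_imp_subprob_space)
qed

text \<open>The density form does not show measurability in \<open>\<nu>\<close>; the
  \<open>bind\<close> form does, and Tonelli for the \<sigma>-finite \<open>\<mu>\<close> identifies
  the two.\<close>

lemma joint_law_eq:
  assumes \<nu>: "\<nu> \<in> space (prob_algebra borel)"
  shows "joint_law \<mu> G \<nu> = \<nu> \<bind> (\<lambda>x. distr (emission x) XY (Pair x))"
proof (rule measure_eqI)
  have s [measurable_cong]: "sets \<nu> = sets borel" using \<nu> by (simp add: space_prob_algebra)
  have D: "(\<lambda>x. distr (emission x) XY (Pair x)) \<in> borel \<rightarrow>\<^sub>M prob_algebra XY" by measurable
  have sj: "sets (joint_law \<mu> G \<nu>) = sets XY"
    unfolding joint_law_def by (simp only: sets_density sets_pair_measure_cong[OF s sets_\<mu>])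
  then show "sets (joint_law \<mu> G \<nu>) = sets (\<nu> \<bind> (\<lambda>x. distr (emission x) XY (Pair x)))"
    by (simp add: sets_bind'[OF \<nu> D])
  fix A assume "A \<in> sets (joint_law \<mu> G \<nu>)"
  then have A [measurable]: "A \<in> sets XY" by (simp add: sj)
  have "emeasure (joint_law \<mu> G \<nu>) A = (\<integral>\<^sup>+z. (case z of (x, y) \<Rightarrow> ennreal (G x y)) * indicator A z \<partial>(\<nu> \<Otimes>\<^sub>M \<mu>))"
    unfolding joint_law_def by (rule emeasure_density) auto
  also have "\<dots> = (\<integral>\<^sup>+x. \<integral>\<^sup>+y. ennreal (G x y) * indicator A (x, y) \<partial>\<mu> \<partial>\<nu>)"
    by (subst \<mu>.nn_integral_fst[symmetric]) auto
  also have "\<dots> = (\<integral>\<^sup>+x. emeasure (distr (emission x) XY (Pair x)) A \<partial>\<nu>)"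
  proof (rule nn_integral_cong)
    fix x
    have "(\<integral>\<^sup>+y. ennreal (G x y) * indicator A (x, y) \<partial>\<mu>) = (\<integral>\<^sup>+y. indicator A (x, y) \<partial>emission x)"
      by (rule nn_integral_emission[symmetric]) measurable
    also have "\<dots> = (\<integral>\<^sup>+z. indicator A z \<partial>distr (emission x) XY (Pair x))"
      by (rule nn_integral_distr[symmetric]) auto
    finally show "(\<integral>\<^sup>+y. ennreal (G x y) * indicator A (x, y) \<partial>\<mu>) = emeasure (distr (emission x) XY (Pair x)) A"
      by simp
  qed
  also have "\<dots> = emeasure (\<nu> \<bind> (\<lambda>x. distr (emission x) XY (Pair x))) A"
    by (rule emeasure_bind_prob_algebra[OF \<nu> D A, symmetric])
  finally show "emeasure (joint_law \<mu> G \<nu>) A = emeasure (\<nu> \<bind> (\<lambda>x. distr (emission x) XY (Pair x))) A" .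
qed

lemma measurable_joint_law [measurable]: "joint_law \<mu> G \<in> prob_algebra borel \<rightarrow>\<^sub>M prob_algebra XY"
proof -
  have "(\<lambda>\<nu>. \<nu> \<bind> (\<lambda>x. distr (emission x) XY (Pair x))) \<in> prob_algebra borel \<rightarrow>\<^sub>M prob_algebra XY"
    by (rule measurable_bind_prob_space) measurable
  then show ?thesis
    by (rule measurable_cong[THEN iffD1, rotated]) (simp add: joint_law_eq)
qed

lemma nn_integral_joint_law:
  assumes \<nu>: "\<nu> \<in> space (prob_algebra borel)" and [measurable]: "F \<in> borel_measurable XY"
  shows "(\<integral>\<^sup>+z. F z \<partial>joint_law \<mu> G \<nu>) = (\<integral>\<^sup>+x. \<integral>\<^sup>+y. ennreal (G x y) * F (x, y) \<partial>\<mu> \<partial>\<nu>)"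
proof -
  have D: "(\<lambda>x. distr (emission x) XY (Pair x)) \<in> borel \<rightarrow>\<^sub>M prob_algebra XY" by measurable
  show ?thesis
    unfolding joint_law_eq[OF \<nu>] kernel_nn_integral[OF D assms(2) \<nu>]
    by (intro nn_integral_cong) (subst nn_integral_distr, auto simp: nn_integral_emission)
qed

section \<open>Markov property and stationarity of the joint chain\<close>

abbreviation joint_kernel :: "'x \<times> 'y \<Rightarrow> ('x \<times> 'y) measure" where
  "joint_kernel \<equiv> \<lambda>(x, y). joint_law \<mu> G (K x)"

sublocale joint: markov_kernel XY joint_kernel
  by standard measurable

abbreviation law :: "'x measure \<Rightarrow> (nat \<Rightarrow> 'x \<times> 'y) measure" where
  "law \<equiv> hmm_law K \<mu> G"

abbreviation law_from :: "'x \<Rightarrow> (nat \<Rightarrow> 'x \<times> 'y) measure" where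
  "law_from x \<equiv> law (return borel x)"

lemma measurable_law [measurable]: "law \<in> prob_algebra borel \<rightarrow>\<^sub>M prob_algebra paths"
  unfolding hmm_law_def[abs_def] by measurable

lemma sets_law [simp, measurable_cong]: "\<nu> \<in> space (prob_algebra borel) \<Longrightarrow> sets (law \<nu>) = sets paths"
  and space_law [simp]: "\<nu> \<in> space (prob_algebra borel) \<Longrightarrow> space (law \<nu>) = space paths"
  and prob_space_law: "\<nu> \<in> space (prob_algebra borel) \<Longrightarrow> prob_space (law \<nu>)"
  using measurable_space[OF measurable_law, of \<nu>]
  by (auto simp: space_prob_algebra dest: sets_eq_imp_space_eq)

lemma kernel_space [simp]: "K x \<in> space (prob_algebra borel)"
  using measurable_space[OF kernel] by simp

text \<open>The joint kernel ignores the observation, so the future after \<open>(x, y)\<close> has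
  the law \<open>law (K x)\<close> whatever \<open>y\<close> is.\<close>

lemma nn_integral_law_first_step:
  assumes \<nu>: "\<nu> \<in> space (prob_algebra borel)" and F [measurable]: "F \<in> borel_measurable paths"
  shows "(\<integral>\<^sup>+\<omega>. F \<omega> \<partial>law \<nu>) =
    (\<integral>\<^sup>+x. \<integral>\<^sup>+y. ennreal (G x y) * (\<integral>\<^sup>+\<omega>. F (case_nat (x, y) \<omega>) \<partial>law (K x)) \<partial>\<mu> \<partial>\<nu>)"
proof -
  have j: "joint_law \<mu> G \<nu> \<in> space (prob_algebra XY)"
    using measurable_space[OF measurable_joint_law \<nu>] .
  have "(\<integral>\<^sup>+\<omega>. F \<omega> \<partial>law \<nu>) = (\<integral>\<^sup>+z. \<integral>\<^sup>+\<omega>. F (case_nat z \<omega>) \<partial>law (K (fst z)) \<partial>joint_law \<mu> G \<nu>)"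
    unfolding hmm_law_def joint.nn_integral_markov_law_first_step[OF j F] by (simp add: split_beta)
  also have "\<dots> = (\<integral>\<^sup>+x. \<integral>\<^sup>+y. ennreal (G x y) * (\<integral>\<^sup>+\<omega>. F (case_nat (x, y) \<omega>) \<partial>law (K x)) \<partial>\<mu> \<partial>\<nu>)"
    by (subst nn_integral_joint_law[OF \<nu>]) auto
  finally show ?thesis .
qed

lemma nn_integral_law_X0:
  assumes \<nu>: "\<nu> \<in> space (prob_algebra borel)" and [measurable]: "f \<in> borel_measurable borel"
  shows "(\<integral>\<^sup>+\<omega>. f (fst (\<omega> 0)) \<partial>law \<nu>) = (\<integral>\<^sup>+x. f x \<partial>\<nu>)"
proof -
  have "(\<integral>\<^sup>+\<omega>. f (fst (\<omega> 0)) \<partial>law \<nu>) = (\<integral>\<^sup>+x. \<integral>\<^sup>+y. ennreal (G x y) * (\<integral>\<^sup>+\<omega>. f x \<partial>law (K x)) \<partial>\<mu> \<partial>\<nu>)"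
    by (subst nn_integral_law_first_step[OF \<nu>]) auto
  also have "\<dots> = (\<integral>\<^sup>+x. f x \<partial>\<nu>)"
    using prob_space.emeasure_space_1[OF prob_space_law[OF kernel_space]]
    by (simp add: nn_integral_multc G_int cong: nn_integral_cong_simp)
  finally show ?thesis .
qed

lemma nn_integral_law_mixture:
  assumes \<nu>: "\<nu> \<in> space (prob_algebra borel)" and F [measurable]: "F \<in> borel_measurable paths"
  shows "(\<integral>\<^sup>+\<omega>. F \<omega> \<partial>law \<nu>) = (\<integral>\<^sup>+x. \<integral>\<^sup>+\<omega>. F \<omega> \<partial>law_from x \<partial>\<nu>)"
  unfolding nn_integral_law_first_step[OF \<nu> F]
proof (rule nn_integral_cong)
  fix x
  show "(\<integral>\<^sup>+y. ennreal (G x y) * (\<integral>\<^sup>+\<omega>. F (case_nat (x, y) \<omega>) \<partial>law (K x)) \<partial>\<mu>) = (\<integral>\<^sup>+\<omega>. F \<omega> \<partial>law_from x)"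
    unfolding nn_integral_law_first_step[OF return_in_prob_algebra F]
    by (subst nn_integral_return) auto
qed

text \<open>\<open>comb_seq n\<close> keeps the coordinates below \<open>n\<close>; from time
  \<open>n\<close> on the path is drawn afresh from the hidden state, observation \<open>n\<close>
  included. This is legitimate because that observation depends on the past only through its own
  state. Induction on \<open>n\<close> by the first step.\<close>

lemma nn_integral_law_markov:
  assumes \<nu>: "\<nu> \<in> space (prob_algebra borel)" and F [measurable]: "F \<in> borel_measurable paths"
  shows "(\<integral>\<^sup>+\<omega>. F \<omega> \<partial>law \<nu>) = (\<integral>\<^sup>+\<omega>. \<integral>\<^sup>+\<omega>'. F (comb_seq n \<omega> \<omega>') \<partial>law_from (fst (\<omega> n)) \<partial>law \<nu>)"
  using \<nu> F
proof (induction n arbitrary: \<nu> F)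
  case (0 \<nu> F)
  note 0 [measurable]
  have "comb_seq 0 \<omega> \<omega>' = \<omega>'" for \<omega> \<omega>' :: "nat \<Rightarrow> 'x \<times> 'y" by (rule comb_seq_0)
  then show ?case
    using nn_integral_law_X0[OF \<open>\<nu> \<in> _\<close>, of "\<lambda>x. \<integral>\<^sup>+\<omega>'. F \<omega>' \<partial>law_from x"]
    by (simp add: nn_integral_law_mixture[OF 0])
next
  case (Suc n \<nu> F)
  note Suc.prems [measurable]
  define F' where "F' \<omega> = (\<integral>\<^sup>+\<omega>'. F (comb_seq (Suc n) \<omega> \<omega>') \<partial>law_from (fst (\<omega> (Suc n))))" for \<omega>
  have [measurable]: "F' \<in> borel_measurable paths"
    unfolding F'_def[abs_def] by measurable
  have g: "comb_seq (Suc n) (case_nat z \<omega>) \<omega>' = case_nat z (comb_seq n \<omega> \<omega>')" for z \<omega> and \<omega>' :: "nat \<Rightarrow> 'x \<times> 'y"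
    by (simp add: case_nat_comb_seq')
  have e: "(\<integral>\<^sup>+\<omega>. F (case_nat (x, y) \<omega>) \<partial>law (K x)) = (\<integral>\<^sup>+\<omega>. F' (case_nat (x, y) \<omega>) \<partial>law (K x))" for x y
  proof -
    have m: "(\<lambda>\<omega>. F (case_nat (x, y) \<omega>)) \<in> borel_measurable paths" by measurable
    show ?thesis unfolding F'_def g using Suc.IH[OF kernel_space m] by simp
  qed
  have "(\<integral>\<^sup>+\<omega>. F \<omega> \<partial>law \<nu>) =
    (\<integral>\<^sup>+x. \<integral>\<^sup>+y. ennreal (G x y) * (\<integral>\<^sup>+\<omega>. F' (case_nat (x, y) \<omega>) \<partial>law (K x)) \<partial>\<mu> \<partial>\<nu>)"
    unfolding nn_integral_law_first_step[OF Suc.prems] e ..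
  also have "\<dots> = (\<integral>\<^sup>+\<omega>. F' \<omega> \<partial>law \<nu>)"
    by (rule nn_integral_law_first_step[symmetric]) (auto simp: Suc.prems)
  finally show ?case by (simp add: F'_def)
qed

lemma nn_integral_law_from_X:
  "f \<in> borel_measurable borel \<Longrightarrow>
    (\<integral>\<^sup>+\<omega>. f (fst (\<omega> m)) \<partial>law_from x) = (\<integral>\<^sup>+x'. f x' \<partial>kernel_iter K m x)"
proof (induction m arbitrary: f)
  case (0 f)
  show ?case
    unfolding nn_integral_law_X0[OF return_in_prob_algebra 0] by simp
next
  case (Suc m f)
  note Suc.prems [measurable]
  have k: "kernel_iter K m x \<in> space (prob_algebra borel)"
    using measurable_space[OF measurable_kernel_iter[OF kernel]] by simp
  have g: "comb_seq m \<omega> \<omega>' (Suc m) = \<omega>' 1" for \<omega> and \<omega>' :: "nat \<Rightarrow> 'x \<times> 'y"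
    by (simp add: comb_seq_def)
  have *: "(\<integral>\<^sup>+\<omega>. f (fst (\<omega> 1)) \<partial>law_from x) = (\<integral>\<^sup>+x'. f x' \<partial>K x)" for x
  proof -
    have "(\<integral>\<^sup>+\<omega>. f (fst (\<omega> 1)) \<partial>law_from x) =
      (\<integral>\<^sup>+x. \<integral>\<^sup>+y. ennreal (G x y) * (\<integral>\<^sup>+\<omega>. f (fst (\<omega> 0)) \<partial>law (K x)) \<partial>\<mu> \<partial>return borel x)"
      by (subst nn_integral_law_first_step) auto
    also have "\<dots> = (\<integral>\<^sup>+x. \<integral>\<^sup>+x'. f x' \<partial>K x \<partial>return borel x)"
      by (simp add: nn_integral_multc G_int nn_integral_law_X0)
    finally show ?thesis by (simp add: nn_integral_return)
  qed
  have "(\<integral>\<^sup>+\<omega>. f (fst (\<omega> (Suc m))) \<partial>law_from x) =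
     (\<integral>\<^sup>+\<omega>. \<integral>\<^sup>+x'. f x' \<partial>K (fst (\<omega> m)) \<partial>law_from x)"
    by (subst nn_integral_law_markov[where n=m]) (auto simp: g * simp del: One_nat_def)
  also have "\<dots> = (\<integral>\<^sup>+x'. f x' \<partial>kernel_iter K (Suc m) x)"
    by (subst Suc.IH) (auto simp: kernel_nn_integral[OF kernel Suc.prems k])
  finally show ?case .
qed

lemma nn_integral_law_seq_shift:
  assumes \<pi>: "invariant_prob K \<pi>" and "F \<in> borel_measurable paths"
  shows "(\<integral>\<^sup>+\<omega>. F (seq_shift n \<omega>) \<partial>law \<pi>) = (\<integral>\<^sup>+\<omega>. F \<omega> \<partial>law \<pi>)"
  using assms(2)
proof (induction n arbitrary: F)
  case (Suc n F)
  note Suc.prems [measurable]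
  note p = invariant_probD[OF \<pi>]
  have m: "(\<lambda>x. \<integral>\<^sup>+\<omega>. F \<omega> \<partial>law_from x) \<in> borel_measurable borel" by measurable
  have s: "(\<lambda>\<omega>. F (seq_shift (Suc 0) \<omega>)) \<in> borel_measurable paths" by measurable
  have "(\<integral>\<^sup>+\<omega>. F (seq_shift (Suc n) \<omega>) \<partial>law \<pi>) = (\<integral>\<^sup>+\<omega>. F (seq_shift (Suc 0) (seq_shift n \<omega>)) \<partial>law \<pi>)"
    by (simp add: seq_shift_seq_shift)
  also have "\<dots> = (\<integral>\<^sup>+\<omega>. F (seq_shift (Suc 0) \<omega>) \<partial>law \<pi>)"
    by (rule Suc.IH[OF s])
  also have "\<dots> = (\<integral>\<^sup>+x. \<integral>\<^sup>+\<omega>. F \<omega> \<partial>law (K x) \<partial>\<pi>)"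
    by (subst nn_integral_law_first_step[OF p s]) (simp add: seq_shift_case_nat nn_integral_multc G_int)
  also have "\<dots> = (\<integral>\<^sup>+x. \<integral>\<^sup>+x'. \<integral>\<^sup>+\<omega>. F \<omega> \<partial>law_from x' \<partial>K x \<partial>\<pi>)"
    by (simp add: nn_integral_law_mixture[OF kernel_space Suc.prems])
  also have "\<dots> = (\<integral>\<^sup>+x. \<integral>\<^sup>+\<omega>. F \<omega> \<partial>law_from x \<partial>\<pi>)"
    using kernel_nn_integral[OF kernel m p] by (simp add: invariant_prob_bind[OF kernel \<pi>])
  also have "\<dots> = (\<integral>\<^sup>+\<omega>. F \<omega> \<partial>law \<pi>)"
    by (rule nn_integral_law_mixture[OF p Suc.prems, symmetric])
  finally show ?case .
qed simp

end

section \<open>A mean ergodic theorem for Markov kernels\<close>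

text \<open>Bounded Borel functions are integrable for all probability measures at once, so no
  integrability has to be tracked along an orbit. The bound holds everywhere and not almost
  everywhere, since it is used under \<open>\<pi>\<close> and under every
  \<open>K x\<close>.\<close>

definition bounded_by :: "real \<Rightarrow> ('x::topological_space \<Rightarrow> real) \<Rightarrow> bool" where
  "bounded_by C f \<longleftrightarrow> f \<in> borel_measurable borel \<and> (\<forall>x. \<bar>f x\<bar> \<le> C)"

lemma bounded_byD [dest]: "bounded_by C f \<Longrightarrow> f \<in> borel_measurable borel" "bounded_by C f \<Longrightarrow> \<bar>f x\<bar> \<le> C"
  by (auto simp: bounded_by_def)

lemma integrable_bounded_by:
  assumes "prob_space M" "sets M = sets borel" "bounded_by C f" shows "integrable M f"
proof -
  interpret prob_space M by fact
  show ?thesis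
    using assms(3) by (intro integrable_const_bound[where B=C])
      (auto simp: bounded_by_def measurable_cong_sets[OF assms(2) refl])
qed

text \<open>Jensen for the square, read off from the nonnegative variance.\<close>

lemma (in prob_space) integral_square_ge:
  fixes f :: "'a \<Rightarrow> real"
  assumes "integrable M f" "integrable M (\<lambda>x. (f x)\<^sup>2)"
  shows "(\<integral>x. f x \<partial>M)\<^sup>2 \<le> (\<integral>x. (f x)\<^sup>2 \<partial>M)"
  using variance_positive[of f] variance_eq[OF assms] by simp

section \<open>The Markov operator as a contraction of L2\<close>

definition kernel_op :: "('x \<Rightarrow> 'x measure) \<Rightarrow> ('x \<Rightarrow> real) \<Rightarrow> 'x \<Rightarrow> real" where
  "kernel_op K f x = (\<integral>x'. f x' \<partial>K x)"

definition orbit_sum :: "('x \<Rightarrow> 'x measure) \<Rightarrow> nat \<Rightarrow> ('x \<Rightarrow> real) \<Rightarrow> 'x \<Rightarrow> real" where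
  "orbit_sum K n f x = (\<Sum>k<n. (kernel_op K ^^ k) f x)"

locale invariant_kernel =
  fixes K :: "'x::topological_space \<Rightarrow> 'x measure" and \<pi> :: "'x measure"
  assumes kernel [measurable]: "K \<in> borel \<rightarrow>\<^sub>M prob_algebra borel"
    and invariant: "invariant_prob K \<pi>"
begin

sublocale \<pi>: prob_space \<pi>
  using invariant by (simp add: invariant_prob_def)

lemma sets_\<pi> [simp, measurable_cong]: "sets \<pi> = sets borel"
  using invariant by (simp add: invariant_prob_def)

lemma prob_space_K: "prob_space (K x)" and sets_K [simp]: "sets (K x) = sets borel"
  using measurable_space[OF kernel, of x] by (auto simp: space_prob_algebra)

lemma kernel_subprob: "K \<in> borel \<rightarrow>\<^sub>M subprob_algebra borel"
  by (rule measurable_prob_algebraD[OF kernel])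

lemma integrable_K: "bounded_by C f \<Longrightarrow> integrable (K x) f"
  by (rule integrable_bounded_by[OF prob_space_K]) auto

lemma integrable_\<pi>: "bounded_by C f \<Longrightarrow> integrable \<pi> f"
  by (rule integrable_bounded_by[OF \<pi>.prob_space_axioms]) auto

lemma bounded_by_kernel_op:
  assumes f: "bounded_by C f" shows "bounded_by C (kernel_op K f)"
  unfolding bounded_by_def
proof (intro conjI allI)
  show "kernel_op K f \<in> borel_measurable borel"
    unfolding kernel_op_def[abs_def]
    using measurable_compose[OF kernel_subprob integral_measurable_subprob_algebra[OF bounded_byD(1)[OF f]]] by simp
  fix x
  interpret prob_space "K x" by (rule prob_space_K)
  have "\<bar>kernel_op K f x\<bar> \<le> (\<integral>x'. \<bar>f x'\<bar> \<partial>K x)"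
    unfolding kernel_op_def by (rule integral_abs_bound)
  also have "\<dots> \<le> (\<integral>x'. C \<partial>K x)"
    using f integrable_K[OF f, of x] by (intro integral_mono) auto
  finally show "\<bar>kernel_op K f x\<bar> \<le> C" by (simp add: prob_space)
qed

lemma bounded_by_funpow: "bounded_by C f \<Longrightarrow> bounded_by C ((kernel_op K ^^ k) f)"
  by (induction k) (auto intro: bounded_by_kernel_op)

lemma bounded_by_square: "bounded_by C f \<Longrightarrow> bounded_by (C\<^sup>2) (\<lambda>x. (f x)\<^sup>2)"
  unfolding bounded_by_def by (auto simp: abs_le_square_iff[symmetric] intro: order_trans[OF _ abs_ge_self])

lemma bounded_by_sum:
  "(\<And>i. i \<in> I \<Longrightarrow> bounded_by C (f i)) \<Longrightarrow> bounded_by (real (card I) * C) (\<lambda>x. \<Sum>i\<in>I. f i x)"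
  unfolding bounded_by_def
  by (intro conjI borel_measurable_sum allI order_trans[OF sum_abs] sum_bounded_above) auto

lemma bounded_by_cmult: "bounded_by C f \<Longrightarrow> bounded_by (\<bar>a\<bar> * C) (\<lambda>x. a * f x)"
  unfolding bounded_by_def by (auto simp: abs_mult intro: mult_left_mono)

lemma kernel_op_sum:
  "(\<And>i. i \<in> I \<Longrightarrow> bounded_by C (f i)) \<Longrightarrow> kernel_op K (\<lambda>x. \<Sum>i\<in>I. f i x) = (\<lambda>x. \<Sum>i\<in>I. kernel_op K (f i) x)"
  unfolding kernel_op_def fun_eq_iff
  by (auto intro!: Bochner_Integration.integral_sum integrable_K[of C])

lemma kernel_op_cmult: "kernel_op K (\<lambda>x. a * f x) = (\<lambda>x. a * kernel_op K f x)"
  unfolding kernel_op_def by simp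

lemma funpow_sum:
  "(\<And>i. i \<in> I \<Longrightarrow> bounded_by C (f i)) \<Longrightarrow>
    (kernel_op K ^^ k) (\<lambda>x. \<Sum>i\<in>I. f i x) = (\<lambda>x. \<Sum>i\<in>I. (kernel_op K ^^ k) (f i) x)"
proof (induction k)
  case (Suc k)
  then show ?case
    using kernel_op_sum[of I C "\<lambda>i. (kernel_op K ^^ k) (f i)"] bounded_by_funpow by simp
qed simp

lemma funpow_cmult: "(kernel_op K ^^ k) (\<lambda>x. a * f x) = (\<lambda>x. a * (kernel_op K ^^ k) f x)"
  by (induction k) (simp_all add: kernel_op_cmult)

lemma integral_kernel_op:
  assumes f: "bounded_by C f" shows "(\<integral>x. kernel_op K f x \<partial>\<pi>) = (\<integral>x. f x \<partial>\<pi>)"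
proof -
  have "(\<integral>x. f x \<partial>(\<pi> \<bind> K)) = (\<integral>x. kernel_op K f x \<partial>\<pi>)"
    unfolding kernel_op_def
  proof (rule integral_bind[where K=borel and B=C and B'=1])
    show "K \<in> \<pi> \<rightarrow>\<^sub>M subprob_algebra borel"
      using kernel_subprob by (simp add: measurable_cong_sets[OF sets_\<pi> refl])
    show "AE x in \<pi>. emeasure (K x) (space (K x)) \<le> ennreal 1"
      using prob_space.emeasure_space_1[OF prob_space_K] by simp
  qed (use f in \<open>auto intro: \<pi>.finite_measure_axioms\<close>)
  then show ?thesis by (simp add: invariant_prob_bind[OF kernel invariant])
qed

text \<open>The squared norm in the L2 space of \<open>\<pi>\<close>.\<close>

definition energy :: "('x \<Rightarrow> real) \<Rightarrow> real" where
  "energy f = (\<integral>x. (f x)\<^sup>2 \<partial>\<pi>)"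

lemma energy_nonneg: "0 \<le> energy f"
  unfolding energy_def by simp

text \<open>Jensen inside each \<open>K x\<close>, then invariance of \<open>\<pi>\<close>.\<close>

lemma energy_kernel_op:
  assumes f: "bounded_by C f" shows "energy (kernel_op K f) \<le> energy f"
proof -
  have "energy (kernel_op K f) \<le> (\<integral>x. kernel_op K (\<lambda>x. (f x)\<^sup>2) x \<partial>\<pi>)"
    unfolding energy_def
  proof (rule integral_mono)
    fix x
    show "(kernel_op K f x)\<^sup>2 \<le> kernel_op K (\<lambda>x. (f x)\<^sup>2) x"
      unfolding kernel_op_def
      by (intro prob_space.integral_square_ge[OF prob_space_K] integrable_K[OF f] integrable_K[OF bounded_by_square[OF f]])
  qed (intro integrable_\<pi>[OF bounded_by_square[OF bounded_by_kernel_op[OF f]]]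
        integrable_\<pi>[OF bounded_by_kernel_op[OF bounded_by_square[OF f]]])+
  also have "\<dots> = energy f"
    unfolding energy_def by (rule integral_kernel_op[OF bounded_by_square[OF f]])
  finally show ?thesis .
qed

lemma energy_funpow: "bounded_by C f \<Longrightarrow> energy ((kernel_op K ^^ k) f) \<le> energy f"
  by (induction k) (auto intro: order_trans[OF energy_kernel_op[OF bounded_by_funpow]])

lemma energy_cmult: "energy (\<lambda>x. a * f x) = a\<^sup>2 * energy f"
  by (simp add: energy_def power_mult_distrib)

lemma bounded_by_orbit_sum: "bounded_by C f \<Longrightarrow> bounded_by (real n * C) (orbit_sum K n f)"
  using bounded_by_sum[of "{..<n}" C "\<lambda>k. (kernel_op K ^^ k) f"] bounded_by_funpow
  unfolding orbit_sum_def[abs_def] by simp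

text \<open>Cauchy-Schwarz over the \<open>n\<close> terms, each of energy at most that of
  \<open>f\<close>.\<close>

lemma energy_orbit_sum:
  assumes f: "bounded_by C f" shows "energy (orbit_sum K n f) \<le> (real n)\<^sup>2 * energy f"
proof -
  note b = bounded_by_square[OF bounded_by_funpow[OF f]]
  have "energy (orbit_sum K n f) \<le> (\<integral>x. real n * (\<Sum>k<n. ((kernel_op K ^^ k) f x)\<^sup>2) \<partial>\<pi>)"
    unfolding energy_def
  proof (rule integral_mono)
    show "integrable \<pi> (\<lambda>x. (orbit_sum K n f x)\<^sup>2)"
      by (rule integrable_\<pi>[OF bounded_by_square[OF bounded_by_orbit_sum[OF f]]])
    show "integrable \<pi> (\<lambda>x. real n * (\<Sum>k<n. ((kernel_op K ^^ k) f x)\<^sup>2))"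
      by (intro integrable_mult_right Bochner_Integration.integrable_sum integrable_\<pi>[OF b])
    fix x
    show "(orbit_sum K n f x)\<^sup>2 \<le> real n * (\<Sum>k<n. ((kernel_op K ^^ k) f x)\<^sup>2)"
      unfolding orbit_sum_def using sum_squared_le_sum_of_squares[of "\<lambda>k. (kernel_op K ^^ k) f x" "{..<n}"]
      by (simp add: mult.commute)
  qed
  also have "\<dots> = real n * (\<Sum>k<n. energy ((kernel_op K ^^ k) f))"
    unfolding energy_def using integrable_\<pi>[OF b]
    by (simp add: Bochner_Integration.integral_sum)
  also have "\<dots> \<le> real n * (\<Sum>k<n. energy f)"
    by (intro mult_left_mono sum_mono energy_funpow[OF f]) simp
  finally show ?thesis by (simp add: power2_eq_square)
qed

text \<open>The difference of squares is factored. For orbit sums \<open>A\<close> grows like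
  \<open>n\<close> while \<open>D\<close> stays fixed, so the energies of the averages differ by
  order \<open>1 / n\<close>.\<close>

lemma energy_diff:
  assumes u: "bounded_by A u" and v: "bounded_by A v" and d: "\<And>x. \<bar>u x - v x\<bar> \<le> D"
  shows "energy v \<le> energy u + 2 * A * D"
proof -
  have "energy v \<le> (\<integral>x. (u x)\<^sup>2 + 2 * A * D \<partial>\<pi>)"
    unfolding energy_def
  proof (rule integral_mono)
    show "integrable \<pi> (\<lambda>x. (u x)\<^sup>2 + 2 * A * D)"
      using integrable_\<pi>[OF bounded_by_square[OF u]] by simp
    fix x
    have "(v x)\<^sup>2 - (u x)\<^sup>2 = (v x + u x) * (v x - u x)"
      by (simp add: power2_eq_square algebra_simps)
    also have "\<dots> \<le> \<bar>v x + u x\<bar> * \<bar>v x - u x\<bar>" by (simp flip: abs_mult)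
    also have "\<dots> \<le> (2 * A) * D"
      using bounded_byD(2)[OF u, of x] bounded_byD(2)[OF v, of x] d[of x]
      by (intro mult_mono) auto
    finally show "(v x)\<^sup>2 \<le> (u x)\<^sup>2 + 2 * A * D" by simp
  qed (rule integrable_\<pi>[OF bounded_by_square[OF v]])
  also have "\<dots> = energy u + 2 * A * D"
    using integrable_\<pi>[OF bounded_by_square[OF u]] by (simp add: energy_def \<pi>.prob_space)
  finally show ?thesis .
qed

text \<open>
  Holds for every average \<open>g\<close> of the orbit of \<open>f\<close>, and keeps the ergodic averages of \<open>f\<close> and \<open>g\<close>
  within \<open>D / n\<close> of each other.
\<close>
definition cohomologous :: "real \<Rightarrow> ('x \<Rightarrow> real) \<Rightarrow> ('x \<Rightarrow> real) \<Rightarrow> bool" where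
  "cohomologous C f g \<longleftrightarrow> bounded_by C g \<and> (\<exists>D. \<forall>n x. \<bar>orbit_sum K n g x - orbit_sum K n f x\<bar> \<le> D)"

lemma cohomologous_refl: "bounded_by C f \<Longrightarrow> cohomologous C f f"
  unfolding cohomologous_def by (auto intro!: exI[of _ 0])

text \<open>The sums of \<open>kernel_op K g\<close> and of \<open>g\<close> telescope to two
  boundary terms, together at most \<open>2 * C\<close> when \<open>g\<close> is bounded by
  \<open>C\<close>; hence \<open>cohomologous_kernel_op\<close>.\<close>

lemma orbit_sum_kernel_op:
  "orbit_sum K n (kernel_op K g) x = orbit_sum K n g x + (kernel_op K ^^ n) g x - g x"
  unfolding orbit_sum_def
  by (induction n) (simp_all add: funpow_swap1)

lemma kernel_op_orbit_sum:
  assumes "bounded_by C g"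
  shows "kernel_op K (orbit_sum K n g) x = orbit_sum K n g x + (kernel_op K ^^ n) g x - g x"
proof -
  have "kernel_op K (orbit_sum K n g) x = (\<Sum>k<n. (kernel_op K ^^ Suc k) g x)"
    unfolding orbit_sum_def[abs_def] using kernel_op_sum[of "{..<n}" C "\<lambda>k. (kernel_op K ^^ k) g"] bounded_by_funpow[OF assms]
    by simp
  also have "\<dots> = orbit_sum K n (kernel_op K g) x"
    unfolding orbit_sum_def by (simp add: funpow_swap1)
  finally show ?thesis by (simp only: orbit_sum_kernel_op)
qed

lemma cohomologous_kernel_op:
  assumes "cohomologous C f g" shows "cohomologous C f (kernel_op K g)"
proof -
  from assms obtain D where g: "bounded_by C g"
    and D: "\<And>n x. \<bar>orbit_sum K n g x - orbit_sum K n f x\<bar> \<le> D"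
    unfolding cohomologous_def by auto
  have "\<bar>orbit_sum K n (kernel_op K g) x - orbit_sum K n f x\<bar> \<le> D + 2 * C" for n x
    using D[of n x] bounded_byD(2)[OF g, of x] bounded_byD(2)[OF bounded_by_funpow[OF g], of n x]
    by (simp add: orbit_sum_kernel_op)
  then show ?thesis
    using bounded_by_kernel_op[OF g] unfolding cohomologous_def by auto
qed

lemma cohomologous_funpow: "bounded_by C f \<Longrightarrow> cohomologous C f ((kernel_op K ^^ k) f)"
  by (induction k) (auto intro: cohomologous_refl cohomologous_kernel_op)

text \<open>Equal weights are all that is used: over an orbit they give the ergodic averages, over
  two of these the midpoints of the parallelogram law.\<close>

lemma cohomologous_average:
  assumes I: "finite I" "I \<noteq> {}" and c: "\<And>i. i \<in> I \<Longrightarrow> cohomologous C f (g i)"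
  shows "cohomologous C f (\<lambda>x. inverse (real (card I)) * (\<Sum>i\<in>I. g i x))"
proof -
  from c have "\<forall>i\<in>I. \<exists>D. \<forall>n x. \<bar>orbit_sum K n (g i) x - orbit_sum K n f x\<bar> \<le> D"
    unfolding cohomologous_def by auto
  then obtain D where D: "\<And>i n x. i \<in> I \<Longrightarrow> \<bar>orbit_sum K n (g i) x - orbit_sum K n f x\<bar> \<le> D i"
    by metis
  have b: "\<And>i. i \<in> I \<Longrightarrow> bounded_by C (g i)" using c unfolding cohomologous_def by auto
  have I0: "real (card I) > 0" using I by (simp add: card_gt_0_iff)
  have bb: "bounded_by C (\<lambda>x. inverse (real (card I)) * (\<Sum>i\<in>I. g i x))"
  proof -
    have e: "\<bar>inverse (real (card I))\<bar> * (real (card I) * C) = C" using I0 by simp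
    have "bounded_by (real (card I) * C) (\<lambda>x. \<Sum>i\<in>I. g i x)" by (rule bounded_by_sum[OF b])
    from bounded_by_cmult[OF this, where a="inverse (real (card I))"] show ?thesis unfolding e .
  qed
  have "\<bar>orbit_sum K n (\<lambda>x. inverse (real (card I)) * (\<Sum>i\<in>I. g i x)) x - orbit_sum K n f x\<bar>
    \<le> inverse (real (card I)) * (\<Sum>i\<in>I. D i)" for n x
  proof -
    have "orbit_sum K n (\<lambda>x. inverse (real (card I)) * (\<Sum>i\<in>I. g i x)) x
      = inverse (real (card I)) * (\<Sum>i\<in>I. orbit_sum K n (g i) x)"
    proof -
      have fs: "(kernel_op K ^^ k) (\<lambda>x. \<Sum>i\<in>I. g i x) = (\<lambda>x. \<Sum>i\<in>I. (kernel_op K ^^ k) (g i) x)" for k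
        by (rule funpow_sum[OF b])
      show ?thesis
        unfolding orbit_sum_def funpow_cmult fs sum_distrib_left[symmetric] by (subst sum.swap) (rule refl)
    qed
    also have "\<dots> - orbit_sum K n f x =
      inverse (real (card I)) * (\<Sum>i\<in>I. orbit_sum K n (g i) x - orbit_sum K n f x)"
      using I0 by (simp add: sum_subtractf field_simps)
    also have "\<bar>\<dots>\<bar> \<le> inverse (real (card I)) * (\<Sum>i\<in>I. D i)"
      using D unfolding abs_mult by (intro mult_mono order_trans[OF sum_abs] sum_mono) auto
    finally show ?thesis .
  qed
  then show ?thesis using bb unfolding cohomologous_def by auto
qed

section \<open>Ergodic averages and their minimal energy\<close>

definition ergodic_avg :: "nat \<Rightarrow> ('x \<Rightarrow> real) \<Rightarrow> 'x \<Rightarrow> real" where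
  "ergodic_avg n f x = inverse (real n) * orbit_sum K n f x"

lemma energy_ergodic_avg: "energy (ergodic_avg n f) = energy (orbit_sum K n f) / (real n)\<^sup>2"
  unfolding ergodic_avg_def[abs_def] energy_cmult by (simp add: field_simps)

lemma bounded_by_ergodic_avg: 
  assumes "bounded_by C f" shows "bounded_by C (ergodic_avg n f)"
proof (cases "n = 0")
  case True
  have "0 \<le> C" using bounded_byD(2)[OF assms, of undefined] by linarith
  then show ?thesis using True by (simp add: ergodic_avg_def[abs_def] bounded_by_def)
next
  case False
  then have e: "\<bar>inverse (real n)\<bar> * (real n * C) = C" by simp
  show ?thesis
    using bounded_by_cmult[OF bounded_by_orbit_sum[OF assms, of n], where a="inverse (real n)"]
    unfolding ergodic_avg_def[abs_def] e .
qed

lemma cohomologous_ergodic_avg: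
  "bounded_by C f \<Longrightarrow> n > 0 \<Longrightarrow> cohomologous C f (ergodic_avg n f)"
  using cohomologous_average[of "{..<n}" C f "\<lambda>k. (kernel_op K ^^ k) f"] cohomologous_funpow
  unfolding ergodic_avg_def[abs_def] orbit_sum_def by auto

text \<open>Length \<open>0\<close> is left out because its average is the zero function. The
  infimum turns out to be the limit of the energies.\<close>

definition min_energy :: "('x \<Rightarrow> real) \<Rightarrow> real" where
  "min_energy f = (INF n\<in>{0<..}. energy (ergodic_avg n f))"

lemma min_energy_le: "n > 0 \<Longrightarrow> min_energy f \<le> energy (ergodic_avg n f)"
  unfolding min_energy_def by (rule cINF_lower) (auto intro: bdd_belowI[of _ 0] energy_nonneg)

text \<open>The orbit sums differ by a constant and their size is at most \<open>n * C\<close>;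
  after division by the square of \<open>n\<close> the gap in energy is of order
  \<open>1 / n\<close>. Averaging does not raise the energy of \<open>g\<close>.\<close>

lemma energy_orbit_sum_cohomologous:
  assumes f: "bounded_by C f" and g: "cohomologous C f g"
  obtains D where "\<And>n. n > 0 \<Longrightarrow> energy (ergodic_avg n f) \<le> energy g + D / real n"
proof -
  from g obtain D where g: "bounded_by C g"
    and D: "\<And>n x. \<bar>orbit_sum K n g x - orbit_sum K n f x\<bar> \<le> D"
    unfolding cohomologous_def by auto
  show thesis
  proof (rule that[of "2 * C * D"])
    fix n :: nat assume n: "n > 0"
    have "energy (orbit_sum K n f) \<le> energy (orbit_sum K n g) + 2 * (real n * C) * D"
      by (rule energy_diff[OF bounded_by_orbit_sum[OF g] bounded_by_orbit_sum[OF f] D])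
    also have "\<dots> \<le> (real n)\<^sup>2 * energy g + 2 * (real n * C) * D"
      using energy_orbit_sum[OF g, of n] by simp
    finally show "energy (ergodic_avg n f) \<le> energy g + 2 * C * D / real n"
      unfolding energy_ergodic_avg using n by (simp add: field_simps power2_eq_square)
  qed
qed

text \<open>Let \<open>n\<close> tend to infinity in the preceding bound. The infimum over ergodic
  averages thus bounds every function cohomologous to \<open>f\<close> from below, midpoints of
  averages included.\<close>

lemma min_energy_le_cohomologous:
  assumes f: "bounded_by C f" and g: "cohomologous C f g"
  shows "min_energy f \<le> energy g"
proof -
  obtain D where D: "\<And>n. n > 0 \<Longrightarrow> energy (ergodic_avg n f) \<le> energy g + D / real n"
    using energy_orbit_sum_cohomologous[OF f g] by blast
  have "(\<lambda>n. energy g + D / real n) \<longlonglongrightarrow> energy g + 0"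
    by (intro tendsto_add tendsto_const lim_const_over_n)
  then have "(\<lambda>n. energy g + D / real n) \<longlonglongrightarrow> energy g" by simp
  moreover have "\<forall>\<^sub>F n in sequentially. min_energy f \<le> energy g + D / real n"
    using eventually_gt_at_top[of 0] by eventually_elim (rule order_trans[OF min_energy_le D])
  ultimately show ?thesis
    by (rule tendsto_lowerbound) simp
qed

text \<open>One average of length \<open>N\<close> with nearly minimal energy controls all long
  averages, because it is cohomologous to \<open>f\<close>; this replaces monotonicity of the
  energies.\<close>

lemma energy_ergodic_avg_tendsto:
  assumes f: "bounded_by C f"
  shows "(\<lambda>n. energy (ergodic_avg n f)) \<longlonglongrightarrow> min_energy f"
proof (rule LIMSEQ_I)
  fix e :: real assume e: "0 < e"
  have "\<exists>N>0. energy (ergodic_avg N f) < min_energy f + e / 2"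
  proof (rule ccontr)
    assume "\<not> (\<exists>N>0. energy (ergodic_avg N f) < min_energy f + e / 2)"
    then have "\<And>N. N > 0 \<Longrightarrow> min_energy f + e / 2 \<le> energy (ergodic_avg N f)"
      by (metis not_less)
    then have "min_energy f + e / 2 \<le> min_energy f"
      by (subst (2) min_energy_def) (intro cINF_greatest, auto)
    with e show False by simp
  qed
  then obtain N where N: "N > 0" "energy (ergodic_avg N f) < min_energy f + e / 2" by auto
  obtain D where D: "\<And>n. n > 0 \<Longrightarrow> energy (ergodic_avg n f) \<le> energy (ergodic_avg N f) + D / real n"
    using energy_orbit_sum_cohomologous[OF f cohomologous_ergodic_avg[OF f N(1)]] by blast
  have "(\<lambda>n. D / real n) \<longlonglongrightarrow> 0" by (rule lim_const_over_n)
  then have "\<forall>\<^sub>F n in sequentially. D / real n < e / 2"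
    using e by (intro order_tendstoD) auto
  then have "\<forall>\<^sub>F n in sequentially. norm (energy (ergodic_avg n f) - min_energy f) < e"
    using eventually_gt_at_top[of 0]
  proof eventually_elim
    case (elim n)
    then show ?case
      unfolding real_norm_def using D[OF elim(2)] N(2) min_energy_le[OF elim(2), of f] by linarith
  qed
  then show "\<exists>no. \<forall>n\<ge>no. norm (energy (ergodic_avg n f) - min_energy f) < e"
    by (simp add: eventually_sequentially)
qed

text \<open>
  Parallelogram law: the midpoint of two ergodic averages is again an average of the orbit, so its
  energy is at least the minimal one.
\<close>
lemma energy_diff_ergodic_avg:
  assumes f: "bounded_by C f" and n: "n > 0" and m: "m > 0"
  shows "energy (\<lambda>x. ergodic_avg n f x - ergodic_avg m f x)
    \<le> 2 * (energy (ergodic_avg n f) - min_energy f) + 2 * (energy (ergodic_avg m f) - min_energy f)"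
proof -
  let ?a = "ergodic_avg n f" and ?b = "ergodic_avg m f"
  let ?h = "\<lambda>x. inverse 2 * (?a x + ?b x)"
  have h: "cohomologous C f ?h"
    using cohomologous_average[of "UNIV::bool set" C f "\<lambda>b. if b then ?a else ?b"]
      cohomologous_ergodic_avg[OF f] n m by (simp add: UNIV_bool add.commute)
  have hb: "bounded_by C ?h" using h by (simp add: cohomologous_def)
  note ba = bounded_by_ergodic_avg[OF f]
  note i = integrable_\<pi>[OF bounded_by_square[OF ba]] integrable_\<pi>[OF bounded_by_square[OF hb]]
  have "energy (\<lambda>x. ?a x - ?b x) = (\<integral>x. 2 * (?a x)\<^sup>2 + 2 * (?b x)\<^sup>2 - 4 * (?h x)\<^sup>2 \<partial>\<pi>)"
    unfolding energy_def by (rule Bochner_Integration.integral_cong) (auto simp: power2_eq_square field_simps)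
  also have "\<dots> = 2 * energy ?a + 2 * energy ?b - 4 * energy ?h"
    unfolding energy_def using i by simp
  also have "\<dots> \<le> 2 * energy ?a + 2 * energy ?b - 4 * min_energy f"
    using min_energy_le_cohomologous[OF f h] by simp
  finally show ?thesis by simp
qed

text \<open>The parallelogram bound makes the averages Cauchy in L2, hence in L1, and a subsequence
  converges almost everywhere. A pointwise limit is wanted because invariance of \<open>u\<close> is
  later checked by dominated convergence under \<open>K x\<close>.\<close>

lemma ergodic_avg_limit:
  assumes f: "bounded_by C f"
  obtains r u where "strict_mono r" "bounded_by C u" "AE x in \<pi>. (\<lambda>i. ergodic_avg (r i) f x) \<longlonglongrightarrow> u x"
proof -
  note ba = bounded_by_ergodic_avg[OF f]
  have C: "0 \<le> C" using bounded_byD(2)[OF f, of undefined] by linarith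
  have bd: "bounded_by (2 * C) (\<lambda>x. ergodic_avg n f x - ergodic_avg m f x)" for n m
    unfolding bounded_by_def
  proof (intro conjI allI)
    show "(\<lambda>x. ergodic_avg n f x - ergodic_avg m f x) \<in> borel_measurable borel"
      by (intro borel_measurable_diff bounded_byD(1)[OF ba])
    show "\<bar>ergodic_avg n f x - ergodic_avg m f x\<bar> \<le> 2 * C" for x
      using bounded_byD(2)[OF ba, of n x] bounded_byD(2)[OF ba, of m x] by linarith
  qed
  obtain r where r: "strict_mono r" "AE x in \<pi>. Cauchy (\<lambda>i. ergodic_avg (r i) f x)"
  proof (rule cauchy_L1_AE_cauchy_subseq[of \<pi> "\<lambda>n. ergodic_avg n f"])
    show "integrable \<pi> (ergodic_avg n f)" for n by (rule integrable_\<pi>[OF ba])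
    fix e :: real assume e: "0 < e"
    \<comment> \<open>With both energies within a quarter of the square of \<open>e\<close> above
      the minimum, the two terms of the parallelogram bound add up to less than that square.\<close>
    have "\<forall>\<^sub>F n in sequentially. energy (ergodic_avg n f) < min_energy f + e\<^sup>2 / 4"
      using e by (intro order_tendstoD(2)[OF energy_ergodic_avg_tendsto[OF f]]) simp
    then obtain N where N: "\<And>n. n \<ge> N \<Longrightarrow> energy (ergodic_avg n f) < min_energy f + e\<^sup>2 / 4"
      by (auto simp: eventually_sequentially)
    show "\<exists>N. \<forall>i\<ge>N. \<forall>j\<ge>N. (LINT x|\<pi>. norm (ergodic_avg i f x - ergodic_avg j f x)) < e"
    proof (intro exI[of _ "Suc N"] allI impI)
      fix i j assume ij: "i \<ge> Suc N" "j \<ge> Suc N"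
      let ?d = "\<lambda>x. ergodic_avg i f x - ergodic_avg j f x"
      have "(LINT x|\<pi>. \<bar>?d x\<bar>)\<^sup>2 \<le> (LINT x|\<pi>. \<bar>?d x\<bar>\<^sup>2)"
        using integrable_\<pi>[OF bd[of i j]] integrable_\<pi>[OF bounded_by_square[OF bd[of i j]]]
        by (intro \<pi>.integral_square_ge) auto
      also have "\<dots> = energy ?d" by (simp add: energy_def)
      also have "\<dots> < e\<^sup>2"
        using energy_diff_ergodic_avg[OF f, of i j] N[of i] N[of j] ij by simp
      finally show "(LINT x|\<pi>. norm (?d x)) < e"
        using e by (simp add: power_less_imp_less_base)
    qed
  qed
  \<comment> \<open>Clipping changes nothing where the limit exists, and makes the bound hold
    everywhere, also on the null set where \<open>lim\<close> is arbitrary.\<close>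
  define u where "u x = max (-C) (min C (lim (\<lambda>i. ergodic_avg (r i) f x)))" for x
  have [measurable]: "ergodic_avg n f \<in> borel_measurable borel" for n using ba by auto
  have "bounded_by C u"
    unfolding bounded_by_def u_def using C by auto
  moreover have "AE x in \<pi>. (\<lambda>i. ergodic_avg (r i) f x) \<longlonglongrightarrow> u x"
    using r(2)
  proof eventually_elim
    case (elim x)
    then have l: "(\<lambda>i. ergodic_avg (r i) f x) \<longlonglongrightarrow> lim (\<lambda>i. ergodic_avg (r i) f x)"
      by (simp add: Cauchy_convergent_iff convergent_LIMSEQ_iff)
    have "\<And>i. \<bar>ergodic_avg (r i) f x\<bar> \<le> C" using ba by auto
    then have "\<bar>lim (\<lambda>i. ergodic_avg (r i) f x)\<bar> \<le> C"
      by (intro tendsto_upperbound[OF tendsto_rabs[OF l]]) auto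
    then have "u x = lim (\<lambda>i. ergodic_avg (r i) f x)" by (auto simp: u_def)
    with l show ?case by simp
  qed
  ultimately show thesis using r(1) that by blast
qed

text \<open>
  The conditional second moment of \<open>u(X\<^sub>1) - u(X\<^sub>0)\<close> given \<open>X\<^sub>0\<close> is \<open>K u\<^sup>2 - u\<^sup>2\<close>, whose mean under \<open>\<pi>\<close> is zero.
\<close>
lemma AE_kernel_eq:
  assumes u: "bounded_by C u" and inv: "AE x in \<pi>. kernel_op K u x = u x"
  shows "AE x in \<pi>. AE x' in K x. u x' = u x"
proof -
  note u2 = bounded_by_square[OF u]
  define v where "v x = kernel_op K (\<lambda>x. (u x)\<^sup>2) x - 2 * u x * kernel_op K u x + (u x)\<^sup>2" for x
  have int_uu: "(\<integral>x'. (u x' - u x)\<^sup>2 \<partial>K x) = v x" and int_d: "integrable (K x) (\<lambda>x'. (u x' - u x)\<^sup>2)" for x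
  proof -
    interpret prob_space "K x" by (rule prob_space_K)
    have "(u x' - u x)\<^sup>2 = (u x')\<^sup>2 - 2 * u x * u x' + (u x)\<^sup>2" for x'
      by (simp add: power2_eq_square algebra_simps)
    then show "(\<integral>x'. (u x' - u x)\<^sup>2 \<partial>K x) = v x" "integrable (K x) (\<lambda>x'. (u x' - u x)\<^sup>2)"
      using integrable_K[OF u, of x] integrable_K[OF u2, of x]
      by (simp_all add: v_def kernel_op_def prob_space)
  qed
  have v0: "0 \<le> v x" for x unfolding int_uu[symmetric] by simp
  have iK: "integrable \<pi> (kernel_op K (\<lambda>x. (u x)\<^sup>2))" by (rule integrable_\<pi>[OF bounded_by_kernel_op[OF u2]])
  have veq: "AE x in \<pi>. v x = kernel_op K (\<lambda>x. (u x)\<^sup>2) x - (u x)\<^sup>2"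
    using inv by eventually_elim (simp add: v_def power2_eq_square)
  have "AE x in \<pi>. kernel_op K (\<lambda>x. (u x)\<^sup>2) x - (u x)\<^sup>2 = 0"
  proof (subst integral_nonneg_eq_0_iff_AE[symmetric])
    show "integrable \<pi> (\<lambda>x. kernel_op K (\<lambda>x. (u x)\<^sup>2) x - (u x)\<^sup>2)"
      using iK integrable_\<pi>[OF u2] by simp
    show "AE x in \<pi>. 0 \<le> kernel_op K (\<lambda>x. (u x)\<^sup>2) x - (u x)\<^sup>2"
      using veq by eventually_elim (use v0 in metis)
    show "(\<integral>x. kernel_op K (\<lambda>x. (u x)\<^sup>2) x - (u x)\<^sup>2 \<partial>\<pi>) = 0"
      using iK integrable_\<pi>[OF u2] integral_kernel_op[OF u2] by simp
  qed
  with veq show ?thesis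
  proof eventually_elim
    case (elim x)
    then have "(\<integral>x'. (u x' - u x)\<^sup>2 \<partial>K x) = 0" by (simp add: int_uu)
    then have "AE x' in K x. (u x' - u x)\<^sup>2 = 0"
      using integral_nonneg_eq_0_iff_AE[OF int_d[of x]] by simp
    then show ?case by eventually_elim simp
  qed
qed

text \<open>By \<open>AE_kernel_eq\<close> the chain almost surely neither leaves nor enters the set
  where \<open>u\<close> is positive. If this set had positive mass, \<open>\<pi>\<close>
  conditioned on it would be invariant, so by uniqueness equal to \<open>\<pi>\<close>; then
  \<open>u\<close> would be positive almost surely, against mean zero. Hence
  \<open>u x \<le> 0\<close> almost surely, and mean zero finishes.\<close>

lemma invariant_function_trivial:
  assumes unique: "\<And>\<pi>'. invariant_prob K \<pi>' \<Longrightarrow> \<pi>' = \<pi>"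
    and u: "bounded_by C u" and inv: "AE x in \<pi>. kernel_op K u x = u x"
    and mean: "(\<integral>x. u x \<partial>\<pi>) = 0"
  shows "AE x in \<pi>. u x = 0"
proof -
  have um [measurable]: "u \<in> borel_measurable borel" using u by auto
  let ?B = "{x. 0 < u x}"
  have B [measurable]: "?B \<in> sets borel" by measurable
  have B\<pi>: "?B \<in> sets \<pi>" by simp
  have abs: "AE x in \<pi>. AE x' in K x. u x' = u x" by (rule AE_kernel_eq[OF u inv])
  have null: "emeasure \<pi> ?B = 0"
  proof (rule ccontr)
    assume pos: "emeasure \<pi> ?B \<noteq> 0"
    have "invariant_prob K (uniform_measure \<pi> ?B)"
      unfolding invariant_prob_def
    proof (intro conjI ballI)
      show "prob_space (uniform_measure \<pi> ?B)"
        using pos by (intro prob_space_uniform_measure) auto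
      show "sets (uniform_measure \<pi> ?B) = sets borel" by simp
      fix A :: "'x set" assume A [measurable]: "A \<in> sets borel"
      have mA: "(\<lambda>x. emeasure (K x) A) \<in> borel_measurable borel"
        by (rule measurable_emeasure_kernel[OF kernel_subprob A])
      then have mA': "(\<lambda>x. emeasure (K x) A) \<in> borel_measurable \<pi>"
        by (simp add: measurable_cong_sets[OF sets_\<pi> refl])
      have "(\<integral>\<^sup>+x. emeasure (K x) A \<partial>uniform_measure \<pi> ?B) = (\<integral>\<^sup>+x. emeasure (K x) A * indicator ?B x \<partial>\<pi>) / emeasure \<pi> ?B"
        by (rule nn_integral_uniform_measure[OF mA' B\<pi>])
      also have "(\<integral>\<^sup>+x. emeasure (K x) A * indicator ?B x \<partial>\<pi>) = (\<integral>\<^sup>+x. emeasure (K x) (A \<inter> ?B) \<partial>\<pi>)"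
        using abs
      proof (intro nn_integral_cong_AE, eventually_elim)
        case (elim x)
        show ?case
        proof (cases "0 < u x")
          case True
          have "emeasure (K x) A = emeasure (K x) (A \<inter> ?B)"
            using elim True by (intro emeasure_eq_AE) auto
          then show ?thesis using True by simp
        next
          case False
          have "emeasure (K x) (A \<inter> ?B) = emeasure (K x) {}"
            using elim False by (intro emeasure_eq_AE) auto
          then show ?thesis using False by simp
        qed
      qed
      also have "\<dots> = emeasure \<pi> (A \<inter> ?B)"
        using invariant unfolding invariant_prob_def by simp
      finally show "(\<integral>\<^sup>+x. emeasure (K x) A \<partial>uniform_measure \<pi> ?B) = emeasure (uniform_measure \<pi> ?B) A"
        by (simp add: Int_commute)
    qed
    from unique[OF this] have "emeasure \<pi> ?B = emeasure (uniform_measure \<pi> ?B) ?B" by simp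
    also have "\<dots> = 1" using pos by (intro emeasure_uniform_measure_1) auto
    finally have AEp: "AE x in \<pi>. 0 < u x"
      using \<pi>.AE_in_set_eq_1[OF B\<pi>] by (simp add: measure_def)
    then have "AE x in \<pi>. 0 \<le> u x" by eventually_elim simp
    then have "AE x in \<pi>. u x = 0"
      using integral_nonneg_eq_0_iff_AE[OF integrable_\<pi>[OF u]] mean by simp
    with AEp have "AE x in \<pi>. False" by eventually_elim simp
    then show False by simp
  qed
  then have "AE x in \<pi>. \<not> 0 < u x"
    by (subst AE_iff_measurable[OF B\<pi>]) (auto simp: sets_eq_imp_space_eq[OF sets_\<pi>])
  then have "AE x in \<pi>. 0 \<le> - u x" by eventually_elim simp
  then have "AE x in \<pi>. - u x = 0"
    using integral_nonneg_eq_0_iff_AE[of \<pi> "\<lambda>x. - u x"] integrable_\<pi>[OF u] mean by simp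
  then show ?thesis by simp
qed

text \<open>Applying \<open>K\<close> changes a long average of \<open>f\<close> very little, so the
  almost sure limit \<open>u\<close> along a subsequence is invariant, and uniqueness of the
  invariant law forces it to vanish. The energies of the full sequence converge, so the subsequence
  decides their limit. Periodic chains are covered, as only averages occur.\<close>

theorem mean_ergodic:
  assumes unique: "\<And>\<pi>'. invariant_prob K \<pi>' \<Longrightarrow> \<pi>' = \<pi>"
    and f: "bounded_by C f" and mean: "(\<integral>x. f x \<partial>\<pi>) = 0"
  shows "(\<lambda>n. energy (ergodic_avg n f)) \<longlonglongrightarrow> 0"
proof -
  note ba = bounded_by_ergodic_avg[OF f]
  obtain r u where r: "strict_mono r" and u: "bounded_by C u"
    and lim: "AE x in \<pi>. (\<lambda>i. ergodic_avg (r i) f x) \<longlonglongrightarrow> u x"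
    using ergodic_avg_limit[OF f] by blast
  have mb: "bounded_by C h \<Longrightarrow> h \<in> borel_measurable \<pi>" for h
    by (auto simp: measurable_cong_sets[OF sets_\<pi> refl])
  have "(\<integral>x. ergodic_avg n f x \<partial>\<pi>) = 0" for n
  proof -
    have "(\<integral>x. (kernel_op K ^^ k) f x \<partial>\<pi>) = 0" for k
      by (induction k) (simp_all add: mean integral_kernel_op[OF bounded_by_funpow[OF f]])
    then show ?thesis
      unfolding ergodic_avg_def orbit_sum_def
      using integrable_\<pi>[OF bounded_by_funpow[OF f]] by (simp add: Bochner_Integration.integral_sum)
  qed
  moreover have "(\<lambda>i. \<integral>x. ergodic_avg (r i) f x \<partial>\<pi>) \<longlonglongrightarrow> (\<integral>x. u x \<partial>\<pi>)"
    using lim bounded_byD(2)[OF ba] by (intro integral_dominated_convergence[where w="\<lambda>_. C"] mb ba u) auto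
  ultimately have mean_u: "(\<integral>x. u x \<partial>\<pi>) = 0"
    using LIMSEQ_unique[OF tendsto_const] by fastforce
  have "(\<lambda>i. energy (ergodic_avg (r i) f)) \<longlonglongrightarrow> energy u"
    unfolding energy_def
  proof (rule integral_dominated_convergence[where w="\<lambda>_. C\<^sup>2"])
    show "(\<lambda>x. (u x)\<^sup>2) \<in> borel_measurable \<pi>" "\<And>i. (\<lambda>x. (ergodic_avg (r i) f x)\<^sup>2) \<in> borel_measurable \<pi>"
      using mb[OF u] mb[OF ba] by auto
    show "AE x in \<pi>. (\<lambda>i. (ergodic_avg (r i) f x)\<^sup>2) \<longlonglongrightarrow> (u x)\<^sup>2"
      using lim by eventually_elim (rule tendsto_power)
    show "\<And>i. AE x in \<pi>. norm ((ergodic_avg (r i) f x)\<^sup>2) \<le> C\<^sup>2"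
      using bounded_by_square[OF ba] by (auto simp: bounded_by_def)
  qed simp
  with LIMSEQ_subseq_LIMSEQ[OF energy_ergodic_avg_tendsto[OF f] r]
  have min: "min_energy f = energy u"
    by (intro LIMSEQ_unique) (auto simp: comp_def)
  \<comment> \<open>Convergence fails only on a \<open>\<pi>\<close>-null set. As
    \<open>\<pi> \<bind> K = \<pi>\<close>, that set is also null for \<open>K x\<close> for almost
    every \<open>x\<close>, so the limit may be taken under \<open>K x\<close>.\<close>
  obtain N where N: "{x\<in>space \<pi>. \<not> (\<lambda>i. ergodic_avg (r i) f x) \<longlonglongrightarrow> u x} \<subseteq> N"
    and N0: "emeasure \<pi> N = 0" "N \<in> sets \<pi>"
    using lim by (rule AE_E)
  have "AE x in \<pi>. AE x' in K x. x' \<notin> N"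
  proof (rule AE_bind[THEN iffD1])
    show "AE x in \<pi> \<bind> K. x \<notin> N"
      unfolding invariant_prob_bind[OF kernel invariant] using N0 by (intro AE_not_in) auto
    show "K \<in> \<pi> \<rightarrow>\<^sub>M subprob_algebra borel"
      unfolding measurable_cong_sets[OF sets_\<pi> refl] by (rule kernel_subprob)
    have [measurable]: "N \<in> sets borel" using N0 by simp
    show "Measurable.pred borel (\<lambda>x. x \<notin> N)" by measurable
  qed
  then have "AE x in \<pi>. AE x' in K x. (\<lambda>i. ergodic_avg (r i) f x') \<longlonglongrightarrow> u x'"
  proof eventually_elim
    case (elim x)
    then show ?case
    proof eventually_elim
      case (elim x')
      then show ?case using N by (auto simp: sets_eq_imp_space_eq[OF sets_\<pi>])
    qed
  qed
  with lim have "AE x in \<pi>. kernel_op K u x = u x"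
  proof eventually_elim
    case (elim x)
    interpret prob_space "K x" by (rule prob_space_K)
    have mK: "bounded_by C h \<Longrightarrow> h \<in> borel_measurable (K x)" for h
      by (auto simp: measurable_cong_sets[OF sets_K refl])
    have "(\<lambda>i. kernel_op K (ergodic_avg (r i) f) x) \<longlonglongrightarrow> kernel_op K u x"
      unfolding kernel_op_def
      using elim bounded_byD(2)[OF ba] by (intro integral_dominated_convergence[where w="\<lambda>_. C"] mK ba u) auto
    moreover have "(\<lambda>i. kernel_op K (ergodic_avg (r i) f) x) \<longlonglongrightarrow> u x + 0"
    proof -
      \<comment> \<open>Telescoping: applying \<open>K\<close> moves the average of length
        \<open>n\<close> by at most \<open>2 * C / n\<close>.\<close>
      have e: "kernel_op K (ergodic_avg n f) x = ergodic_avg n f x + inverse (real n) * ((kernel_op K ^^ n) f x - f x)" for n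
        unfolding ergodic_avg_def[abs_def] kernel_op_cmult kernel_op_orbit_sum[OF f] by (simp add: algebra_simps)
      have "(\<lambda>n. inverse (real n) * ((kernel_op K ^^ n) f x - f x)) \<longlonglongrightarrow> 0"
      proof (rule Lim_null_comparison)
        show "\<forall>\<^sub>F n in sequentially. norm (inverse (real n) * ((kernel_op K ^^ n) f x - f x)) \<le> inverse (real n) * (2 * C)"
        proof (rule always_eventually, rule allI)
          fix n
          have "\<bar>(kernel_op K ^^ n) f x - f x\<bar> \<le> 2 * C"
            using bounded_byD(2)[OF bounded_by_funpow[OF f], of n x] bounded_byD(2)[OF f, of x] by linarith
          then show "norm (inverse (real n) * ((kernel_op K ^^ n) f x - f x)) \<le> inverse (real n) * (2 * C)"
            by (simp add: abs_mult mult_left_mono)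
        qed
        show "(\<lambda>n. inverse (real n) * (2 * C)) \<longlonglongrightarrow> 0"
          by (intro tendsto_mult_left_zero LIMSEQ_inverse_real_of_nat lim_inverse_n)
      qed
      from LIMSEQ_subseq_LIMSEQ[OF this r]
      show ?thesis unfolding e using elim(1) by (intro tendsto_add) (simp_all add: comp_def)
    qed
    ultimately show ?case by (simp add: LIMSEQ_unique)
  qed
  from invariant_function_trivial[OF unique u this mean_u] have "AE x in \<pi>. u x = 0" .
  then have "energy u = 0"
    unfolding energy_def by (subst integral_eq_zero_AE) (auto elim: eventually_mono)
  with min energy_ergodic_avg_tendsto[OF f] show ?thesis by simp
qed

end

section \<open>Law of large numbers for the stationary observations\<close>

lemma obs_seq_shift: "obs (seq_shift n \<omega>) = seq_shift n (obs \<omega>)"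
  by (simp add: obs_def seq_shift_def fun_eq_iff)

lemma seq_shift_comb_seq [simp]: "seq_shift n (comb_seq n \<omega> \<omega>') = \<omega>'"
  by (simp add: seq_shift_def fun_eq_iff comb_seq_add)

lemma obs_comb_seq: "obs (comb_seq n \<omega> \<omega>') = comb_seq n (obs \<omega>) (obs \<omega>')"
  by (simp add: obs_def comb_seq_def fun_eq_iff)

section \<open>Statistics of finitely many observations\<close>

definition depends_on :: "nat \<Rightarrow> ((nat \<Rightarrow> 'a) \<Rightarrow> 'b) \<Rightarrow> bool" where
  "depends_on s h \<longleftrightarrow> (\<forall>y y'. (\<forall>i<s. y i = y' i) \<longrightarrow> h y = h y')"

lemma depends_on_comb_seq: "depends_on s h \<Longrightarrow> s \<le> n \<Longrightarrow> h (comb_seq n y y') = h y"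
  unfolding depends_on_def by (auto simp: comb_seq_less)

definition window_sum :: "((nat \<Rightarrow> 'a) \<Rightarrow> real) \<Rightarrow> nat \<Rightarrow> (nat \<Rightarrow> 'a) \<Rightarrow> real" where
  "window_sum h n y = (\<Sum>j<n. h (seq_shift j y))"

lemma measurable_window_sum [measurable]:
  assumes [measurable]: "h \<in> borel_measurable (PiM UNIV (\<lambda>_. M))"
  shows "window_sum h n \<in> borel_measurable (PiM UNIV (\<lambda>_. M))"
  unfolding window_sum_def[abs_def] by measurable

lemma window_sum_Suc: "window_sum h (Suc n) y = h y + window_sum h n (seq_shift 1 y)"
  unfolding window_sum_def sum.lessThan_Suc_shift by (simp add: seq_shift_seq_shift)

lemma window_sum_add: "window_sum h (m + n) y = window_sum h m y + window_sum h n (seq_shift m y)"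
  by (induction m arbitrary: y) (simp_all add: window_sum_Suc seq_shift_seq_shift, simp add: window_sum_def)

lemma abs_window_sum_le: "(\<And>y. \<bar>h y\<bar> \<le> C) \<Longrightarrow> \<bar>window_sum h n y\<bar> \<le> real n * C"
  unfolding window_sum_def using sum_bounded_above[of "{..<n}" "\<lambda>j. \<bar>h (seq_shift j y)\<bar>" C]
  by (auto intro: order_trans[OF sum_abs])

context hmm
begin

lemma space_paths [simp]: "space paths = UNIV"
  by (simp add: space_PiM space_pair_measure)

abbreviation obs_space :: "(nat \<Rightarrow> 'y) measure" where "obs_space \<equiv> PiM UNIV (\<lambda>_. borel)"

text \<open>The Markov property as an identity of measures. From it follows the version for signed
  bounded integrands, which the nonnegative integral does not give directly.\<close>

lemma law_markov:
  assumes \<nu>: "\<nu> \<in> space (prob_algebra borel)"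
  shows "law \<nu> = law \<nu> \<bind> (\<lambda>\<omega>. distr (law_from (fst (\<omega> n))) paths (comb_seq n \<omega>))"
proof -
  let ?D = "\<lambda>\<omega>. distr (law_from (fst (\<omega> n))) paths (comb_seq n \<omega>)"
  have D: "?D \<in> paths \<rightarrow>\<^sub>M prob_algebra paths" by measurable
  have l: "law \<nu> \<in> space (prob_algebra paths)" by (rule measurable_space[OF measurable_law \<nu>])
  show ?thesis
  proof (rule measure_eqI)
    show "sets (law \<nu>) = sets (law \<nu> \<bind> ?D)" by (simp add: sets_bind'[OF l D] \<nu>)
    fix A assume "A \<in> sets (law \<nu>)"
    then have A [measurable]: "A \<in> sets paths" by (simp add: \<nu>)
    have "emeasure (law \<nu>) A = (\<integral>\<^sup>+\<omega>. indicator A \<omega> \<partial>law \<nu>)" by (simp add: \<nu>)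
    also have "\<dots> = (\<integral>\<^sup>+\<omega>. \<integral>\<^sup>+\<omega>'. indicator A (comb_seq n \<omega> \<omega>') \<partial>law_from (fst (\<omega> n)) \<partial>law \<nu>)"
      by (rule nn_integral_law_markov[OF \<nu>]) measurable
    also have "\<dots> = (\<integral>\<^sup>+\<omega>. emeasure (?D \<omega>) A \<partial>law \<nu>)"
    proof (rule nn_integral_cong)
      fix \<omega>
      have "(\<integral>\<^sup>+\<omega>'. indicator A (comb_seq n \<omega> \<omega>') \<partial>law_from (fst (\<omega> n))) = (\<integral>\<^sup>+z. indicator A z \<partial>?D \<omega>)"
        by (rule nn_integral_distr[symmetric]) auto
      then show "(\<integral>\<^sup>+\<omega>'. indicator A (comb_seq n \<omega> \<omega>') \<partial>law_from (fst (\<omega> n))) = emeasure (?D \<omega>) A"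
        by simp
    qed
    also have "\<dots> = emeasure (law \<nu> \<bind> ?D) A"
      by (rule emeasure_bind_prob_algebra[OF l D A, symmetric])
    finally show "emeasure (law \<nu>) A = emeasure (law \<nu> \<bind> ?D) A" .
  qed
qed

text \<open>The rule for Bochner integrals varies the measure but not the integrand. Pushing the law
  forward along \<open>Pair z\<close> moves the dependence on \<open>z\<close> into the
  measure.\<close>

lemma measurable_integral_law_from [measurable (raw)]:
  fixes F :: "'c \<Rightarrow> (nat \<Rightarrow> 'x \<times> 'y) \<Rightarrow> real"
  assumes [measurable]: "(\<lambda>(z, \<omega>). F z \<omega>) \<in> borel_measurable (N \<Otimes>\<^sub>M paths)" "X \<in> N \<rightarrow>\<^sub>M borel"
  shows "(\<lambda>z. \<integral>\<omega>. F z \<omega> \<partial>law_from (X z)) \<in> borel_measurable N"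
proof -
  have k: "(\<lambda>z. distr (law_from (X z)) (N \<Otimes>\<^sub>M paths) (Pair z)) \<in> N \<rightarrow>\<^sub>M subprob_algebra (N \<Otimes>\<^sub>M paths)"
    by (intro measurable_prob_algebraD) measurable
  have "(\<lambda>z. \<integral>p. (case p of (z, \<omega>) \<Rightarrow> F z \<omega>) \<partial>distr (law_from (X z)) (N \<Otimes>\<^sub>M paths) (Pair z)) \<in> borel_measurable N"
    using measurable_compose[OF k integral_measurable_subprob_algebra[OF assms(1)]] by simp
  then show ?thesis
    by (rule measurable_cong[THEN iffD1, rotated]) (subst integral_distr, auto)
qed

lemma integral_law_markov:
  fixes F :: "(nat \<Rightarrow> 'x \<times> 'y) \<Rightarrow> real"
  assumes \<nu>: "\<nu> \<in> space (prob_algebra borel)" and F [measurable]: "F \<in> borel_measurable paths"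
    and B: "\<And>\<omega>. \<bar>F \<omega>\<bar> \<le> B"
  shows "(\<integral>\<omega>. F \<omega> \<partial>law \<nu>) = (\<integral>\<omega>. \<integral>\<omega>'. F (comb_seq n \<omega> \<omega>') \<partial>law_from (fst (\<omega> n)) \<partial>law \<nu>)"
proof -
  interpret prob_space "law \<nu>" by (rule prob_space_law[OF \<nu>])
  let ?D = "\<lambda>\<omega>. distr (law_from (fst (\<omega> n))) paths (comb_seq n \<omega>)"
  have D: "?D \<in> paths \<rightarrow>\<^sub>M prob_algebra paths" by measurable
  have "(\<integral>\<omega>. F \<omega> \<partial>law \<nu>) = (\<integral>\<omega>. F \<omega> \<partial>(law \<nu> \<bind> ?D))"
    using law_markov[OF \<nu>, of n] by simp
  also have "\<dots> = (\<integral>\<omega>. \<integral>\<omega>'. F \<omega>' \<partial>?D \<omega> \<partial>law \<nu>)"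
  proof (rule integral_bind[where K=paths and B=B and B'=1])
    show "?D \<in> law \<nu> \<rightarrow>\<^sub>M subprob_algebra paths"
      unfolding measurable_cong_sets[OF sets_law[OF \<nu>] refl] by (rule measurable_prob_algebraD[OF D])
    have "prob_space (?D \<omega>)" for \<omega>
      using measurable_space[OF D, of \<omega>] by (simp add: space_prob_algebra)
    from prob_space.emeasure_space_1[OF this]
    show "AE \<omega> in law \<nu>. emeasure (?D \<omega>) (space (?D \<omega>)) \<le> ennreal 1"
      by (intro AE_I2) (simp only: ennreal_1 order_refl)
  qed (use B in \<open>auto intro: finite_measure_axioms\<close>)
  also have "\<dots> = (\<integral>\<omega>. \<integral>\<omega>'. F (comb_seq n \<omega> \<omega>') \<partial>law_from (fst (\<omega> n)) \<partial>law \<nu>)"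
    by (intro Bochner_Integration.integral_cong refl integral_distr) auto
  finally show ?thesis .
qed

lemma distr_law_X0: "\<nu> \<in> space (prob_algebra borel) \<Longrightarrow> distr (law \<nu>) borel (\<lambda>\<omega>. fst (\<omega> 0)) = \<nu>"
proof (rule measure_eqI)
  fix A assume \<nu>: "\<nu> \<in> space (prob_algebra borel)" and "A \<in> sets (distr (law \<nu>) borel (\<lambda>\<omega>. fst (\<omega> 0)))"
  then have [measurable]: "A \<in> sets borel" and s: "sets \<nu> = sets borel" by (auto simp: space_prob_algebra)
  have "emeasure (distr (law \<nu>) borel (\<lambda>\<omega>. fst (\<omega> 0))) A = (\<integral>\<^sup>+x. indicator A x \<partial>distr (law \<nu>) borel (\<lambda>\<omega>. fst (\<omega> 0)))"
    by simp
  also have "\<dots> = (\<integral>\<^sup>+\<omega>. indicator A (fst (\<omega> 0)) \<partial>law \<nu>)"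
    using \<nu> by (intro nn_integral_distr) auto
  also have "\<dots> = emeasure \<nu> A"
    using nn_integral_law_X0[OF \<nu>, of "indicator A"] by (simp add: s)
  finally show "emeasure (distr (law \<nu>) borel (\<lambda>\<omega>. fst (\<omega> 0))) A = emeasure \<nu> A" .
qed (simp add: space_prob_algebra)

lemma distr_law_seq_shift:
  assumes \<pi>: "invariant_prob K \<pi>"
  shows "distr (law \<pi>) paths (seq_shift n) = law \<pi>"
proof (rule measure_eqI)
  note p [simp] = invariant_probD[OF \<pi>]
  fix A assume "A \<in> sets (distr (law \<pi>) paths (seq_shift n))"
  then have A [measurable]: "A \<in> sets paths" by simp
  have "emeasure (distr (law \<pi>) paths (seq_shift n)) A = (\<integral>\<^sup>+\<omega>. indicator A \<omega> \<partial>distr (law \<pi>) paths (seq_shift n))"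
    by simp
  also have "\<dots> = (\<integral>\<^sup>+\<omega>. indicator A (seq_shift n \<omega>) \<partial>law \<pi>)"
    by (intro nn_integral_distr) auto
  also have "\<dots> = emeasure (law \<pi>) A"
    using nn_integral_law_seq_shift[OF \<pi>, of "indicator A" n] by simp
  finally show "emeasure (distr (law \<pi>) paths (seq_shift n)) A = emeasure (law \<pi>) A" .
qed (simp add: invariant_probD[OF \<pi>])

lemma integral_law_seq_shift:
  fixes F :: "(nat \<Rightarrow> 'x \<times> 'y) \<Rightarrow> real"
  assumes \<pi>: "invariant_prob K \<pi>" and [measurable]: "F \<in> borel_measurable paths"
  shows "(\<integral>\<omega>. F (seq_shift n \<omega>) \<partial>law \<pi>) = (\<integral>\<omega>. F \<omega> \<partial>law \<pi>)"
proof -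
  note p [simp] = invariant_probD[OF \<pi>]
  have "(\<integral>\<omega>. F \<omega> \<partial>distr (law \<pi>) paths (seq_shift n)) = (\<integral>\<omega>. F (seq_shift n \<omega>) \<partial>law \<pi>)"
    by (rule integral_distr) auto
  then show ?thesis by (simp add: distr_law_seq_shift[OF \<pi>])
qed

lemma integral_law_X:
  fixes f :: "'x \<Rightarrow> real"
  assumes \<pi>: "invariant_prob K \<pi>" and [measurable]: "f \<in> borel_measurable borel"
  shows "(\<integral>\<omega>. f (fst (\<omega> n)) \<partial>law \<pi>) = (\<integral>x. f x \<partial>\<pi>)"
proof -
  note p [simp] = invariant_probD[OF \<pi>]
  have "(\<integral>\<omega>. f (fst (\<omega> n)) \<partial>law \<pi>) = (\<integral>\<omega>. f (fst (\<omega> 0)) \<partial>law \<pi>)"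
    using integral_law_seq_shift[OF \<pi>, of "\<lambda>\<omega>. f (fst (\<omega> 0))" n] by (simp add: seq_shift_def)
  also have "\<dots> = (\<integral>x. f x \<partial>distr (law \<pi>) borel (\<lambda>\<omega>. fst (\<omega> 0)))"
    by (rule integral_distr[symmetric]) auto
  finally show ?thesis by (simp add: distr_law_X0)
qed

definition cond_mean :: "((nat \<Rightarrow> 'y) \<Rightarrow> real) \<Rightarrow> 'x \<Rightarrow> real" where
  "cond_mean h x = (\<integral>\<omega>. h (obs \<omega>) \<partial>law_from x)"

lemma integral_law_bounded:
  fixes F :: "(nat \<Rightarrow> 'x \<times> 'y) \<Rightarrow> real"
  assumes \<nu>: "\<nu> \<in> space (prob_algebra borel)" and [measurable]: "F \<in> borel_measurable paths"
    and B: "\<And>\<omega>. \<bar>F \<omega>\<bar> \<le> B"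
  shows "integrable (law \<nu>) F" "\<bar>\<integral>\<omega>. F \<omega> \<partial>law \<nu>\<bar> \<le> B"
proof -
  interpret prob_space "law \<nu>" by (rule prob_space_law[OF \<nu>])
  show i: "integrable (law \<nu>) F"
    using B \<nu> by (intro integrable_const_bound[where B=B]) auto
  have "\<bar>\<integral>\<omega>. F \<omega> \<partial>law \<nu>\<bar> \<le> (\<integral>\<omega>. \<bar>F \<omega>\<bar> \<partial>law \<nu>)" by (rule integral_abs_bound)
  also have "\<dots> \<le> (\<integral>\<omega>. B \<partial>law \<nu>)" using i B by (intro integral_mono) auto
  finally show "\<bar>\<integral>\<omega>. F \<omega> \<partial>law \<nu>\<bar> \<le> B" by (simp add: prob_space)
qed

lemma bounded_by_cond_mean:
  assumes [measurable]: "h \<in> borel_measurable obs_space" and C: "\<And>y. \<bar>h y\<bar> \<le> C"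
  shows "bounded_by C (cond_mean h)"
  unfolding bounded_by_def cond_mean_def
  using integral_law_bounded(2)[OF return_in_prob_algebra, of "\<lambda>\<omega>. h (obs \<omega>)" C] C by auto

text \<open>Phrased with \<open>kernel_iter\<close>, the form in which uniform ergodicity is stated;
  \<open>cond_mean_seq_shift_funpow\<close> is the operator form for the mean ergodic
  theorem.\<close>

lemma cond_mean_seq_shift:
  assumes h [measurable]: "h \<in> borel_measurable obs_space" and C: "\<And>y. \<bar>h y\<bar> \<le> C"
  shows "cond_mean (\<lambda>y. h (seq_shift n y)) x = (\<integral>x'. cond_mean h x' \<partial>kernel_iter K n x)"
proof -
  have b: "cond_mean h \<in> borel_measurable borel" using bounded_by_cond_mean[OF h C] by auto
  have d: "distr (law_from x) borel (\<lambda>\<omega>. fst (\<omega> n)) = kernel_iter K n x"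
  proof (rule measure_eqI)
    have k: "sets (kernel_iter K n x) = sets borel"
      using measurable_space[OF measurable_kernel_iter[OF kernel], of x n] by (simp add: space_prob_algebra)
    then show "sets (distr (law_from x) borel (\<lambda>\<omega>. fst (\<omega> n))) = sets (kernel_iter K n x)" by simp
    fix A assume "A \<in> sets (distr (law_from x) borel (\<lambda>\<omega>. fst (\<omega> n)))"
    then have [measurable]: "A \<in> sets borel" by simp
    have "emeasure (distr (law_from x) borel (\<lambda>\<omega>. fst (\<omega> n))) A = (\<integral>\<^sup>+x. indicator A x \<partial>distr (law_from x) borel (\<lambda>\<omega>. fst (\<omega> n)))"
      by simp
    also have "\<dots> = (\<integral>\<^sup>+\<omega>. indicator A (fst (\<omega> n)) \<partial>law_from x)"
      by (intro nn_integral_distr) auto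
    also have "\<dots> = emeasure (kernel_iter K n x) A"
      by (subst nn_integral_law_from_X) (auto simp: k)
    finally show "emeasure (distr (law_from x) borel (\<lambda>\<omega>. fst (\<omega> n))) A = emeasure (kernel_iter K n x) A" .
  qed
  have "cond_mean (\<lambda>y. h (seq_shift n y)) x = (\<integral>\<omega>. cond_mean h (fst (\<omega> n)) \<partial>law_from x)"
    unfolding cond_mean_def
    using C by (subst integral_law_markov[where n=n and B=C]) (auto simp: obs_comb_seq)
  also have "\<dots> = (\<integral>x'. cond_mean h x' \<partial>distr (law_from x) borel (\<lambda>\<omega>. fst (\<omega> n)))"
    using b by (intro integral_distr[symmetric]) auto
  finally show ?thesis by (simp only: d)
qed

end

text \<open>The L1 norm is at most the L2 norm, which the mean ergodic theorem brings below
  \<open>e * real n\<close> for large \<open>n\<close>. The constant \<open>B\<close> takes care of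
  the finitely many small \<open>n\<close>.\<close>

lemma (in invariant_kernel) orbit_sum_L1_bound:
  assumes unique: "\<And>\<pi>'. invariant_prob K \<pi>' \<Longrightarrow> \<pi>' = \<pi>"
    and f: "bounded_by C f" and mean: "(\<integral>x. f x \<partial>\<pi>) = 0" and e: "0 < e"
  obtains B where "0 \<le> B" "\<And>n. (\<integral>x. \<bar>orbit_sum K n f x\<bar> \<partial>\<pi>) \<le> e * real n + B"
proof -
  have C: "0 \<le> C" using bounded_byD(2)[OF f, of undefined] by linarith
  have "\<forall>\<^sub>F n in sequentially. energy (ergodic_avg n f) < e\<^sup>2"
    using e by (intro order_tendstoD(2)[OF mean_ergodic[OF unique f mean]]) auto
  then obtain m where m: "\<And>n. n \<ge> m \<Longrightarrow> energy (ergodic_avg n f) < e\<^sup>2"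
    by (auto simp: eventually_sequentially)
  note bo = bounded_by_orbit_sum[OF f]
  have "(\<integral>x. \<bar>orbit_sum K n f x\<bar> \<partial>\<pi>) \<le> e * real n + real m * C" for n
  proof (cases "n \<ge> m \<and> n > 0")
    case True
    have "(\<integral>x. \<bar>orbit_sum K n f x\<bar> \<partial>\<pi>)\<^sup>2 \<le> (\<integral>x. \<bar>orbit_sum K n f x\<bar>\<^sup>2 \<partial>\<pi>)"
      using integrable_\<pi>[OF bo] integrable_\<pi>[OF bounded_by_square[OF bo]]
      by (intro \<pi>.integral_square_ge) auto
    also have "\<dots> = energy (ergodic_avg n f) * (real n)\<^sup>2"
      unfolding energy_ergodic_avg using True by (simp add: energy_def)
    also have "\<dots> \<le> e\<^sup>2 * (real n)\<^sup>2"
      using m[of n] True by (intro mult_right_mono) auto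
    finally have "(\<integral>x. \<bar>orbit_sum K n f x\<bar> \<partial>\<pi>)\<^sup>2 \<le> (e * real n)\<^sup>2" by (simp add: power_mult_distrib)
    then have "(\<integral>x. \<bar>orbit_sum K n f x\<bar> \<partial>\<pi>) \<le> e * real n"
      by (rule power2_le_imp_le) (use e in simp)
    moreover have "0 \<le> real m * C" using C by simp
    ultimately show ?thesis by linarith
  next
    case False
    have "(\<integral>x. \<bar>orbit_sum K n f x\<bar> \<partial>\<pi>) \<le> (\<integral>x. real n * C \<partial>\<pi>)"
      using integrable_\<pi>[OF bo, of n] bounded_byD(2)[OF bo, of n] by (intro integral_mono) auto
    also have "\<dots> = real n * C" by (simp add: \<pi>.prob_space)
    also have "\<dots> \<le> real m * C" using False C by (intro mult_right_mono) auto
    also have "\<dots> \<le> e * real n + real m * C" using e by simp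
    finally show ?thesis .
  qed
  with C show thesis by (intro that[of "real m * C"]) auto
qed

context hmm
begin

lemma cond_mean_seq_shift_funpow:
  assumes h [measurable]: "h \<in> borel_measurable obs_space" and C: "\<And>y. \<bar>h y\<bar> \<le> C"
  shows "cond_mean (\<lambda>y. h (seq_shift n y)) x = (kernel_op K ^^ n) (cond_mean h) x"
proof (induction n arbitrary: x)
  case (Suc n)
  have k: "kernel_iter K 1 x = K x" for x
    by (simp add: bind_return[OF measurable_prob_algebraD[OF kernel]])
  have "cond_mean (\<lambda>y. h (seq_shift (Suc n) y)) x = cond_mean (\<lambda>y. h (seq_shift n (seq_shift 1 y))) x"
    by (simp add: seq_shift_seq_shift)
  also have "\<dots> = (\<integral>x'. cond_mean (\<lambda>y. h (seq_shift n y)) x' \<partial>K x)"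
    using cond_mean_seq_shift[of "\<lambda>y. h (seq_shift n y)" C 1 x] C by (simp add: k del: One_nat_def)
  also have "\<dots> = (kernel_op K ^^ Suc n) (cond_mean h) x"
    unfolding Suc.IH by (simp add: kernel_op_def[of K "(kernel_op K ^^ n) (cond_mean h)"])
  finally show ?case .
qed simp

lemma cond_mean_window_sum:
  assumes h [measurable]: "h \<in> borel_measurable obs_space" and C: "\<And>y. \<bar>h y\<bar> \<le> C"
  shows "cond_mean (window_sum h n) x = orbit_sum K n (cond_mean h) x"
proof -
  have "cond_mean (window_sum h n) x = (\<Sum>j<n. cond_mean (\<lambda>y. h (seq_shift j y)) x)"
    unfolding cond_mean_def window_sum_def
    using C by (intro Bochner_Integration.integral_sum integral_law_bounded(1)[where B=C]) auto
  then show ?thesis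
    unfolding orbit_sum_def using cond_mean_seq_shift_funpow[OF h C] by simp
qed

lemma integral_cond_mean:
  assumes \<pi>: "invariant_prob K \<pi>"
    and h [measurable]: "h \<in> borel_measurable obs_space" and C: "\<And>y. \<bar>h y\<bar> \<le> C"
  shows "(\<integral>x. cond_mean h x \<partial>\<pi>) = (\<integral>\<omega>. h (obs \<omega>) \<partial>law \<pi>)"
proof -
  have "(\<integral>\<omega>. h (obs \<omega>) \<partial>law \<pi>) = (\<integral>\<omega>. cond_mean h (fst (\<omega> 0)) \<partial>law \<pi>)"
    unfolding cond_mean_def
    using C by (subst integral_law_markov[OF invariant_probD[OF \<pi>], where n=0 and B=C]) (auto simp: comb_seq_0)
  also have "\<dots> = (\<integral>x. cond_mean h x \<partial>\<pi>)"
    using bounded_by_cond_mean[OF h C] by (intro integral_law_X[OF \<pi>]) auto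
  finally show ?thesis by simp
qed

text \<open>\<open>h\<close> reads the first \<open>s\<close> observations. The first
  \<open>s\<close> terms of the window sum may overlap with it and are bounded trivially; the other
  \<open>n\<close> start at time \<open>s + 1\<close>, where conditioning on the hidden state
  replaces them by an orbit sum.\<close>

lemma cross_moment_bound:
  assumes \<pi>: "invariant_prob K \<pi>"
    and h [measurable]: "h \<in> borel_measurable obs_space" and C: "\<And>y. \<bar>h y\<bar> \<le> C"
    and s: "depends_on s h"
  shows "(\<integral>\<omega>. h (obs \<omega>) * window_sum h (s + n) (seq_shift 1 (obs \<omega>)) \<partial>law \<pi>)
    \<le> real s * C\<^sup>2 + C * (\<integral>x. \<bar>orbit_sum K n (cond_mean h) x\<bar> \<partial>\<pi>)"
proof -
  note p [simp] = invariant_probD[OF \<pi>]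
  interpret I: invariant_kernel K \<pi> by standard (auto simp: \<pi>)
  interpret P: prob_space "law \<pi>" by (rule prob_space_law) simp
  have C0: "0 \<le> C" using C[of undefined] by linarith
  note cm = bounded_by_cond_mean[OF h C]
  have w: "\<bar>window_sum h m y\<bar> \<le> real m * C" for m y by (rule abs_window_sum_le[OF C])
  have hw: "\<bar>h y * window_sum h m y'\<bar> \<le> real m * C\<^sup>2" for m y y'
    using mult_mono[OF C[of y] w[of m y'] C0 abs_ge_zero] by (simp add: abs_mult power2_eq_square mult_ac)
  have "(\<integral>\<omega>. h (obs \<omega>) * window_sum h (s + n) (seq_shift 1 (obs \<omega>)) \<partial>law \<pi>)
    = (\<integral>\<omega>. h (obs \<omega>) * window_sum h s (seq_shift 1 (obs \<omega>)) + h (obs \<omega>) * window_sum h n (seq_shift (s + 1) (obs \<omega>)) \<partial>law \<pi>)"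
    by (simp add: window_sum_add seq_shift_seq_shift ring_distribs)
  also have "\<dots> = (\<integral>\<omega>. h (obs \<omega>) * window_sum h s (seq_shift 1 (obs \<omega>)) \<partial>law \<pi>)
    + (\<integral>\<omega>. h (obs \<omega>) * window_sum h n (seq_shift (s + 1) (obs \<omega>)) \<partial>law \<pi>)"
    by (intro Bochner_Integration.integral_add integral_law_bounded(1)[OF p _ hw]) measurable
  also have "(\<integral>\<omega>. h (obs \<omega>) * window_sum h s (seq_shift 1 (obs \<omega>)) \<partial>law \<pi>) \<le> real s * C\<^sup>2"
    using integral_law_bounded(2)[OF p _ hw[of _ s], of obs "\<lambda>\<omega>. seq_shift 1 (obs \<omega>)"] by (simp add: abs_le_iff)
  also have "(\<integral>\<omega>. h (obs \<omega>) * window_sum h n (seq_shift (s + 1) (obs \<omega>)) \<partial>law \<pi>)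
    = (\<integral>\<omega>. h (obs \<omega>) * cond_mean (window_sum h n) (fst (\<omega> (s + 1))) \<partial>law \<pi>)"
    unfolding cond_mean_def
    by (subst integral_law_markov[OF p _ hw, where n="s + 1"])
      (simp_all add: obs_comb_seq depends_on_comb_seq[OF s])
  also have "\<dots> \<le> (\<integral>\<omega>. C * \<bar>orbit_sum K n (cond_mean h) (fst (\<omega> (s + 1)))\<bar> \<partial>law \<pi>)"
  proof (rule integral_mono)
    have [measurable]: "orbit_sum K n (cond_mean h) \<in> borel_measurable borel"
      using I.bounded_by_orbit_sum[OF cm] by auto
    have b: "\<bar>orbit_sum K n (cond_mean h) x\<bar> \<le> real n * C" for x
      using I.bounded_by_orbit_sum[OF cm] by auto
    have le: "h y * orbit_sum K n (cond_mean h) x \<le> C * \<bar>orbit_sum K n (cond_mean h) x\<bar>"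
      "\<bar>h y * orbit_sum K n (cond_mean h) x\<bar> \<le> C * \<bar>orbit_sum K n (cond_mean h) x\<bar>" for x y
      using mult_right_mono[OF C[of y], of "\<bar>orbit_sum K n (cond_mean h) x\<bar>"]
        abs_ge_self[of "h y * orbit_sum K n (cond_mean h) x"] by (auto simp: abs_mult)
    have le2: "C * \<bar>orbit_sum K n (cond_mean h) x\<bar> \<le> C * (real n * C)" for x
      using C0 by (intro mult_left_mono b)
    show "integrable (law \<pi>) (\<lambda>\<omega>. h (obs \<omega>) * cond_mean (window_sum h n) (fst (\<omega> (s + 1))))"
      unfolding cond_mean_window_sum[OF h C]
      by (rule integral_law_bounded(1)[OF p _ order_trans[OF le(2) le2]]) measurable
    show "integrable (law \<pi>) (\<lambda>\<omega>. C * \<bar>orbit_sum K n (cond_mean h) (fst (\<omega> (s + 1)))\<bar>)"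
      using le2 C0 by (intro integral_law_bounded(1)[OF p, where B="C * (real n * C)"]) (auto simp: abs_mult)
    show "h (obs \<omega>) * cond_mean (window_sum h n) (fst (\<omega> (s + 1))) \<le> C * \<bar>orbit_sum K n (cond_mean h) (fst (\<omega> (s + 1)))\<bar>" for \<omega>
      unfolding cond_mean_window_sum[OF h C] by (rule le(1))
  qed
  also have "\<dots> = C * (\<integral>x. \<bar>orbit_sum K n (cond_mean h) x\<bar> \<partial>\<pi>)"
  proof -
    have "(\<lambda>x. \<bar>orbit_sum K n (cond_mean h) x\<bar>) \<in> borel_measurable borel"
      by (intro borel_measurable_abs bounded_byD(1)[OF I.bounded_by_orbit_sum[OF cm]])
    then show ?thesis
      using integral_law_X[OF \<pi>, of "\<lambda>x. \<bar>orbit_sum K n (cond_mean h) x\<bar>" "s + 1"] by simp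
  qed
  finally show ?thesis by simp
qed

text \<open>Stationarity bounds the increment of the second moment by a constant plus twice a cross
  moment, and the latter grows at most like a small multiple of \<open>n\<close>. Summation gives an
  arbitrarily small quadratic coefficient.\<close>

lemma window_sum_second_moment:
  assumes \<pi>: "invariant_prob K \<pi>" and unique: "\<And>\<pi>'. invariant_prob K \<pi>' \<Longrightarrow> \<pi>' = \<pi>"
    and h [measurable]: "h \<in> borel_measurable obs_space" and C: "\<And>y. \<bar>h y\<bar> \<le> C"
    and s: "depends_on s h" and mean: "(\<integral>\<omega>. h (obs \<omega>) \<partial>law \<pi>) = 0"
    and e: "0 < e"
  obtains B where "\<And>n. (\<integral>\<omega>. (window_sum h n (obs \<omega>))\<^sup>2 \<partial>law \<pi>) \<le> real n * (e * real n + B)"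
proof -
  note p [simp] = invariant_probD[OF \<pi>]
  interpret I: invariant_kernel K \<pi> by standard (auto simp: \<pi>)
  interpret P: prob_space "law \<pi>" by (rule prob_space_law) simp
  have C0: "0 \<le> C" using C[of undefined] by linarith
  have w: "\<bar>window_sum h m y\<bar> \<le> real m * C" for m y by (rule abs_window_sum_le[OF C])
  have hw: "\<bar>h y * window_sum h m y'\<bar> \<le> real m * C\<^sup>2" for m y y'
    using mult_mono[OF C[of y] w[of m y'] C0 abs_ge_zero] by (simp add: abs_mult power2_eq_square mult_ac)
  \<comment> \<open>Chosen for \<open>2 * C * e' \<le> e\<close>; adding \<open>1\<close> to
    \<open>C\<close> avoids a zero denominator.\<close>
  define e' where "e' = e / (2 * (C + 1))"
  have e': "0 < e'" "2 * C * e' \<le> e" using e C0 by (auto simp: e'_def field_simps)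
  obtain B0 where B0: "0 \<le> B0" "\<And>n. (\<integral>x. \<bar>orbit_sum K n (cond_mean h) x\<bar> \<partial>\<pi>) \<le> e' * real n + B0"
    using I.orbit_sum_L1_bound[OF unique bounded_by_cond_mean[OF h C] _ e'(1)]
      integral_cond_mean[OF \<pi> h C] mean by auto
  define R where "R n = (\<integral>\<omega>. h (obs \<omega>) * window_sum h n (seq_shift 1 (obs \<omega>)) \<partial>law \<pi>)" for n
  define B1 where "B1 = real s * C\<^sup>2 + C * B0"
  have R: "R n \<le> C * e' * real n + B1" for n
  proof (cases "s \<le> n")
    case True
    then obtain m where n: "n = s + m" using le_Suc_ex by blast
    have "R n \<le> real s * C\<^sup>2 + C * (\<integral>x. \<bar>orbit_sum K m (cond_mean h) x\<bar> \<partial>\<pi>)"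
      unfolding R_def n by (rule cross_moment_bound[OF \<pi> h C s])
    also have "\<dots> \<le> real s * C\<^sup>2 + C * (e' * real m + B0)"
      using B0(2)[of m] C0 by (intro add_left_mono mult_left_mono)
    also have "\<dots> \<le> C * e' * real n + B1"
      using C0 e' by (simp add: n B1_def algebra_simps)
    finally show ?thesis .
  next
    case False
    have "R n \<le> real n * C\<^sup>2"
      using integral_law_bounded(2)[OF p _ hw[of _ n], of obs "\<lambda>\<omega>. seq_shift 1 (obs \<omega>)"] by (simp add: abs_le_iff R_def)
    also have "\<dots> \<le> real s * C\<^sup>2" using False by (intro mult_right_mono) auto
    also have "\<dots> \<le> C * e' * real n + B1" using C0 e' B0 by (simp add: B1_def)
    finally show ?thesis .
  qed
  define V where "V n = (\<integral>\<omega>. (window_sum h n (obs \<omega>))\<^sup>2 \<partial>law \<pi>)" for n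
  have sq: "\<bar>(window_sum h n y)\<^sup>2\<bar> \<le> (real n * C)\<^sup>2" for n y
    using w[of n y] C0 by (simp add: abs_le_square_iff[symmetric])
  have h2: "\<bar>(h y)\<^sup>2\<bar> \<le> C\<^sup>2" for y
    using C[of y] C0 by (simp add: abs_le_square_iff[symmetric])
  have V_Suc: "V (Suc n) \<le> C\<^sup>2 + 2 * R n + V n" for n
  proof -
    have "V (Suc n) = (\<integral>\<omega>. (h (obs \<omega>))\<^sup>2 + 2 * (h (obs \<omega>) * window_sum h n (seq_shift 1 (obs \<omega>)))
        + (window_sum h n (seq_shift 1 (obs \<omega>)))\<^sup>2 \<partial>law \<pi>)"
      unfolding V_def by (simp add: window_sum_Suc power2_eq_square algebra_simps)
    also have "\<dots> = (\<integral>\<omega>. (h (obs \<omega>))\<^sup>2 \<partial>law \<pi>) + 2 * R n + (\<integral>\<omega>. (window_sum h n (seq_shift 1 (obs \<omega>)))\<^sup>2 \<partial>law \<pi>)"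
    proof -
      have i: "integrable (law \<pi>) (\<lambda>\<omega>. (h (obs \<omega>))\<^sup>2)"
        by (rule integral_law_bounded(1)[OF p _ h2]) measurable
      have ii: "integrable (law \<pi>) (\<lambda>\<omega>. h (obs \<omega>) * window_sum h n (seq_shift 1 (obs \<omega>)))"
        by (rule integral_law_bounded(1)[OF p _ hw]) measurable
      have iii: "integrable (law \<pi>) (\<lambda>\<omega>. (window_sum h n (seq_shift 1 (obs \<omega>)))\<^sup>2)"
        by (rule integral_law_bounded(1)[OF p _ sq]) measurable
      show ?thesis unfolding R_def using i ii iii by simp
    qed
    also have "(\<integral>\<omega>. (window_sum h n (seq_shift 1 (obs \<omega>)))\<^sup>2 \<partial>law \<pi>) = V n"
      using integral_law_seq_shift[OF \<pi>, of "\<lambda>\<omega>. (window_sum h n (obs \<omega>))\<^sup>2" 1]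
      by (simp add: V_def obs_seq_shift)
    also have "(\<integral>\<omega>. (h (obs \<omega>))\<^sup>2 \<partial>law \<pi>) \<le> C\<^sup>2"
      using integral_law_bounded(2)[OF p _ h2, of obs] by (simp add: abs_le_iff)
    finally show ?thesis by simp
  qed
  have "V n \<le> real n * (e * real n + (C\<^sup>2 + 2 * B1))" for n
  proof (induction n)
    case 0 then show ?case by (simp add: V_def window_sum_def)
  next
    case (Suc n)
    note V_Suc[of n]
    also have "C\<^sup>2 + 2 * R n + V n \<le> C\<^sup>2 + 2 * (C * e' * real n + B1) + real n * (e * real n + (C\<^sup>2 + 2 * B1))"
      by (intro add_mono mult_left_mono R Suc.IH order_refl) simp
    also have "\<dots> = real (Suc n) * (C\<^sup>2 + 2 * B1) + (2 * C * e') * real n + e * real n * real n"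
      by (simp add: algebra_simps)
    also have "\<dots> \<le> real (Suc n) * (C\<^sup>2 + 2 * B1) + e * real n + e * real n * real n"
      using mult_right_mono[OF e'(2), of "real n"] by simp
    also have "\<dots> \<le> real (Suc n) * (e * real (Suc n) + (C\<^sup>2 + 2 * B1))"
      using e by (simp add: algebra_simps)
    finally show ?case .
  qed
  then show thesis using that unfolding V_def by blast
qed

text \<open>Chebyshev: it is enough that the second moment is of smaller order than the square of
  \<open>n\<close>.\<close>

theorem weak_law:
  assumes \<pi>: "invariant_prob K \<pi>" and unique: "\<And>\<pi>'. invariant_prob K \<pi>' \<Longrightarrow> \<pi>' = \<pi>"
    and h [measurable]: "h \<in> borel_measurable obs_space" and C: "\<And>y. \<bar>h y\<bar> \<le> C"
    and s: "depends_on s h" and mean: "(\<integral>\<omega>. h (obs \<omega>) \<partial>law \<pi>) = 0"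
    and a: "0 < a"
  shows "(\<lambda>n. measure (law \<pi>) {\<omega>. a * real n \<le> \<bar>window_sum h n (obs \<omega>)\<bar>}) \<longlonglongrightarrow> 0"
proof (rule LIMSEQ_I)
  note p [simp] = invariant_probD[OF \<pi>]
  interpret P: prob_space "law \<pi>" by (rule prob_space_law) simp
  have C0: "0 \<le> C" using C[of undefined] by linarith
  have w: "\<bar>window_sum h m y\<bar> \<le> real m * C" for m y by (rule abs_window_sum_le[OF C])
  have sq: "\<bar>(window_sum h n y)\<^sup>2\<bar> \<le> (real n * C)\<^sup>2" for n y
    using w[of n y] C0 by (simp add: abs_le_square_iff[symmetric])
  fix r :: real assume r: "0 < r"
  \<comment> \<open>Makes the quadratic part of the second moment contribute exactly
    \<open>r / 2\<close>.\<close>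
  define e where "e = r * a\<^sup>2 / 2"
  have e: "0 < e" using r a by (simp add: e_def)
  obtain B where B: "\<And>n. (\<integral>\<omega>. (window_sum h n (obs \<omega>))\<^sup>2 \<partial>law \<pi>) \<le> real n * (e * real n + B)"
    using window_sum_second_moment[OF \<pi> unique h C s mean e] by blast
  have "(\<lambda>n. B / a\<^sup>2 / real n) \<longlonglongrightarrow> 0" by (rule lim_const_over_n)
  then have "\<forall>\<^sub>F n in sequentially. B / a\<^sup>2 / real n < r / 2"
    using r by (intro order_tendstoD(2)) auto
  then have "\<forall>\<^sub>F n in sequentially. norm (measure (law \<pi>) {\<omega>. a * real n \<le> \<bar>window_sum h n (obs \<omega>)\<bar>} - 0) < r"
    using eventually_gt_at_top[of 0]
  proof eventually_elim
    case (elim n)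
    have i: "integrable (law \<pi>) (\<lambda>\<omega>. (window_sum h n (obs \<omega>))\<^sup>2)"
      by (rule integral_law_bounded(1)[OF p _ sq]) measurable
    have "measure (law \<pi>) {\<omega>. a * real n \<le> \<bar>window_sum h n (obs \<omega>)\<bar>}
      \<le> (\<integral>\<omega>. (window_sum h n (obs \<omega>))\<^sup>2 \<partial>law \<pi>) / (a * real n)\<^sup>2"
      using P.second_moment_method[of "\<lambda>\<omega>. window_sum h n (obs \<omega>)" "a * real n"] a elim(2) i by simp
    also have "\<dots> \<le> (real n * (e * real n + B)) / (a * real n)\<^sup>2"
      using B[of n] by (intro divide_right_mono) auto
    also have "\<dots> = r / 2 + B / a\<^sup>2 / real n"
      using elim(2) a by (simp add: e_def field_simps power2_eq_square)
    also have "\<dots> < r" using elim(1) by linarith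
    finally show ?case by simp
  qed
  then show "\<exists>no. \<forall>n\<ge>no. norm (measure (law \<pi>) {\<omega>. a * real n \<le> \<bar>window_sum h n (obs \<omega>)\<bar>} - 0) < r"
    by (simp add: eventually_sequentially)
qed

end

section \<open>Exponential deviation bounds under uniform ergodicity\<close>

text \<open>For \<open>u = - v\<close> with \<open>v \<ge> 0\<close> the bound passes through
  \<open>1 / (1 + v)\<close>: this dominates \<open>exp (- v)\<close>, and
  \<open>(1 - v + v^2) * (1 + v) = 1 + v^3\<close>.\<close>

lemma exp_le_quadratic:
  fixes u :: real assumes "\<bar>u\<bar> \<le> 1" shows "exp u \<le> 1 + u + u\<^sup>2"
proof (cases "0 \<le> u")
  case True then show ?thesis using assms by (intro exp_bound) auto
next
  case False
  define v where "v = - u"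
  have v: "0 \<le> v" using False by (simp add: v_def)
  have "1 \<le> (1 - v + v\<^sup>2) * (1 + v)"
    using v by (simp add: algebra_simps power2_eq_square)
  then have "1 / (1 + v) \<le> 1 - v + v\<^sup>2" using v by (simp add: field_simps)
  moreover have "exp u \<le> 1 / (1 + v)"
    using v exp_ge_add_one_self[of v] by (simp add: v_def exp_minus field_simps)
  ultimately show ?thesis by (simp add: v_def)
qed

lemma invariant_prob_kernel_iter:
  assumes [measurable]: "K \<in> borel \<rightarrow>\<^sub>M prob_algebra borel" and \<pi>: "invariant_prob K \<pi>"
  shows "\<pi> \<bind> kernel_iter K m = \<pi>"
proof (induction m)
  case 0
  have "kernel_iter K 0 = return borel" by (simp add: fun_eq_iff)
  then show ?case using \<pi> by (simp add: bind_return'' invariant_prob_def)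
next
  case (Suc m)
  have s: "sets \<pi> = sets borel" using \<pi> by (simp add: invariant_prob_def)
  have k: "kernel_iter K m \<in> \<pi> \<rightarrow>\<^sub>M subprob_algebra borel"
    unfolding measurable_cong_sets[OF s refl] by (rule measurable_prob_algebraD[OF measurable_kernel_iter]) fact
  have "kernel_iter K (Suc m) = (\<lambda>x. kernel_iter K m x \<bind> K)" by (simp add: fun_eq_iff)
  then have "\<pi> \<bind> kernel_iter K (Suc m) = (\<pi> \<bind> kernel_iter K m) \<bind> K"
    using bind_assoc[OF k measurable_prob_algebraD[OF assms(1)]] by simp
  then show ?case by (simp only: Suc invariant_prob_bind[OF assms])
qed

locale uniformly_ergodic =
  fixes K :: "'x::polish_space \<Rightarrow> 'x measure" and V :: "'x \<Rightarrow> real" and \<pi> :: "'x measure" and R \<alpha> :: real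
  assumes kernel: "K \<in> borel \<rightarrow>\<^sub>M prob_algebra borel"
    and V [measurable]: "V \<in> borel_measurable borel" and V_ge_1: "\<And>x. 1 \<le> V x"
    and \<pi>: "invariant_prob K \<pi>" and R: "0 \<le> R" and \<alpha>: "1 < \<alpha>"
    and dist: "\<And>x m. V_dist V (kernel_iter K m x) \<pi> \<le> ennreal (R / \<alpha> ^ m * V x)"
begin

text \<open>A finite \<open>V_dist\<close> excludes its branch \<open>\<infinity>\<close>, so the
  ergodicity bound already contains integrability of \<open>V\<close>.\<close>

lemma integrable_V_iter: "integrable (kernel_iter K m x) V" and integrable_V: "integrable \<pi> V"
  using dist[of m x] unfolding V_dist_def
  by (auto split: if_splits simp: top_unique)

lemma V_nonneg: "0 \<le> V x"
  using V_ge_1[of x] by linarith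

lemma integral_V_nonneg: "0 \<le> (\<integral>x. V x \<partial>\<pi>)"
  by (rule Bochner_Integration.integral_nonneg) (rule V_nonneg)

lemma integral_iter_dist:
  assumes [measurable]: "f \<in> borel_measurable borel" and f: "\<And>x. \<bar>f x\<bar> \<le> V x"
  shows "\<bar>(\<integral>x'. f x' \<partial>kernel_iter K m x) - (\<integral>x. f x \<partial>\<pi>)\<bar> \<le> R / \<alpha> ^ m * V x"
proof -
  have "ennreal \<bar>(\<integral>x'. f x' \<partial>kernel_iter K m x) - (\<integral>x. f x \<partial>\<pi>)\<bar> \<le> V_dist V (kernel_iter K m x) \<pi>"
    unfolding V_dist_def using integrable_V_iter[of m x] integrable_V f by (auto intro!: SUP_upper)
  also note dist[of m x]
  finally show ?thesis
    using R \<alpha> V_ge_1[of x] by (subst (asm) ennreal_le_iff) auto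
qed

text \<open>Division by \<open>C\<close> brings \<open>f\<close> below \<open>1\<close>, and
  \<open>1 \<le> V x\<close>.\<close>

lemma integral_iter_dist_bounded:
  assumes f: "bounded_by C f" and C: "0 < C"
  shows "\<bar>(\<integral>x'. f x' \<partial>kernel_iter K m x) - (\<integral>x. f x \<partial>\<pi>)\<bar> \<le> C * (R / \<alpha> ^ m * V x)"
proof -
  have "\<bar>(\<integral>x'. f x' / C \<partial>kernel_iter K m x) - (\<integral>x. f x / C \<partial>\<pi>)\<bar> \<le> R / \<alpha> ^ m * V x"
  proof (rule integral_iter_dist)
    show "(\<lambda>x. f x / C) \<in> borel_measurable borel" using f by auto
    show "\<bar>f x / C\<bar> \<le> V x" for x
    proof -
      have "\<bar>f x / C\<bar> \<le> 1" using bounded_byD(2)[OF f, of x] C by simp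
      then show ?thesis using V_ge_1[of x] by linarith
    qed
  qed
  then have "\<bar>(\<integral>x'. f x' \<partial>kernel_iter K m x) - (\<integral>x. f x \<partial>\<pi>)\<bar> / C \<le> R / \<alpha> ^ m * V x"
    using C by (simp add: diff_divide_distrib[symmetric])
  then show ?thesis using C by (simp add: field_simps)
qed

text \<open>From every starting point the iterates converge to \<open>\<pi>\<close> on each set.
  Integrated over \<open>\<pi>'\<close>, the left side is constantly the mass under
  \<open>\<pi>'\<close> and the limit is the mass under \<open>\<pi>\<close>. This is what makes
  \<open>stationary_dist\<close> denote \<open>\<pi>\<close>.\<close>

lemma unique_invariant:
  assumes \<pi>': "invariant_prob K \<pi>'" shows "\<pi>' = \<pi>"
proof (rule measure_eqI)
  note kernel [measurable]
  have s': "sets \<pi>' = sets borel" and s: "sets \<pi> = sets borel"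
    using \<pi> \<pi>' by (auto simp: invariant_prob_def)
  then show "sets \<pi>' = sets \<pi>" by simp
  interpret P: prob_space \<pi>' using \<pi>' by (simp add: invariant_prob_def)
  interpret Q: prob_space \<pi> using \<pi> by (simp add: invariant_prob_def)
  note p' = invariant_probD[OF \<pi>']
  fix A assume "A \<in> sets \<pi>'"
  then have A [measurable]: "A \<in> sets borel" by (simp add: s')
  have pk: "prob_space (kernel_iter K m x)" "sets (kernel_iter K m x) = sets borel" for m x
    using measurable_space[OF measurable_kernel_iter[OF kernel], of x m] by (auto simp: space_prob_algebra)
  have mm: "(\<lambda>x. measure (kernel_iter K m x) A) \<in> borel_measurable borel" for m
    using measurable_compose[OF measurable_kernel_iter[OF kernel] measurable_measure_prob_algebra[OF A]] by simp
  have mm': "(\<lambda>x. measure (kernel_iter K m x) A) \<in> borel_measurable \<pi>'" for m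
    unfolding measurable_cong_sets[OF s' refl] by (rule mm)
  have "(\<lambda>m. \<integral>x. measure (kernel_iter K m x) A \<partial>\<pi>') \<longlonglongrightarrow> (\<integral>x. measure \<pi> A \<partial>\<pi>')"
  proof (rule integral_dominated_convergence[where w="\<lambda>_. 1"])
    show "AE x in \<pi>'. (\<lambda>m. measure (kernel_iter K m x) A) \<longlonglongrightarrow> measure \<pi> A"
    proof (rule AE_I2)
      fix x
      have "\<bar>measure (kernel_iter K m x) A - measure \<pi> A\<bar> \<le> V x * R * inverse \<alpha> ^ m" for m
      proof -
        have "bounded_by 1 (indicator A :: 'x \<Rightarrow> real)"
          by (auto simp: bounded_by_def indicator_def)
        from integral_iter_dist_bounded[OF this, of m x] show ?thesis
          using s pk(2)[of m x] by (simp add: field_simps sets_eq_imp_space_eq[OF s] sets_eq_imp_space_eq[OF pk(2)])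
      qed
      then have "\<forall>m. norm (measure (kernel_iter K m x) A - measure \<pi> A) \<le> V x * R * inverse \<alpha> ^ m"
        by simp
      moreover have "(\<lambda>m. V x * R * inverse \<alpha> ^ m) \<longlonglongrightarrow> 0"
        using \<alpha> by (intro tendsto_mult_right_zero LIMSEQ_power_zero) (simp add: inverse_less_1_iff)
      ultimately have "(\<lambda>m. measure (kernel_iter K m x) A - measure \<pi> A) \<longlonglongrightarrow> 0"
        by (rule Lim_null_comparison[OF always_eventually])
      then show "(\<lambda>m. measure (kernel_iter K m x) A) \<longlonglongrightarrow> measure \<pi> A" by (simp add: LIM_zero_iff)
    qed
    show "\<And>m. AE x in \<pi>'. norm (measure (kernel_iter K m x) A) \<le> 1"
      using prob_space.prob_le_1[OF pk(1)] by simp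
  qed (use mm' in auto)
  moreover have "(\<integral>x. measure (kernel_iter K m x) A \<partial>\<pi>') = measure \<pi>' A" for m
  proof -
    have "emeasure \<pi>' A = (\<integral>\<^sup>+x. emeasure (kernel_iter K m x) A \<partial>\<pi>')"
      using emeasure_bind_prob_algebra[OF p' measurable_kernel_iter[OF kernel] A, of m]
      by (simp add: invariant_prob_kernel_iter[OF kernel \<pi>'])
    also have "\<dots> = (\<integral>\<^sup>+x. ennreal (measure (kernel_iter K m x) A) \<partial>\<pi>')"
      using finite_measure.emeasure_eq_measure[OF prob_space.finite_measure[OF pk(1)]] by simp
    also have "\<dots> = ennreal (\<integral>x. measure (kernel_iter K m x) A \<partial>\<pi>')"
      using prob_space.prob_le_1[OF pk(1)] mm'
      by (intro nn_integral_eq_integral P.integrable_const_bound[where B=1]) auto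
    finally show ?thesis by (simp add: P.emeasure_eq_measure)
  qed
  ultimately have "measure \<pi>' A = measure \<pi> A"
    using LIMSEQ_unique[OF tendsto_const] by (fastforce simp: P.prob_space)
  then show "emeasure \<pi>' A = emeasure \<pi> A"
    by (simp add: P.emeasure_eq_measure Q.emeasure_eq_measure)
qed

lemma stationary_dist_eq: "stationary_dist K = \<pi>"
  unfolding stationary_dist_def using \<pi> unique_invariant by (rule the_equality)

end

text \<open>Of each block of \<open>b\<close> observations only the \<open>b - s\<close> window
  positions whose \<open>s\<close> observations lie inside the block are used. Blocks then share no
  observation, and the Markov property at multiples of \<open>b\<close> separates them
  exactly.\<close>

definition block_sum :: "((nat \<Rightarrow> 'a) \<Rightarrow> real) \<Rightarrow> nat \<Rightarrow> nat \<Rightarrow> nat \<Rightarrow> (nat \<Rightarrow> 'a) \<Rightarrow> real" where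
  "block_sum h s b J y = (\<Sum>j<J. window_sum h (b - s) (seq_shift (j * b) y))"

lemma measurable_block_sum [measurable]:
  assumes [measurable]: "h \<in> borel_measurable (PiM UNIV (\<lambda>_. M))"
  shows "block_sum h s b J \<in> borel_measurable (PiM UNIV (\<lambda>_. M))"
  unfolding block_sum_def[abs_def] by measurable

lemma block_sum_Suc: "block_sum h s b (Suc J) y = window_sum h (b - s) y + block_sum h s b J (seq_shift b y)"
  unfolding block_sum_def sum.lessThan_Suc_shift by (simp add: seq_shift_seq_shift add.commute)

lemma depends_on_seq_shift: "depends_on s h \<Longrightarrow> depends_on (s + j) (\<lambda>y. h (seq_shift j y))"
  unfolding depends_on_def seq_shift_def by auto

lemma depends_on_mono: "depends_on s h \<Longrightarrow> s \<le> t \<Longrightarrow> depends_on t h"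
  unfolding depends_on_def by (meson order_less_le_trans)

lemma depends_on_window_sum:
  assumes "depends_on s h" shows "depends_on (n + s) (window_sum h n)"
proof -
  have "depends_on (n + s) (\<lambda>y. h (seq_shift j y))" if "j < n" for j
    using depends_on_mono[OF depends_on_seq_shift[OF assms, of j]] that by simp
  then show ?thesis
    unfolding depends_on_def window_sum_def by (auto intro!: sum.cong)
qed

locale hmm_ergodic = hmm K \<mu> G + uniformly_ergodic K V \<pi> R \<alpha>
  for K :: "'x::polish_space \<Rightarrow> 'x measure" and \<mu> :: "'y::polish_space measure" and G V \<pi> R \<alpha> +
  fixes h :: "(nat \<Rightarrow> 'y) \<Rightarrow> real" and C :: real and s :: nat
  assumes h [measurable]: "h \<in> borel_measurable (PiM UNIV (\<lambda>_. borel))"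
    and C: "\<And>y. \<bar>h y\<bar> \<le> C" and C_ge_1: "1 \<le> C"
    and depends: "depends_on s h"
    and mean: "(\<integral>\<omega>. h (obs \<omega>) \<partial>hmm_law K \<mu> G \<pi>) = 0"
begin

text \<open>The conditional means decay geometrically, so their sum stays below a geometric series
  whatever the length \<open>n\<close>; \<open>\<alpha> / (\<alpha> - 1)\<close> is the value of
  that series.\<close>

lemma cond_mean_window_sum_le: "cond_mean (window_sum h n) x \<le> C * R * \<alpha> / (\<alpha> - 1) * V x"
proof -
  note b = bounded_by_cond_mean[OF h C]
  have 1: "cond_mean (\<lambda>y. h (seq_shift j y)) x \<le> C * R * V x * inverse \<alpha> ^ j" for j
  proof -
    have "cond_mean (\<lambda>y. h (seq_shift j y)) x = (\<integral>x'. cond_mean h x' \<partial>kernel_iter K j x)"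
      by (rule cond_mean_seq_shift[OF h C])
    also have "\<dots> \<le> C * (R / \<alpha> ^ j * V x)"
      using integral_iter_dist_bounded[OF b, of j x] C_ge_1 integral_cond_mean[OF \<pi> h C] mean by simp
    finally show ?thesis by (simp add: field_simps)
  qed
  have "cond_mean (window_sum h n) x = (\<Sum>j<n. cond_mean (\<lambda>y. h (seq_shift j y)) x)"
    unfolding cond_mean_def window_sum_def
    using C by (intro Bochner_Integration.integral_sum integral_law_bounded(1)[where B=C]) auto
  also have "\<dots> \<le> (\<Sum>j<n. C * R * V x * inverse \<alpha> ^ j)" by (intro sum_mono 1)
  also have "\<dots> = C * R * V x * (\<Sum>j<n. inverse \<alpha> ^ j)" by (simp add: sum_distrib_left)
  also have "\<dots> \<le> C * R * V x * (1 / (1 - inverse \<alpha>))"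
  proof (intro mult_left_mono)
    have "(\<Sum>j<n. inverse \<alpha> ^ j) \<le> (\<Sum>j. inverse \<alpha> ^ j)"
      using \<alpha> by (intro sum_le_suminf summable_geometric) (auto simp: inverse_less_1_iff)
    also have "\<dots> = 1 / (1 - inverse \<alpha>)"
      using \<alpha> by (intro suminf_geometric) (auto simp: inverse_less_1_iff)
    finally show "(\<Sum>j<n. inverse \<alpha> ^ j) \<le> 1 / (1 - inverse \<alpha>)" .
    show "0 \<le> C * R * V x" using C_ge_1 R V_ge_1[of x] by (intro mult_nonneg_nonneg) auto
  qed
  also have "\<dots> = C * R * \<alpha> / (\<alpha> - 1) * V x" using \<alpha> by (simp add: field_simps)
  finally show ?thesis .
qed

text \<open>
  A block contributes at most \<open>\<epsilon> C\<^sub>1 V(x)\<close> to first order in \<open>\<epsilon>\<close>, with \<open>C\<^sub>1\<close> independent of the block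
  length; this is absorbed into the weight \<open>1 + \<eta> V\<close>.
\<close>
lemma block_drift:
  assumes b: "s \<le> b" and \<epsilon>: "0 < \<epsilon>" "\<epsilon> * real b * C \<le> 1"
    and \<kappa>: "R / \<alpha> ^ b \<le> 1 / 6"
    and C1: "C * R * \<alpha> / (\<alpha> - 1) \<le> C1" and \<eta>: "\<eta> = 2 * \<epsilon> * C1"
    and \<delta>: "\<delta> = (\<epsilon> * real b * C)\<^sup>2 + 6 * \<epsilon> * C1 * (\<integral>x. V x \<partial>\<pi>)"
  shows "(\<integral>\<^sup>+\<omega>. ennreal (exp (\<epsilon> * window_sum h (b - s) (obs \<omega>))) * ennreal (1 + \<eta> * V (fst (\<omega> b))) \<partial>law_from x)
    \<le> ennreal ((1 + \<delta>) * (1 + \<eta> * V x))"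
proof -
  let ?H = "\<lambda>\<omega> :: nat \<Rightarrow> 'x \<times> 'y. window_sum h (b - s) (obs \<omega>)"
  interpret P: prob_space "law_from x" by (rule prob_space_law) simp
  interpret \<pi>: prob_space \<pi> using \<pi> by (simp add: invariant_prob_def)
  have "0 \<le> C * R * \<alpha> / (\<alpha> - 1)" using C_ge_1 R \<alpha> by simp
  with C1 have C1_0: "0 \<le> C1" by linarith
  have \<eta>0: "0 \<le> \<eta>" using \<epsilon> C1_0 by (simp add: \<eta>)
  have \<pi>V: "0 \<le> (\<integral>x. V x \<partial>\<pi>)" by (rule integral_V_nonneg)
  have \<delta>0: "0 \<le> \<delta>" using \<epsilon> C1_0 \<pi>V by (simp add: \<delta>)
  have H: "\<bar>?H \<omega>\<bar> \<le> real b * C" for \<omega>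
  proof -
    have "\<bar>?H \<omega>\<bar> \<le> real (b - s) * C" by (rule abs_window_sum_le[OF C])
    also have "\<dots> \<le> real b * C" using C_ge_1 by (intro mult_right_mono) auto
    finally show ?thesis .
  qed
  have \<epsilon>H: "\<bar>\<epsilon> * ?H \<omega>\<bar> \<le> \<epsilon> * real b * C" for \<omega>
    using mult_left_mono[OF H[of \<omega>], of \<epsilon>] \<epsilon> by (simp add: abs_mult mult.assoc)
  have \<epsilon>H1: "\<bar>\<epsilon> * ?H \<omega>\<bar> \<le> 1" for \<omega> using \<epsilon>H[of \<omega>] \<epsilon> by linarith
  have \<epsilon>H2: "(\<epsilon> * ?H \<omega>)\<^sup>2 \<le> (\<epsilon> * real b * C)\<^sup>2" for \<omega>
    using \<epsilon>H[of \<omega>] by (metis abs_le_square_iff abs_ge_self order_trans)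
  \<comment> \<open>The quadratic expansion is applied to the constant part only; against the
    unbounded \<open>V\<close> the crude factor \<open>3\<close> suffices, since
    \<open>\<eta>\<close> is itself of order \<open>\<epsilon>\<close>.\<close>
  have point: "exp (\<epsilon> * ?H \<omega>) * (1 + \<eta> * V x') \<le> 1 + \<epsilon> * ?H \<omega> + (\<epsilon> * real b * C)\<^sup>2 + 3 * \<eta> * V x'" for \<omega> x'
  proof -
    have "exp (\<epsilon> * ?H \<omega>) \<le> exp 1" using \<epsilon>H1[of \<omega>] by simp
    also have "\<dots> \<le> 3" by (rule exp_le)
    finally have "exp (\<epsilon> * ?H \<omega>) * (\<eta> * V x') \<le> 3 * (\<eta> * V x')"
      using \<eta>0 V_ge_1[of x'] by (intro mult_right_mono mult_nonneg_nonneg) auto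
    moreover have "exp (\<epsilon> * ?H \<omega>) \<le> 1 + \<epsilon> * ?H \<omega> + (\<epsilon> * real b * C)\<^sup>2"
      using exp_le_quadratic[OF \<epsilon>H1[of \<omega>]] \<epsilon>H2[of \<omega>] by linarith
    ultimately show ?thesis by (simp add: distrib_left)
  qed
  have iH: "integrable (law_from x) ?H"
    by (rule integral_law_bounded(1)[OF _ _ H]) auto
  have nnV: "(\<integral>\<^sup>+\<omega>. ennreal (V (fst (\<omega> b))) \<partial>law_from x) = ennreal (\<integral>x'. V x' \<partial>kernel_iter K b x)"
    using nn_integral_law_from_X[of "\<lambda>x. ennreal (V x)" x b]
      nn_integral_eq_integral[OF integrable_V_iter[of b x]] V_nonneg by simp
  have iV: "integrable (law_from x) (\<lambda>\<omega>. V (fst (\<omega> b)))"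
    by (rule integrableI_nonneg) (auto simp: nnV V_nonneg)
  have eV: "(\<integral>\<omega>. V (fst (\<omega> b)) \<partial>law_from x) = (\<integral>x'. V x' \<partial>kernel_iter K b x)"
    using nnV nn_integral_eq_integral[OF iV] V_nonneg by (simp add: Bochner_Integration.integral_nonneg)
  have Vb: "(\<integral>x'. V x' \<partial>kernel_iter K b x) \<le> (\<integral>x. V x \<partial>\<pi>) + 1 / 6 * V x"
  proof -
    have "\<bar>(\<integral>x'. V x' \<partial>kernel_iter K b x) - (\<integral>x. V x \<partial>\<pi>)\<bar> \<le> R / \<alpha> ^ b * V x"
      by (intro integral_iter_dist) (auto simp: abs_of_nonneg V_nonneg)
    also have "\<dots> \<le> 1 / 6 * V x"
      using \<kappa> V_ge_1[of x] by (intro mult_right_mono) auto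
    finally show ?thesis by linarith
  qed
  have "(\<integral>\<^sup>+\<omega>. ennreal (exp (\<epsilon> * ?H \<omega>)) * ennreal (1 + \<eta> * V (fst (\<omega> b))) \<partial>law_from x)
    \<le> (\<integral>\<^sup>+\<omega>. ennreal (1 + \<epsilon> * ?H \<omega> + (\<epsilon> * real b * C)\<^sup>2 + 3 * \<eta> * V (fst (\<omega> b))) \<partial>law_from x)"
    by (intro nn_integral_mono) (simp add: ennreal_mult'[symmetric] ennreal_leI point)
  also have "\<dots> = ennreal (\<integral>\<omega>. 1 + \<epsilon> * ?H \<omega> + (\<epsilon> * real b * C)\<^sup>2 + 3 * \<eta> * V (fst (\<omega> b)) \<partial>law_from x)"
  proof (rule nn_integral_eq_integral)
    show "integrable (law_from x) (\<lambda>\<omega>. 1 + \<epsilon> * ?H \<omega> + (\<epsilon> * real b * C)\<^sup>2 + 3 * \<eta> * V (fst (\<omega> b)))"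
      using iH iV by simp
    \<comment> \<open>The integrand of the bound is nonnegative because it dominates a nonnegative
      product.\<close>
    have "0 \<le> exp (\<epsilon> * ?H \<omega>) * (1 + \<eta> * V x')" for \<omega> x'
      using \<eta>0 V_ge_1[of x'] by (intro mult_nonneg_nonneg add_nonneg_nonneg) auto
    then show "AE \<omega> in law_from x. 0 \<le> 1 + \<epsilon> * ?H \<omega> + (\<epsilon> * real b * C)\<^sup>2 + 3 * \<eta> * V (fst (\<omega> b))"
      using point by (intro AE_I2) (rule order_trans)
  qed
  also have "(\<integral>\<omega>. 1 + \<epsilon> * ?H \<omega> + (\<epsilon> * real b * C)\<^sup>2 + 3 * \<eta> * V (fst (\<omega> b)) \<partial>law_from x)
    = 1 + \<epsilon> * cond_mean (window_sum h (b - s)) x + (\<epsilon> * real b * C)\<^sup>2 + 3 * \<eta> * (\<integral>x'. V x' \<partial>kernel_iter K b x)"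
    using iH iV P.prob_space by (simp add: cond_mean_def eV)
  also have "\<dots> \<le> 1 + \<epsilon> * (C1 * V x) + (\<epsilon> * real b * C)\<^sup>2 + 3 * \<eta> * ((\<integral>x. V x \<partial>\<pi>) + 1 / 6 * V x)"
  proof -
    have "cond_mean (window_sum h (b - s)) x \<le> C1 * V x"
      using cond_mean_window_sum_le[of "b - s" x] mult_right_mono[OF C1, of "V x"] V_ge_1[of x] by linarith
    then show ?thesis using \<epsilon> \<eta>0 by (intro add_mono mult_left_mono Vb) auto
  qed
  \<comment> \<open>Here the constants fit: the mean of the block costs
    \<open>\<epsilon> * C1 * V x\<close>, the value of \<open>V\<close> at the end of the block
    costs \<open>3 * \<eta> / 6 * V x\<close>, and each is half of \<open>\<eta> * V x\<close>. What
    does not depend on \<open>x\<close> is collected in \<open>\<delta>\<close>.\<close>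
  also have "\<dots> = 1 + \<delta> + \<eta> * V x"
    by (simp add: \<delta> \<eta> algebra_simps)
  also have "\<dots> \<le> (1 + \<delta>) * (1 + \<eta> * V x)"
    using \<delta>0 \<eta>0 V_ge_1[of x] by (simp add: algebra_simps)
  finally show ?thesis by (simp add: ennreal_leI)
qed

text \<open>The blocks after the first are bounded by the hypothesis at the state
  \<open>fst (\<omega> b)\<close>, which leaves the weight there; the drift bound then turns the
  first block and this weight into a multiple of the weight at \<open>x\<close>. The weight is at
  least \<open>1\<close>, which settles \<open>J = 0\<close>.\<close>

lemma block_sum_exponential_moment:
  assumes b: "s \<le> b" and \<eta>: "0 \<le> \<eta>" and \<delta>: "0 \<le> \<delta>"
    and drift: "\<And>x. (\<integral>\<^sup>+\<omega>. ennreal (exp (\<epsilon> * window_sum h (b - s) (obs \<omega>))) * ennreal (1 + \<eta> * V (fst (\<omega> b))) \<partial>law_from x)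
      \<le> ennreal ((1 + \<delta>) * (1 + \<eta> * V x))"
  shows "(\<integral>\<^sup>+\<omega>. ennreal (exp (\<epsilon> * block_sum h s b J (obs \<omega>))) \<partial>law_from x) \<le> ennreal ((1 + \<delta>) ^ J * (1 + \<eta> * V x))"
proof (induction J arbitrary: x)
  case 0
  interpret P: prob_space "law_from x" by (rule prob_space_law) simp
  have "0 \<le> \<eta> * V x" using \<eta> V_ge_1[of x] by (intro mult_nonneg_nonneg) auto
  then show ?case using P.emeasure_space_1 by (simp add: block_sum_def)
next
  case (Suc J)
  \<comment> \<open>\<open>(b - s) + s = b\<close>: the sum over a block is a function of that block
    alone.\<close>
  have dep: "depends_on b (window_sum h (b - s))"
    using depends_on_window_sum[OF depends, of "b - s"] b by simp
  have "(\<integral>\<^sup>+\<omega>. ennreal (exp (\<epsilon> * block_sum h s b (Suc J) (obs \<omega>))) \<partial>law_from x)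
    = (\<integral>\<^sup>+\<omega>. \<integral>\<^sup>+\<omega>'. ennreal (exp (\<epsilon> * window_sum h (b - s) (obs \<omega>))) * ennreal (exp (\<epsilon> * block_sum h s b J (obs \<omega>'))) \<partial>law_from (fst (\<omega> b)) \<partial>law_from x)"
    by (subst nn_integral_law_markov[where n=b])
      (auto simp: block_sum_Suc obs_comb_seq depends_on_comb_seq[OF dep] distrib_left exp_add ennreal_mult)
  also have "\<dots> = (\<integral>\<^sup>+\<omega>. ennreal (exp (\<epsilon> * window_sum h (b - s) (obs \<omega>))) * (\<integral>\<^sup>+\<omega>'. ennreal (exp (\<epsilon> * block_sum h s b J (obs \<omega>'))) \<partial>law_from (fst (\<omega> b))) \<partial>law_from x)"
    by (intro nn_integral_cong nn_integral_cmult) auto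
  also have "\<dots> \<le> (\<integral>\<^sup>+\<omega>. ennreal ((1 + \<delta>) ^ J) * (ennreal (exp (\<epsilon> * window_sum h (b - s) (obs \<omega>))) * ennreal (1 + \<eta> * V (fst (\<omega> b)))) \<partial>law_from x)"
  proof (intro nn_integral_mono)
    fix \<omega> :: "nat \<Rightarrow> 'x \<times> 'y"
    have "(\<integral>\<^sup>+\<omega>'. ennreal (exp (\<epsilon> * block_sum h s b J (obs \<omega>'))) \<partial>law_from (fst (\<omega> b))) \<le> ennreal ((1 + \<delta>) ^ J) * ennreal (1 + \<eta> * V (fst (\<omega> b)))"
      using Suc.IH[of "fst (\<omega> b)"] \<delta> \<eta> V_nonneg[of "fst (\<omega> b)"] by (subst ennreal_mult[symmetric]) auto
    from mult_left_mono[OF this, of "ennreal (exp (\<epsilon> * window_sum h (b - s) (obs \<omega>)))"]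
    show "ennreal (exp (\<epsilon> * window_sum h (b - s) (obs \<omega>))) * (\<integral>\<^sup>+\<omega>'. ennreal (exp (\<epsilon> * block_sum h s b J (obs \<omega>'))) \<partial>law_from (fst (\<omega> b)))
      \<le> ennreal ((1 + \<delta>) ^ J) * (ennreal (exp (\<epsilon> * window_sum h (b - s) (obs \<omega>))) * ennreal (1 + \<eta> * V (fst (\<omega> b))))"
      by (simp add: mult_ac)
  qed
  also have "\<dots> = ennreal ((1 + \<delta>) ^ J) * (\<integral>\<^sup>+\<omega>. ennreal (exp (\<epsilon> * window_sum h (b - s) (obs \<omega>))) * ennreal (1 + \<eta> * V (fst (\<omega> b))) \<partial>law_from x)"
    by (rule nn_integral_cmult) auto
  also have "\<dots> \<le> ennreal ((1 + \<delta>) ^ J) * ennreal ((1 + \<delta>) * (1 + \<eta> * V x))"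
    by (intro mult_left_mono drift) auto
  also have "\<dots> = ennreal ((1 + \<delta>) ^ Suc J * (1 + \<eta> * V x))"
    using \<delta> by (subst ennreal_mult'[symmetric]) (auto simp: mult_ac)
  finally show ?case .
qed

text \<open>Markov's inequality for the exponential of \<open>\<epsilon>\<close> times the block
  sum. The threshold gains \<open>\<epsilon> * b / 2\<close> per block and the moment grows by at
  most \<open>\<epsilon> * b / 4\<close>, which leaves the rate
  \<open>c = \<epsilon> * b / 4\<close>. The parameter \<open>b0\<close> lets a caller ask for
  longer blocks.\<close>

theorem block_sum_deviation:
  obtains b c \<eta> where "b0 \<le> b" "0 < b" "0 < c" "0 \<le> \<eta>"
    "\<And>\<nu> J. \<nu> \<in> space (prob_algebra borel) \<Longrightarrow>
      emeasure (law \<nu>) {\<omega>. real J * real b / 2 \<le> block_sum h s b J (obs \<omega>)}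
        \<le> ennreal (exp (- c * real J)) * (\<integral>\<^sup>+x. ennreal (1 + \<eta> * V x) \<partial>\<nu>)"
proof -
  define C1 where "C1 = C * R * \<alpha> / (\<alpha> - 1)"
  define \<pi>V where "\<pi>V = (\<integral>x. V x \<partial>\<pi>)"
  have C1_0: "0 \<le> C1" using C_ge_1 R \<alpha> by (simp add: C1_def)
  have \<pi>V: "0 \<le> \<pi>V" unfolding \<pi>V_def by (rule integral_V_nonneg)
  have "(\<lambda>b. R * inverse \<alpha> ^ b) \<longlonglongrightarrow> 0"
    using \<alpha> by (intro tendsto_mult_right_zero LIMSEQ_power_zero) (simp add: inverse_less_1_iff)
  then have "\<forall>\<^sub>F b in sequentially. R * inverse \<alpha> ^ b < 1 / 6"
    by (rule order_tendstoD(2)) simp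
  \<comment> \<open>The block length is fixed before \<open>\<epsilon>\<close>; the factor
    \<open>48\<close> makes \<open>6 * C1 * \<pi>V\<close> at most \<open>b / 8\<close>.\<close>
  moreover obtain b1 :: nat where b1: "48 * C1 * \<pi>V \<le> real b1" using real_arch_simple by blast
  ultimately have "\<forall>\<^sub>F b in sequentially. R * inverse \<alpha> ^ b < 1 / 6 \<and> b \<ge> Suc (b0 + b1 + s)"
    by (intro eventually_conj eventually_ge_at_top)
  then obtain b where b: "R * inverse \<alpha> ^ b < 1 / 6" "b \<ge> Suc (b0 + b1 + s)"
    by (auto simp: eventually_sequentially)
  have b': "s \<le> b" "b0 \<le> b" "0 < b" "48 * C1 * \<pi>V \<le> real b" using b b1 by auto
  \<comment> \<open>Chosen so that the square of \<open>\<epsilon> * b * C = 1 / (8 * C)\<close>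
    equals \<open>\<epsilon> * b / 8\<close>. The two parts of \<open>\<delta>\<close> then add up
    to at most \<open>\<epsilon> * b / 4\<close>.\<close>
  define \<epsilon> where "\<epsilon> = 1 / (8 * real b * C\<^sup>2)"
  define \<eta> where "\<eta> = 2 * \<epsilon> * C1"
  define \<delta> where "\<delta> = (\<epsilon> * real b * C)\<^sup>2 + 6 * \<epsilon> * C1 * \<pi>V"
  have \<epsilon>: "0 < \<epsilon>" using b' C_ge_1 by (simp add: \<epsilon>_def)
  have \<epsilon>bC: "\<epsilon> * real b * C = 1 / (8 * C)" using b' C_ge_1 by (simp add: \<epsilon>_def power2_eq_square)
  have \<delta>0: "0 \<le> \<delta>" using \<epsilon> C1_0 \<pi>V by (simp add: \<delta>_def)
  have \<eta>0: "0 \<le> \<eta>" using \<epsilon> C1_0 by (simp add: \<eta>_def)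
  have "\<delta> = \<epsilon> * real b / 8 + \<epsilon> * (6 * C1 * \<pi>V)"
    using b' C_ge_1 unfolding \<delta>_def \<epsilon>bC by (simp add: \<epsilon>_def field_simps power2_eq_square)
  also have "\<dots> \<le> \<epsilon> * real b / 8 + \<epsilon> * (real b / 8)"
    using b'(4) \<epsilon> by (intro add_left_mono mult_left_mono) auto
  finally have \<delta>: "\<delta> \<le> \<epsilon> * real b / 4" by simp
  have drift: "(\<integral>\<^sup>+\<omega>. ennreal (exp (\<epsilon> * window_sum h (b - s) (obs \<omega>))) * ennreal (1 + \<eta> * V (fst (\<omega> b))) \<partial>law_from x)
      \<le> ennreal ((1 + \<delta>) * (1 + \<eta> * V x))" for x
  proof (rule block_drift[OF b'(1) \<epsilon>])
    show "\<epsilon> * real b * C \<le> 1" unfolding \<epsilon>bC using C_ge_1 by simp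
    show "R / \<alpha> ^ b \<le> 1 / 6" using b(1) by (simp add: field_simps)
    show "C * R * \<alpha> / (\<alpha> - 1) \<le> C1" by (simp add: C1_def)
  qed (simp_all add: \<eta>_def \<delta>_def \<pi>V_def)
  show thesis
  proof (rule that[of b "\<epsilon> * real b / 4" \<eta>])
    fix \<nu> :: "'x measure" and J :: nat assume \<nu> [simp]: "\<nu> \<in> space (prob_algebra borel)"
    let ?S = "\<lambda>\<omega> :: nat \<Rightarrow> 'x \<times> 'y. block_sum h s b J (obs \<omega>)"
    have "emeasure (law \<nu>) {\<omega>. real J * real b / 2 \<le> ?S \<omega>} = (\<integral>\<^sup>+\<omega>. indicator {\<omega>. real J * real b / 2 \<le> ?S \<omega>} \<omega> \<partial>law \<nu>)"
    proof (rule nn_integral_indicator[symmetric])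
      have "{\<omega> \<in> space paths. real J * real b / 2 \<le> ?S \<omega>} \<in> sets paths" by measurable
      then show "{\<omega>. real J * real b / 2 \<le> ?S \<omega>} \<in> sets (law \<nu>)" by simp
    qed
    also have "\<dots> \<le> (\<integral>\<^sup>+\<omega>. ennreal (exp (- (\<epsilon> * (real J * real b / 2)))) * ennreal (exp (\<epsilon> * ?S \<omega>)) \<partial>law \<nu>)"
    proof (intro nn_integral_mono)
      fix \<omega> :: "nat \<Rightarrow> 'x \<times> 'y"
      have "1 \<le> exp (- (\<epsilon> * (real J * real b / 2)) + \<epsilon> * ?S \<omega>)" if "real J * real b / 2 \<le> ?S \<omega>"
        using mult_left_mono[OF that, of \<epsilon>] \<epsilon> by simp
      then have "1 \<le> exp (- (\<epsilon> * (real J * real b / 2))) * exp (\<epsilon> * ?S \<omega>)" if "real J * real b / 2 \<le> ?S \<omega>"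
        using that by (simp only: exp_add)
      then show "indicator {\<omega>. real J * real b / 2 \<le> ?S \<omega>} \<omega> \<le> ennreal (exp (- (\<epsilon> * (real J * real b / 2)))) * ennreal (exp (\<epsilon> * ?S \<omega>))"
        by (simp add: indicator_def ennreal_mult'[symmetric])
    qed
    also have "\<dots> = ennreal (exp (- (\<epsilon> * (real J * real b / 2)))) * (\<integral>\<^sup>+\<omega>. ennreal (exp (\<epsilon> * ?S \<omega>)) \<partial>law \<nu>)"
      by (rule nn_integral_cmult) auto
    also have "(\<integral>\<^sup>+\<omega>. ennreal (exp (\<epsilon> * ?S \<omega>)) \<partial>law \<nu>) = (\<integral>\<^sup>+x. \<integral>\<^sup>+\<omega>. ennreal (exp (\<epsilon> * ?S \<omega>)) \<partial>law_from x \<partial>\<nu>)"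
      by (rule nn_integral_law_mixture[OF \<nu>]) measurable
    also have "\<dots> \<le> (\<integral>\<^sup>+x. ennreal ((1 + \<delta>) ^ J) * ennreal (1 + \<eta> * V x) \<partial>\<nu>)"
      using block_sum_exponential_moment[OF b'(1) \<eta>0 \<delta>0 drift] \<delta>0
      by (intro nn_integral_mono) (simp add: ennreal_mult')
    also have "\<dots> = ennreal ((1 + \<delta>) ^ J) * (\<integral>\<^sup>+x. ennreal (1 + \<eta> * V x) \<partial>\<nu>)"
    proof (rule nn_integral_cmult)
      have s: "sets \<nu> = sets borel" using \<nu> by (simp add: space_prob_algebra)
      show "(\<lambda>x. ennreal (1 + \<eta> * V x)) \<in> borel_measurable \<nu>"
        unfolding measurable_cong_sets[OF s refl] by measurable
    qed
    also have "ennreal ((1 + \<delta>) ^ J) \<le> ennreal (exp (\<epsilon> * real b / 4 * real J))"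
    proof (rule ennreal_leI)
      have "(1 + \<delta>) ^ J \<le> exp (\<epsilon> * real b / 4) ^ J"
        using \<delta> \<delta>0 exp_ge_add_one_self[of "\<epsilon> * real b / 4"] by (intro power_mono) linarith+
      then show "(1 + \<delta>) ^ J \<le> exp (\<epsilon> * real b / 4 * real J)" unfolding exp_of_nat2_mult .
    qed
    also have "ennreal (exp (- (\<epsilon> * (real J * real b / 2)))) * (ennreal (exp (\<epsilon> * real b / 4 * real J)) * (\<integral>\<^sup>+x. ennreal (1 + \<eta> * V x) \<partial>\<nu>))
      = ennreal (exp (- (\<epsilon> * (real J * real b / 2))) * exp (\<epsilon> * real b / 4 * real J)) * (\<integral>\<^sup>+x. ennreal (1 + \<eta> * V x) \<partial>\<nu>)"
      by (simp add: ennreal_mult' mult.assoc)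
    also have "exp (- (\<epsilon> * (real J * real b / 2))) * exp (\<epsilon> * real b / 4 * real J) = exp (- (\<epsilon> * real b / 4) * real J)"
      unfolding exp_add[symmetric] by (simp add: field_simps)
    finally show "emeasure (law \<nu>) {\<omega>. real J * real b / 2 \<le> ?S \<omega>}
        \<le> ennreal (exp (- (\<epsilon> * real b / 4) * real J)) * (\<integral>\<^sup>+x. ennreal (1 + \<eta> * V x) \<partial>\<nu>)"
      by (simp add: mult_left_mono mult_right_mono)
  qed (use b' \<epsilon> \<eta>0 in auto)
qed

end

section \<open>Likelihoods and finite-dimensional laws of the observations\<close>

text \<open>Tonelli over the first \<open>p\<close> and the last \<open>m\<close> coordinates, with
  \<open>comb_seq\<close> as gluing map. Points of a product are \<open>undefined\<close> off the
  index set, and gluing respects this: from \<open>p + m\<close> on the value is that of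
  \<open>y'\<close> from \<open>m\<close> on.\<close>

lemma nn_integral_PiM_comb_seq:
  fixes F :: "(nat \<Rightarrow> 'a) \<Rightarrow> ennreal"
  assumes "sigma_finite_measure N" and "F \<in> borel_measurable (PiM {..<p + m} (\<lambda>_. N))"
  shows "(\<integral>\<^sup>+y. F y \<partial>PiM {..<p + m} (\<lambda>_. N)) =
    (\<integral>\<^sup>+y. \<integral>\<^sup>+y'. F (comb_seq p y y') \<partial>PiM {..<m} (\<lambda>_. N) \<partial>PiM {..<p} (\<lambda>_. N))"
  using assms(2)
proof (induction m arbitrary: F)
  case (0 F)
  have "(\<integral>\<^sup>+y'. F (comb_seq p y y') \<partial>PiM {..<0} (\<lambda>_. N)) = F y" if "y \<in> space (PiM {..<p} (\<lambda>_. N))" for y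
  proof -
    have "comb_seq p y (\<lambda>_. undefined) = y"
      using that by (auto simp: fun_eq_iff comb_seq_def space_PiM PiE_iff extensional_def)
    then show ?thesis by (simp add: PiM_empty nn_integral_count_space_finite)
  qed
  then show ?case unfolding add_0_right by (intro nn_integral_cong) simp
next
  case (Suc m F)
  interpret N: sigma_finite_measure N by fact
  interpret product_sigma_finite "\<lambda>_::nat. N" by standard
  note Suc.prems [measurable]
  have i: "{..<p + Suc m} = insert (p + m) {..<p + m}" "{..<Suc m} = insert m {..<m}" by auto
  have F' [measurable]: "F \<in> borel_measurable (PiM (insert (p + m) {..<p + m}) (\<lambda>_. N))"
    using Suc.prems by (simp only: i)
  have m1: "(\<lambda>(y, z). F (fun_upd y (p + m) z)) \<in> borel_measurable (PiM {..<p + m} (\<lambda>_. N) \<Otimes>\<^sub>M N)"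
    using measurable_compose[OF measurable_add_dim F'] by (simp add: split_beta)
  have m2: "(\<lambda>y. \<integral>\<^sup>+z. F (fun_upd y (p + m) z) \<partial>N) \<in> borel_measurable (PiM {..<p + m} (\<lambda>_. N))"
    by (rule N.borel_measurable_nn_integral[OF m1])
  have "(\<integral>\<^sup>+y. F y \<partial>PiM {..<p + Suc m} (\<lambda>_. N)) = (\<integral>\<^sup>+y. \<integral>\<^sup>+z. F (fun_upd y (p + m) z) \<partial>N \<partial>PiM {..<p + m} (\<lambda>_. N))"
    unfolding i by (rule product_nn_integral_insert) (use F' in auto)
  also have "\<dots> = (\<integral>\<^sup>+y. \<integral>\<^sup>+y'. \<integral>\<^sup>+z. F (fun_upd (comb_seq p y y') (p + m) z) \<partial>N \<partial>PiM {..<m} (\<lambda>_. N) \<partial>PiM {..<p} (\<lambda>_. N))"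
    by (rule Suc.IH[OF m2])
  also have "\<dots> = (\<integral>\<^sup>+y. \<integral>\<^sup>+y'. F (comb_seq p y y') \<partial>PiM {..<Suc m} (\<lambda>_. N) \<partial>PiM {..<p} (\<lambda>_. N))"
  proof (rule nn_integral_cong)
    fix y assume y: "y \<in> space (PiM {..<p} (\<lambda>_. N))"
    have e: "fun_upd (comb_seq p y y') (p + m) z = comb_seq p y (fun_upd y' m z)" for y' z
      by (auto simp: fun_eq_iff comb_seq_def)
    have "comb_seq p y \<in> PiM (insert m {..<m}) (\<lambda>_. N) \<rightarrow>\<^sub>M PiM (insert (p + m) {..<p + m}) (\<lambda>_. N)"
    proof (rule measurable_PiM_single')
      fix j assume j: "j \<in> insert (p + m) {..<p + m}"
      show "(\<lambda>y'. comb_seq p y y' j) \<in> PiM (insert m {..<m}) (\<lambda>_. N) \<rightarrow>\<^sub>M N"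
      proof (cases "j < p")
        case True
        then show ?thesis using y by (simp add: comb_seq_def space_PiM PiE_iff)
      next
        case False
        then have "j - p \<in> insert m {..<m}" using j by auto
        then show ?thesis using False by (simp add: comb_seq_def measurable_component_singleton)
      qed
    next
      show "comb_seq p y \<in> space (PiM (insert m {..<m}) (\<lambda>_. N)) \<rightarrow> (\<Pi>\<^sub>E i\<in>insert (p + m) {..<p + m}. space N)"
      proof (intro funcsetI PiE_I)
        fix y' i assume y': "y' \<in> space (PiM (insert m {..<m}) (\<lambda>_. N))"
        show "comb_seq p y y' i \<in> space N" if i: "i \<in> insert (p + m) {..<p + m}"
        proof (cases "i < p")
          case False
          then have "i - p \<in> insert m {..<m}" using i by auto
          then show ?thesis using False y' by (auto simp: comb_seq_def space_PiM PiE_iff)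
        qed (use y in \<open>simp add: comb_seq_def space_PiM PiE_iff\<close>)
        show "comb_seq p y y' i = undefined" if i: "i \<notin> insert (p + m) {..<p + m}"
        proof -
          have "i - p \<notin> insert m {..<m}" "\<not> i < p" using i by auto
          then show ?thesis using y' by (auto simp: comb_seq_def space_PiM PiE_iff extensional_def)
        qed
      qed
    qed
    from measurable_compose[OF this F']
    have "(\<lambda>y'. F (comb_seq p y y')) \<in> borel_measurable (PiM (insert m {..<m}) (\<lambda>_. N))" .
    then show "(\<integral>\<^sup>+y'. \<integral>\<^sup>+z. F (fun_upd (comb_seq p y y') (p + m) z) \<partial>N \<partial>PiM {..<m} (\<lambda>_. N)) =
      (\<integral>\<^sup>+y'. F (comb_seq p y y') \<partial>PiM {..<Suc m} (\<lambda>_. N))"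
      unfolding i(2) e by (subst product_nn_integral_insert) auto
  qed
  finally show ?case .
qed

lemma nn_integral_PiM_case_nat:
  fixes F :: "(nat \<Rightarrow> 'a) \<Rightarrow> ennreal"
  assumes N: "sigma_finite_measure N" and F: "F \<in> borel_measurable (PiM {..Suc n} (\<lambda>_. N))"
  shows "(\<integral>\<^sup>+y. F y \<partial>PiM {..Suc n} (\<lambda>_. N)) =
    (\<integral>\<^sup>+y0. \<integral>\<^sup>+y'. F (case_nat y0 y') \<partial>PiM {..n} (\<lambda>_. N) \<partial>N)"
proof -
  interpret N: sigma_finite_measure N by fact
  interpret product_sigma_finite "\<lambda>_::nat. N" by standard
  interpret PN: sigma_finite_measure "PiM {..n} (\<lambda>_. N)" by (rule sigma_finite) simp
  have s: "{..Suc n} = {..<1 + Suc n}" "{..n} = {..<Suc n}" "{..<1} = {0::nat}" by auto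
  have c: "(\<lambda>(y0, y'). case_nat y0 y') \<in> N \<Otimes>\<^sub>M PiM {..n} (\<lambda>_. N) \<rightarrow>\<^sub>M PiM {..Suc n} (\<lambda>_. N)"
  proof (rule measurable_PiM_single')
    fix i assume i: "i \<in> {..Suc n}"
    then show "(\<lambda>p. (case p of (y0, y') \<Rightarrow> case_nat y0 y') i) \<in> N \<Otimes>\<^sub>M PiM {..n} (\<lambda>_. N) \<rightarrow>\<^sub>M N"
      by (cases i) (auto simp: split_beta)
  qed (auto simp: space_pair_measure space_PiM PiE_iff extensional_def split: nat.splits)
  have m: "(\<lambda>y0. \<integral>\<^sup>+y'. F (case_nat y0 y') \<partial>PiM {..n} (\<lambda>_. N)) \<in> borel_measurable N"
    using measurable_compose[OF c F] by (intro PN.borel_measurable_nn_integral) (simp add: split_beta)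
  have "(\<integral>\<^sup>+y. F y \<partial>PiM {..Suc n} (\<lambda>_. N)) =
    (\<integral>\<^sup>+y. \<integral>\<^sup>+y'. F (comb_seq 1 y y') \<partial>PiM {..n} (\<lambda>_. N) \<partial>PiM {..<1} (\<lambda>_. N))"
    unfolding s(1,2) by (rule nn_integral_PiM_comb_seq[OF N]) (use F in \<open>simp only: s(1)\<close>)
  also have "\<dots> = (\<integral>\<^sup>+y. (\<lambda>y0. \<integral>\<^sup>+y'. F (case_nat y0 y') \<partial>PiM {..n} (\<lambda>_. N)) (y 0) \<partial>PiM {0::nat} (\<lambda>_. N))"
    unfolding s(3) by simp
  also have "\<dots> = (\<integral>\<^sup>+y0. \<integral>\<^sup>+y'. F (case_nat y0 y') \<partial>PiM {..n} (\<lambda>_. N) \<partial>N)"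
    by (rule product_nn_integral_singleton[OF m])
  finally show ?thesis .
qed

section \<open>The unnormalized filter and its dependence on start and data\<close>

declare lik_measure.simps [simp del]

context hmm
begin

text \<open>The forward recursion of filtering without normalization: correction by the observation,
  then prediction.\<close>

definition update :: "'x measure \<Rightarrow> 'y \<Rightarrow> 'x measure" where
  "update \<rho> a = density \<rho> (\<lambda>x. ennreal (G x a)) \<bind> K"

lemma lik_measure_update:
  "lik_measure K G \<rho> y 0 = update \<rho> (y 0)"
  "lik_measure K G \<rho> y (Suc t) = update (lik_measure K G \<rho> y t) (y (Suc t))"
  by (simp_all add: update_def lik_measure.simps)

lemma nn_integral_update:
  assumes \<rho>: "sets \<rho> = sets borel" and f [measurable]: "f \<in> borel_measurable borel"
  shows "(\<integral>\<^sup>+x. f x \<partial>update \<rho> a) = (\<integral>\<^sup>+x. ennreal (G x a) * (\<integral>\<^sup>+x'. f x' \<partial>K x) \<partial>\<rho>)"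
proof -
  have k: "K \<in> density \<rho> (\<lambda>x. ennreal (G x a)) \<rightarrow>\<^sub>M subprob_algebra borel"
    using measurable_prob_algebraD[OF kernel] by (simp add: measurable_cong_sets[OF \<rho> refl])
  have g: "(\<lambda>x. ennreal (G x a)) \<in> borel_measurable \<rho>" and i: "(\<lambda>x. \<integral>\<^sup>+x'. f x' \<partial>K x) \<in> borel_measurable \<rho>"
    unfolding measurable_cong_sets[OF \<rho> refl] by measurable
  show ?thesis
    unfolding update_def nn_integral_bind[OF f k] by (rule nn_integral_density[OF g i])
qed

lemma sets_update [simp]: "sets \<rho> = sets borel \<Longrightarrow> sets (update \<rho> a) = sets borel"
  unfolding update_def using sets_eq_imp_space_eq[of \<rho> borel] kernel_space
  by (intro sets_bind) (auto simp: space_prob_algebra)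

lemma sets_lik_measure [simp]: "sets \<rho> = sets borel \<Longrightarrow> sets (lik_measure K G \<rho> y t) = sets borel"
  by (induction t) (simp_all only: lik_measure_update sets_update)

lemma lik_eq: "sets \<rho> = sets borel \<Longrightarrow> lik K G \<rho> y t = (\<integral>\<^sup>+x. 1 \<partial>lik_measure K G \<rho> y t)"
  by (simp add: lik_def)

lemma lik_measure_cong: "(\<And>i. i \<le> t \<Longrightarrow> y i = y' i) \<Longrightarrow> lik_measure K G \<rho> y t = lik_measure K G \<rho> y' t"
  by (induction t) (auto simp: lik_measure_update)

lemma lik_cong: "(\<And>i. i \<le> t \<Longrightarrow> y i = y' i) \<Longrightarrow> lik K G \<rho> y t = lik K G \<rho> y' t"
  unfolding lik_def using lik_measure_cong[of t y y'] by simp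

text \<open>\<open>lik_measure\<close> at \<open>n\<close> is a measure on the hidden state at time
  \<open>n + 1\<close>, hence the shift by \<open>Suc n\<close>: the recursion is restarted from
  it.\<close>

lemma lik_measure_split:
  "lik_measure K G \<rho> y (n + Suc m) = lik_measure K G (lik_measure K G \<rho> y n) (seq_shift (Suc n) y) m"
proof (induction m)
  case 0
  have "n + Suc 0 = Suc n" by simp
  then show ?case by (simp only: lik_measure_update) (simp add: seq_shift_def)
next
  case (Suc m)
  have "n + Suc (Suc m) = Suc (n + Suc m)" by simp
  then have "lik_measure K G \<rho> y (n + Suc (Suc m)) = update (lik_measure K G \<rho> y (n + Suc m)) (y (Suc (n + Suc m)))"
    by (simp only: lik_measure_update)
  also have "\<dots> = lik_measure K G (lik_measure K G \<rho> y n) (seq_shift (Suc n) y) (Suc m)"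
    unfolding Suc by (simp only: lik_measure_update) (simp add: seq_shift_def add_ac)
  finally show ?case .
qed

lemma measurable_update_integral:
  assumes [measurable]: "(\<lambda>(z, x). F z x) \<in> borel_measurable (N \<Otimes>\<^sub>M borel)" "a \<in> N \<rightarrow>\<^sub>M borel"
  shows "(\<lambda>(z, x). ennreal (G x (a z)) * (\<integral>\<^sup>+x'. F z x' \<partial>K x)) \<in> borel_measurable (N \<Otimes>\<^sub>M borel)"
  by measurable

text \<open>The filter is linear in its starting measure. This reduces a \<sigma>-finite start to
  point masses, for which measurability is proved jointly in the data and the starting
  point.\<close>

lemma nn_integral_lik_measure_mixture:
  assumes \<rho>: "sets \<rho> = sets borel" and f: "f \<in> borel_measurable borel"
  shows "(\<integral>\<^sup>+x. f x \<partial>lik_measure K G \<rho> y t) = (\<integral>\<^sup>+x. \<integral>\<^sup>+x'. f x' \<partial>lik_measure K G (return borel x) y t \<partial>\<rho>)"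
  using f
proof (induction t arbitrary: f)
  case (0 f)
  note 0 [measurable]
  have m: "(\<lambda>x. ennreal (G x (y 0)) * (\<integral>\<^sup>+x'. f x' \<partial>K x)) \<in> borel_measurable borel" by measurable
  show ?case
    unfolding lik_measure_update nn_integral_update[OF \<rho> 0] nn_integral_update[OF sets_return 0]
    by (intro nn_integral_cong) (subst nn_integral_return[OF _ m], auto)
next
  case (Suc t f)
  note Suc.prems [measurable]
  have m: "(\<lambda>x. ennreal (G x (y (Suc t))) * (\<integral>\<^sup>+x'. f x' \<partial>K x)) \<in> borel_measurable borel" by measurable
  show ?case
    unfolding lik_measure_update nn_integral_update[OF sets_lik_measure[OF \<rho>] Suc.prems]
      nn_integral_update[OF sets_lik_measure[OF sets_return] Suc.prems]
    by (rule Suc.IH[OF m])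
qed

text \<open>The test function depends on \<open>z\<close> so that the induction can absorb the last
  observation into it.\<close>

lemma measurable_nn_integral_lik_measure_return:
  assumes "(\<lambda>(z, x). F z x) \<in> borel_measurable (N \<Otimes>\<^sub>M borel)"
    and "\<And>i. i \<le> t \<Longrightarrow> (\<lambda>z. Y z i) \<in> N \<rightarrow>\<^sub>M borel"
  shows "(\<lambda>(z, x). \<integral>\<^sup>+x'. F z x' \<partial>lik_measure K G (return borel x) (Y z) t) \<in> borel_measurable (N \<Otimes>\<^sub>M borel)"
  using assms
proof (induction t arbitrary: F)
  case (0 F)
  have Y: "(\<lambda>z. Y z 0) \<in> N \<rightarrow>\<^sub>M borel" by (rule 0) simp
  have e: "(\<integral>\<^sup>+x'. F z x' \<partial>lik_measure K G (return borel x) (Y z) 0) = ennreal (G x (Y z 0)) * (\<integral>\<^sup>+x'. F z x' \<partial>K x)"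
    if "z \<in> space N" for z x
  proof -
    have [measurable]: "F z \<in> borel_measurable borel" using measurable_Pair2[OF 0(1) that] by simp
    have m: "(\<lambda>x. ennreal (G x (Y z 0)) * (\<integral>\<^sup>+x'. F z x' \<partial>K x)) \<in> borel_measurable borel" by measurable
    show ?thesis
      unfolding lik_measure_update by (subst nn_integral_update) (auto simp: nn_integral_return[OF _ m])
  qed
  show ?case
    by (rule measurable_cong[THEN iffD1, OF _ measurable_update_integral[OF 0(1) Y]])
      (auto simp: e space_pair_measure)
next
  case (Suc t F)
  have Y: "(\<lambda>z. Y z (Suc t)) \<in> N \<rightarrow>\<^sub>M borel" by (rule Suc.prems) simp
  have e: "(\<integral>\<^sup>+x'. F z x' \<partial>lik_measure K G (return borel x) (Y z) (Suc t)) =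
    (\<integral>\<^sup>+x'. ennreal (G x' (Y z (Suc t))) * (\<integral>\<^sup>+x''. F z x'' \<partial>K x') \<partial>lik_measure K G (return borel x) (Y z) t)"
    if "z \<in> space N" for z x
  proof -
    have "F z \<in> borel_measurable borel" using measurable_Pair2[OF Suc.prems(1) that] by simp
    then show ?thesis unfolding lik_measure_update by (intro nn_integral_update sets_lik_measure sets_return)
  qed
  have "(\<lambda>(z, x). \<integral>\<^sup>+x'. ennreal (G x' (Y z (Suc t))) * (\<integral>\<^sup>+x''. F z x'' \<partial>K x') \<partial>lik_measure K G (return borel x) (Y z) t)
    \<in> borel_measurable (N \<Otimes>\<^sub>M borel)"
    by (rule Suc.IH[OF measurable_update_integral[OF Suc.prems(1) Y]]) (rule Suc.prems, simp)
  then show ?case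
    by (rule measurable_cong[THEN iffD1, rotated]) (auto simp: e space_pair_measure)
qed

lemma measurable_nn_integral_lik_measure:
  assumes \<rho>: "sets \<rho> = sets borel" "sigma_finite_measure \<rho>"
    and F: "(\<lambda>(z, x). F z x) \<in> borel_measurable (N \<Otimes>\<^sub>M borel)"
    and Y: "\<And>i. i \<le> t \<Longrightarrow> (\<lambda>z. Y z i) \<in> N \<rightarrow>\<^sub>M borel"
  shows "(\<lambda>z. \<integral>\<^sup>+x. F z x \<partial>lik_measure K G \<rho> (Y z) t) \<in> borel_measurable N"
proof -
  interpret \<rho>: sigma_finite_measure \<rho> by fact
  have s: "sets (N \<Otimes>\<^sub>M \<rho>) = sets (N \<Otimes>\<^sub>M borel)"
    by (rule sets_pair_measure_cong) (simp_all add: \<rho>)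
  have "(\<lambda>z. \<integral>\<^sup>+x. \<integral>\<^sup>+x'. F z x' \<partial>lik_measure K G (return borel x) (Y z) t \<partial>\<rho>) \<in> borel_measurable N"
    by (rule \<rho>.borel_measurable_nn_integral, unfold measurable_cong_sets[OF s refl])
      (rule measurable_nn_integral_lik_measure_return[OF F Y])
  then show ?thesis
    by (rule measurable_cong[THEN iffD1, rotated])
      (subst nn_integral_lik_measure_mixture[OF \<rho>(1)], use measurable_Pair2[OF F] in auto)
qed

lemma measurable_lik:
  assumes "sets \<rho> = sets borel" "sigma_finite_measure \<rho>"
    and "\<And>i. i \<le> t \<Longrightarrow> (\<lambda>z. Y z i) \<in> N \<rightarrow>\<^sub>M borel"
  shows "(\<lambda>z. lik K G \<rho> (Y z) t) \<in> borel_measurable N"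
  unfolding lik_eq[OF assms(1)]
  by (rule measurable_nn_integral_lik_measure) (use assms in auto)

lemma measurable_nn_integral_lik_measure_start:
  assumes [measurable]: "f \<in> borel_measurable borel"
  shows "(\<lambda>x. \<integral>\<^sup>+x'. f x' \<partial>lik_measure K G (return borel x) y t) \<in> borel_measurable borel"
proof -
  \<comment> \<open>A parameter of type \<open>unit\<close> turns the joint statement into one about
    the starting point alone.\<close>
  have "(\<lambda>(z, x). \<integral>\<^sup>+x'. f x' \<partial>lik_measure K G (return borel x) y t) \<in> borel_measurable (count_space (UNIV::unit set) \<Otimes>\<^sub>M borel)"
    by (rule measurable_nn_integral_lik_measure_return) auto
  from measurable_Pair2[OF this, of "()"] show ?thesis by simp
qed

lemma nn_integral_lik_measure_scale:
  assumes \<rho>: "sets \<rho> = sets borel" and f: "f \<in> borel_measurable borel"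
  shows "(\<integral>\<^sup>+x. f x \<partial>lik_measure K G (scale_measure c \<rho>) y t) = c * (\<integral>\<^sup>+x. f x \<partial>lik_measure K G \<rho> y t)"
proof -
  have "(\<lambda>x. \<integral>\<^sup>+x'. f x' \<partial>lik_measure K G (return borel x) y t) \<in> borel_measurable borel"
    by (rule measurable_nn_integral_lik_measure_start[OF f])
  then have m': "(\<lambda>x. \<integral>\<^sup>+x'. f x' \<partial>lik_measure K G (return borel x) y t) \<in> borel_measurable \<rho>"
    unfolding measurable_cong_sets[OF \<rho> refl] .
  have s: "sets (scale_measure c \<rho>) = sets borel" by (simp add: \<rho>)
  show ?thesis
    unfolding nn_integral_lik_measure_mixture[OF s f] nn_integral_lik_measure_mixture[OF \<rho> f]
    by (rule nn_integral_scale_measure[OF m'])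
qed

section \<open>The likelihood as density of the observations\<close>

lemma sets_PiM_\<mu>: "sets (PiM I (\<lambda>_. \<mu>)) = sets (PiM I (\<lambda>_. borel))"
  by (rule sets_PiM_cong) simp_all

lemma measurable_restrict_obs [measurable]:
  "(\<lambda>\<omega>. restrict (obs \<omega>) I) \<in> paths \<rightarrow>\<^sub>M PiM I (\<lambda>_. borel)"
  by (rule measurable_compose[OF measurable_obs measurable_restrict_subset]) simp

text \<open>The law splits at the first step, and so does the likelihood once it is rewritten from
  the front. Tonelli then moves the integral over the hidden state inside those over the
  observations twice: past the first one, then past the remaining ones.\<close>

theorem nn_integral_obs_prefix:
  assumes "\<nu> \<in> space (prob_algebra borel)" "F \<in> borel_measurable (PiM {..n} (\<lambda>_. borel))"
  shows "(\<integral>\<^sup>+\<omega>. F (restrict (obs \<omega>) {..n}) \<partial>law \<nu>) = (\<integral>\<^sup>+y. F y * lik K G \<nu> y n \<partial>PiM {..n} (\<lambda>_. \<mu>))"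
  using assms
proof (induction n arbitrary: \<nu> F)
  case (0 \<nu> F)
  note F [measurable] = 0(2) and \<nu> [simp] = 0(1)
  interpret product_sigma_finite "\<lambda>_::nat. \<mu>" by standard
  have s: "sets \<nu> = sets borel" using \<nu> by (simp add: space_prob_algebra)
  interpret \<nu>: prob_space \<nu> using \<nu> by (simp add: space_prob_algebra)
  interpret pair_sigma_finite \<mu> \<nu> ..
  have at0: "{..0} = {0::nat}" by auto
  define u where "u a = (\<lambda>i\<in>{0::nat}. a :: 'y)" for a
  have u [measurable]: "u \<in> borel \<rightarrow>\<^sub>M PiM {..0} (\<lambda>_. borel)"
    unfolding u_def[abs_def] at0 by (rule measurable_restrict) simp
  have r: "restrict (obs (case_nat (x, a) \<omega>)) {..0} = u a" for x :: 'x and a \<omega>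
    by (auto simp: u_def obs_def fun_eq_iff)
  have Kp: "(\<integral>\<^sup>+\<omega>. c \<partial>law (K x)) = c" for c x
    using prob_space.emeasure_space_1[OF prob_space_law[OF kernel_space, of x]] by simp
  have lk: "lik K G \<nu> (u a) 0 = (\<integral>\<^sup>+x. ennreal (G x a) \<partial>\<nu>)" for a
  proof -
    have "(\<integral>\<^sup>+x'. 1 \<partial>K x) = 1" for x
      using prob_space.emeasure_space_1[of "K x"] kernel_space[of x] by (simp add: space_prob_algebra)
    then show ?thesis
      unfolding lik_eq[OF s] lik_measure_update by (subst nn_integral_update[OF s]) (auto simp: u_def)
  qed
  have "(\<integral>\<^sup>+\<omega>. F (restrict (obs \<omega>) {..0}) \<partial>law \<nu>) = (\<integral>\<^sup>+x. \<integral>\<^sup>+a. ennreal (G x a) * F (u a) \<partial>\<mu> \<partial>\<nu>)"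
    by (subst nn_integral_law_first_step[OF \<nu> measurable_compose[OF measurable_restrict_obs F]]) (simp only: r Kp)
  also have "\<dots> = (\<integral>\<^sup>+a. \<integral>\<^sup>+x. ennreal (G x a) * F (u a) \<partial>\<nu> \<partial>\<mu>)"
  proof (rule Fubini')
    have s2: "sets (\<mu> \<Otimes>\<^sub>M \<nu>) = sets (borel \<Otimes>\<^sub>M borel)" by (rule sets_pair_measure_cong) (simp_all add: s)
    show "(\<lambda>(a, x). ennreal (G x a) * F (u a)) \<in> borel_measurable (\<mu> \<Otimes>\<^sub>M \<nu>)"
      unfolding measurable_cong_sets[OF s2 refl] by measurable
  qed
  also have "\<dots> = (\<integral>\<^sup>+a. F (u a) * lik K G \<nu> (u a) 0 \<partial>\<mu>)"
  proof (rule nn_integral_cong)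
    fix a
    have "(\<lambda>x. ennreal (G x a)) \<in> borel_measurable \<nu>" unfolding measurable_cong_sets[OF s refl] by measurable
    then show "(\<integral>\<^sup>+x. ennreal (G x a) * F (u a) \<partial>\<nu>) = F (u a) * lik K G \<nu> (u a) 0"
      unfolding lk by (subst nn_integral_multc) (auto simp: mult.commute)
  qed
  also have "\<dots> = (\<integral>\<^sup>+y. (\<lambda>a. F (u a) * lik K G \<nu> (u a) 0) (y 0) \<partial>PiM {0::nat} (\<lambda>_. \<mu>))"
  proof (rule product_nn_integral_singleton[symmetric])
    have "(\<lambda>a. lik K G \<nu> (u a) 0) \<in> borel_measurable borel"
      by (rule measurable_lik[OF s]) (auto simp: u_def \<nu>.sigma_finite_measure_axioms)
    then show "(\<lambda>a. F (u a) * lik K G \<nu> (u a) 0) \<in> borel_measurable \<mu>" by measurable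
  qed
  also have "\<dots> = (\<integral>\<^sup>+y. F y * lik K G \<nu> y 0 \<partial>PiM {..0} (\<lambda>_. \<mu>))"
    unfolding at0
  proof (rule nn_integral_cong)
    fix y assume "y \<in> space (PiM {0::nat} (\<lambda>_. \<mu>))"
    then have "u (y 0) = y" by (auto simp: u_def fun_eq_iff space_PiM PiE_iff extensional_def)
    then show "F (u (y 0)) * lik K G \<nu> (u (y 0)) 0 = F y * lik K G \<nu> y 0" by simp
  qed
  finally show ?case .
next
  case (Suc n \<nu> F)
  note F [measurable] = Suc.prems(2) and \<nu> [simp] = Suc.prems(1)
  interpret product_sigma_finite "\<lambda>_::nat. \<mu>" by standard
  have s: "sets \<nu> = sets borel" using \<nu> by (simp add: space_prob_algebra)
  interpret \<nu>: prob_space \<nu> using \<nu> by (simp add: space_prob_algebra)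
  interpret PN: sigma_finite_measure "PiM {..n} (\<lambda>_. \<mu>)" by (rule sigma_finite) simp
  interpret A: pair_sigma_finite \<mu> \<nu> ..
  interpret B: pair_sigma_finite "PiM {..n} (\<lambda>_. \<mu>)" \<nu> ..
  let ?PB = "PiM {..n} (\<lambda>_. borel) :: (nat \<Rightarrow> 'y) measure"
  have c [measurable]: "(\<lambda>(a, y'). case_nat a y') \<in> borel \<Otimes>\<^sub>M ?PB \<rightarrow>\<^sub>M PiM {..Suc n} (\<lambda>_. borel)"
  proof (rule measurable_PiM_single')
    fix i assume i: "i \<in> {..Suc n}"
    then show "(\<lambda>p. (case p of (a, y') \<Rightarrow> case_nat a y') i) \<in> borel \<Otimes>\<^sub>M ?PB \<rightarrow>\<^sub>M borel"
      by (cases i) (auto simp: split_beta)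
  qed (auto simp: space_pair_measure space_PiM PiE_iff extensional_def split: nat.splits)
  have r: "restrict (obs (case_nat (x, a) \<omega>)) {..Suc n} = case_nat a (restrict (obs \<omega>) {..n})" for x :: 'x and a \<omega>
    by (auto simp: obs_def fun_eq_iff split: nat.split)
  have Fa [measurable]: "(\<lambda>y'. F (case_nat a y')) \<in> borel_measurable ?PB" for a
    by measurable
  have sK: "sets (K x) = sets borel" for x using kernel_space[of x] by (simp add: space_prob_algebra)
  have lK: "lik K G (K x) y' n = (\<integral>\<^sup>+x'. \<integral>\<^sup>+x''. 1 \<partial>lik_measure K G (return borel x') y' n \<partial>K x)" for x y'
    unfolding lik_eq[OF sK] by (rule nn_integral_lik_measure_mixture[OF sK]) simp
  have mlr: "(\<lambda>(y', x'). \<integral>\<^sup>+x''. 1 \<partial>lik_measure K G (return borel x') y' n) \<in> borel_measurable (?PB \<Otimes>\<^sub>M borel)"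
    by (rule measurable_nn_integral_lik_measure_return) auto
  have mlK [measurable]: "(\<lambda>(y', x). lik K G (K x) y' n) \<in> borel_measurable (?PB \<Otimes>\<^sub>M borel)"
    unfolding lK using mlr by measurable
  \<comment> \<open>The recursion of \<open>lik_measure\<close> appends observations at the end;
    restarting it after the first one gives the form that matches the first step of the law.\<close>
  have lc: "lik K G \<nu> (case_nat a y') (Suc n) = (\<integral>\<^sup>+x. ennreal (G x a) * lik K G (K x) y' n \<partial>\<nu>)" for a y'
  proof -
    have "lik K G \<nu> (case_nat a y') (Suc n) = (\<integral>\<^sup>+x. 1 \<partial>lik_measure K G (update \<nu> a) y' n)"
      unfolding lik_eq[OF s] using lik_measure_split[of \<nu> "case_nat a y'" 0 n]
      by (simp only: add_0 lik_measure_update seq_shift_case_nat) simp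
    also have "\<dots> = (\<integral>\<^sup>+x'. \<integral>\<^sup>+x''. 1 \<partial>lik_measure K G (return borel x') y' n \<partial>update \<nu> a)"
      by (rule nn_integral_lik_measure_mixture) (simp_all add: s)
    also have "\<dots> = (\<integral>\<^sup>+x. ennreal (G x a) * lik K G (K x) y' n \<partial>\<nu>)"
      unfolding lK
    proof (rule nn_integral_update[OF s])
      show "(\<lambda>x'. \<integral>\<^sup>+x''. 1 \<partial>lik_measure K G (return borel x') y' n) \<in> borel_measurable borel"
        by (rule measurable_nn_integral_lik_measure_start) simp
    qed
    finally show ?thesis .
  qed
  have sPB: "sets (PiM {..n} (\<lambda>_. \<mu>)) = sets ?PB" by (rule sets_PiM_\<mu>)
  have "(\<integral>\<^sup>+\<omega>. F (restrict (obs \<omega>) {..Suc n}) \<partial>law \<nu>) =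
    (\<integral>\<^sup>+x. \<integral>\<^sup>+a. ennreal (G x a) * (\<integral>\<^sup>+\<omega>. F (case_nat a (restrict (obs \<omega>) {..n})) \<partial>law (K x)) \<partial>\<mu> \<partial>\<nu>)"
    by (subst nn_integral_law_first_step[OF \<nu> measurable_compose[OF measurable_restrict_obs F]]) (simp only: r)
  also have "\<dots> = (\<integral>\<^sup>+x. \<integral>\<^sup>+a. ennreal (G x a) * (\<integral>\<^sup>+y'. F (case_nat a y') * lik K G (K x) y' n \<partial>PiM {..n} (\<lambda>_. \<mu>)) \<partial>\<mu> \<partial>\<nu>)"
    by (simp only: Suc.IH[OF kernel_space Fa])
  also have "\<dots> = (\<integral>\<^sup>+a. \<integral>\<^sup>+x. ennreal (G x a) * (\<integral>\<^sup>+y'. F (case_nat a y') * lik K G (K x) y' n \<partial>PiM {..n} (\<lambda>_. \<mu>)) \<partial>\<nu> \<partial>\<mu>)"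
  proof (rule A.Fubini')
    have s2: "sets (\<mu> \<Otimes>\<^sub>M \<nu>) = sets (borel \<Otimes>\<^sub>M borel)" by (rule sets_pair_measure_cong) (simp_all add: s)
    have s3: "sets ((borel \<Otimes>\<^sub>M borel) \<Otimes>\<^sub>M PiM {..n} (\<lambda>_. \<mu>)) = sets ((borel \<Otimes>\<^sub>M borel) \<Otimes>\<^sub>M ?PB)"
      by (rule sets_pair_measure_cong) (simp_all add: sPB)
    have "(\<lambda>p. (snd p, snd (fst p))) \<in> (borel \<Otimes>\<^sub>M borel) \<Otimes>\<^sub>M ?PB \<rightarrow>\<^sub>M ?PB \<Otimes>\<^sub>M borel" by measurable
    from measurable_compose[OF this mlK]
    have [measurable]: "(\<lambda>p. lik K G (K (snd (fst p))) (snd p) n) \<in> borel_measurable ((borel \<Otimes>\<^sub>M borel) \<Otimes>\<^sub>M ?PB)"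
      by simp
    have "(\<lambda>p. (fst (fst p), snd p)) \<in> (borel \<Otimes>\<^sub>M borel) \<Otimes>\<^sub>M ?PB \<rightarrow>\<^sub>M borel \<Otimes>\<^sub>M ?PB" by measurable
    from measurable_compose[OF measurable_compose[OF this c] F]
    have [measurable]: "(\<lambda>p. F (case_nat (fst (fst p)) (snd p))) \<in> borel_measurable ((borel \<Otimes>\<^sub>M borel) \<Otimes>\<^sub>M ?PB)"
      by simp
    have m1: "(\<lambda>p. F (case_nat (fst (fst p)) (snd p)) * lik K G (K (snd (fst p))) (snd p) n)
      \<in> borel_measurable ((borel \<Otimes>\<^sub>M borel) \<Otimes>\<^sub>M PiM {..n} (\<lambda>_. \<mu>))"
      unfolding measurable_cong_sets[OF s3 refl] by measurable
    have [measurable]: "(\<lambda>(a, x). \<integral>\<^sup>+y'. F (case_nat a y') * lik K G (K x) y' n \<partial>PiM {..n} (\<lambda>_. \<mu>)) \<in> borel_measurable (borel \<Otimes>\<^sub>M borel)"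
      using PN.borel_measurable_nn_integral[of "\<lambda>p y'. F (case_nat (fst p) y') * lik K G (K (snd p)) y' n" "borel \<Otimes>\<^sub>M borel"] m1
      by (simp add: split_beta)
    show "(\<lambda>(a, x). ennreal (G x a) * (\<integral>\<^sup>+y'. F (case_nat a y') * lik K G (K x) y' n \<partial>PiM {..n} (\<lambda>_. \<mu>))) \<in> borel_measurable (\<mu> \<Otimes>\<^sub>M \<nu>)"
      unfolding measurable_cong_sets[OF s2 refl] by measurable
  qed
  also have "\<dots> = (\<integral>\<^sup>+a. \<integral>\<^sup>+y'. F (case_nat a y') * lik K G \<nu> (case_nat a y') (Suc n) \<partial>PiM {..n} (\<lambda>_. \<mu>) \<partial>\<mu>)"
  proof (rule nn_integral_cong)
    fix a
    have s2: "sets (PiM {..n} (\<lambda>_. \<mu>) \<Otimes>\<^sub>M \<nu>) = sets (?PB \<Otimes>\<^sub>M borel)" by (rule sets_pair_measure_cong) (simp_all add: s sPB)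
    have "(\<integral>\<^sup>+x. ennreal (G x a) * (\<integral>\<^sup>+y'. F (case_nat a y') * lik K G (K x) y' n \<partial>PiM {..n} (\<lambda>_. \<mu>)) \<partial>\<nu>)
      = (\<integral>\<^sup>+x. \<integral>\<^sup>+y'. ennreal (G x a) * (F (case_nat a y') * lik K G (K x) y' n) \<partial>PiM {..n} (\<lambda>_. \<mu>) \<partial>\<nu>)"
    proof (intro nn_integral_cong nn_integral_cmult[symmetric])
      fix x
      have "(\<lambda>y'. F (case_nat a y') * lik K G (K x) y' n) \<in> borel_measurable ?PB" by measurable
      then show "(\<lambda>y'. F (case_nat a y') * lik K G (K x) y' n) \<in> borel_measurable (PiM {..n} (\<lambda>_. \<mu>))"
        unfolding measurable_cong_sets[OF sPB refl] .
    qed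
    also have "\<dots> = (\<integral>\<^sup>+y'. \<integral>\<^sup>+x. ennreal (G x a) * (F (case_nat a y') * lik K G (K x) y' n) \<partial>\<nu> \<partial>PiM {..n} (\<lambda>_. \<mu>))"
    proof (rule B.Fubini')
      show "(\<lambda>(y', x). ennreal (G x a) * (F (case_nat a y') * lik K G (K x) y' n)) \<in> borel_measurable (PiM {..n} (\<lambda>_. \<mu>) \<Otimes>\<^sub>M \<nu>)"
        unfolding measurable_cong_sets[OF s2 refl] by measurable
    qed
    also have "\<dots> = (\<integral>\<^sup>+y'. F (case_nat a y') * lik K G \<nu> (case_nat a y') (Suc n) \<partial>PiM {..n} (\<lambda>_. \<mu>))"
    proof (rule nn_integral_cong)
      fix y' assume "y' \<in> space (PiM {..n} (\<lambda>_. \<mu>))"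
      then have y': "y' \<in> space ?PB" by (simp add: sets_eq_imp_space_eq[OF sPB])
      have "(\<lambda>x. lik K G (K x) y' n) \<in> borel_measurable borel"
        using measurable_Pair2[OF mlK y'] by simp
      then have m: "(\<lambda>x. ennreal (G x a) * lik K G (K x) y' n) \<in> borel_measurable \<nu>"
        unfolding measurable_cong_sets[OF s refl] by measurable
      show "(\<integral>\<^sup>+x. ennreal (G x a) * (F (case_nat a y') * lik K G (K x) y' n) \<partial>\<nu>) = F (case_nat a y') * lik K G \<nu> (case_nat a y') (Suc n)"
        unfolding lc by (subst nn_integral_cmult[OF m, symmetric]) (simp add: mult_ac)
    qed
    finally show "(\<integral>\<^sup>+x. ennreal (G x a) * (\<integral>\<^sup>+y'. F (case_nat a y') * lik K G (K x) y' n \<partial>PiM {..n} (\<lambda>_. \<mu>)) \<partial>\<nu>)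
      = (\<integral>\<^sup>+y'. F (case_nat a y') * lik K G \<nu> (case_nat a y') (Suc n) \<partial>PiM {..n} (\<lambda>_. \<mu>))" .
  qed
  also have "\<dots> = (\<integral>\<^sup>+y. F y * lik K G \<nu> y (Suc n) \<partial>PiM {..Suc n} (\<lambda>_. \<mu>))"
  proof (rule nn_integral_PiM_case_nat[OF sigma_finite_\<mu>, symmetric])
    have [measurable]: "(\<lambda>y. lik K G \<nu> y (Suc n)) \<in> borel_measurable (PiM {..Suc n} (\<lambda>_. borel))"
      by (rule measurable_lik[OF s]) (auto simp: \<nu>.sigma_finite_measure_axioms)
    show "(\<lambda>y. F y * lik K G \<nu> y (Suc n)) \<in> borel_measurable (PiM {..Suc n} (\<lambda>_. \<mu>))"
      unfolding measurable_cong_sets[OF sets_PiM_\<mu> refl] by measurable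
  qed
  finally show ?case .
qed

end

section \<open>The normalized law\<close>

text \<open>Outside \<open>I\<close> the points are constantly \<open>undefined\<close>, so reading
  a prefix as an infinite sequence is measurable. This transfers sets and functions of sequences to
  prefixes.\<close>

lemma measurable_extend_PiM: "(\<lambda>y. y) \<in> PiM I (\<lambda>_. borel) \<rightarrow>\<^sub>M PiM UNIV (\<lambda>_. borel)"
proof (rule measurable_PiM_single')
  fix i
  show "(\<lambda>y. y i) \<in> PiM I (\<lambda>_. borel) \<rightarrow>\<^sub>M borel"
  proof (cases "i \<in> I")
    case False
    then have "\<And>y. y \<in> space (PiM I (\<lambda>_. borel)) \<Longrightarrow> y i = undefined"
      by (auto simp: space_PiM PiE_iff extensional_def)
    then show ?thesis by (subst measurable_cong[where g="\<lambda>_. undefined"]) auto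
  qed simp
qed auto

text \<open>A cylinder depends on finitely many coordinates, hence on a prefix as long as desired,
  so the prefixes from length index \<open>r\<close> on are enough.\<close>

lemma prefix_determines_law:
  fixes P P' :: "(nat \<Rightarrow> 'y::topological_space) measure"
  assumes P: "prob_space P" "sets P = sets (PiM UNIV (\<lambda>_. borel))"
    and P': "prob_space P'" "sets P' = sets (PiM UNIV (\<lambda>_. borel))"
    and eq: "\<And>n A. r \<le> n \<Longrightarrow> A \<in> sets (PiM {..n} (\<lambda>_. borel)) \<Longrightarrow>
      emeasure P {y. restrict y {..n} \<in> A} = emeasure P' {y. restrict y {..n} \<in> A}"
  shows "P = P'"
proof (rule measure_eqI_PiM_infinite[OF P(2) P'(2)])
  show "finite_measure P" using P(1) by (simp add: prob_space_def)
  fix E :: "nat \<Rightarrow> 'y set" and J :: "nat set" assume J: "finite J" and E: "\<And>i. i \<in> J \<Longrightarrow> E i \<in> sets borel"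
  obtain n0 where "J \<subseteq> {..n0}" using J by (auto simp: finite_nat_iff_bounded_le)
  then have n: "J \<subseteq> {..max n0 r}" "r \<le> max n0 r" by auto
  have X: "PiE J E \<in> sets (PiM J (\<lambda>_. borel))" using J E by (intro sets_PiM_I_finite) auto
  let ?A = "prod_emb {..max n0 r} (\<lambda>_. borel) J (PiE J E)"
  have "?A \<in> sets (PiM {..max n0 r} (\<lambda>_. borel))" by (rule measurable_prod_emb[OF n(1) X])
  from eq[OF n(2) this]
  have "emeasure P {y. restrict y {..max n0 r} \<in> ?A} = emeasure P' {y. restrict y {..max n0 r} \<in> ?A}" .
  moreover have "{y. restrict y {..max n0 r} \<in> ?A} = prod_emb UNIV (\<lambda>_. borel) J (PiE J E)"
  proof -
    have "restrict (restrict y {..max n0 r}) J = restrict y J" for y :: "nat \<Rightarrow> 'y"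
      using n(1) by (auto simp: fun_eq_iff restrict_def)
    then show ?thesis by (auto simp: prod_emb_iff)
  qed
  ultimately show "emeasure P (prod_emb UNIV (\<lambda>_. borel) J (PiE J E)) = emeasure P' (prod_emb UNIV (\<lambda>_. borel) J (PiE J E))"
    by simp
qed

text \<open>\<open>Ps\<close> stands for the law of the observations at the true parameter and
  \<open>Ds\<close> for the density of its first \<open>r + 1\<close> coordinates; the true model
  enters in no other way.\<close>

locale normalized_hmm = hmm K \<mu> G
  for K :: "'x::polish_space \<Rightarrow> 'x measure" and \<mu> :: "'y::polish_space measure" and G +
  fixes lam :: "'x measure" and r :: nat and Ps :: "(nat \<Rightarrow> 'y) measure" and Ds :: "(nat \<Rightarrow> 'y) \<Rightarrow> ennreal"
  assumes lam: "sets lam = sets borel" "sigma_finite_measure lam"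
    and Ps: "Ps \<in> space (prob_algebra (PiM UNIV (\<lambda>_. borel)))"
    and Ds [measurable]: "Ds \<in> borel_measurable (PiM {..r} (\<lambda>_. borel))"
    and Ds_cong: "\<And>y y'. (\<And>i. i \<le> r \<Longrightarrow> y i = y' i) \<Longrightarrow> Ds y = Ds y'"
    and Ps_density: "\<And>F. F \<in> borel_measurable (PiM {..r} (\<lambda>_. borel)) \<Longrightarrow>
      (\<integral>\<^sup>+y. F (restrict y {..r}) \<partial>Ps) = (\<integral>\<^sup>+y. F y * Ds y \<partial>PiM {..r} (\<lambda>_. \<mu>))"
    and lik_pos: "AE y in Ps. 0 < lik K G lam y r" and lik_finite: "AE y in Ps. lik K G lam y r < \<infinity>"
begin

abbreviation L where "L \<equiv> lik K G lam"

lemma sets_Ps [simp, measurable_cong]: "sets Ps = sets obs_space"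
  using Ps by (simp add: space_prob_algebra)

sublocale Ps: prob_space Ps
  using Ps by (simp add: space_prob_algebra)

lemma measurable_L [measurable]: "(\<lambda>y. L y n) \<in> borel_measurable obs_space"
  by (rule measurable_lik[OF lam]) simp

lemma measurable_L_prefix: "m \<le> n \<Longrightarrow> (\<lambda>y. L y m) \<in> borel_measurable (PiM {..n} (\<lambda>_. borel))"
  by (rule measurable_compose[OF measurable_extend_PiM measurable_L])

lemma L_restrict [simp]: "r \<le> n \<Longrightarrow> L (restrict y {..n}) r = L y r"
  by (rule lik_cong) simp

text \<open>The filter: the conditional law of the hidden state at time \<open>r + 1\<close> given
  the observations up to \<open>r\<close>. Where the likelihood cannot be divided by, an arbitrary
  point mass keeps it a probability measure, hence a kernel in \<open>y\<close>.\<close>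

definition posterior :: "(nat \<Rightarrow> 'y) \<Rightarrow> 'x measure" where
  "posterior y = (if 0 < L y r \<and> L y r < \<infinity>
     then scale_measure (inverse (L y r)) (lik_measure K G lam y r) else return borel undefined)"

lemma sets_posterior [simp]: "sets (posterior y) = sets borel"
  by (simp add: posterior_def lam)

lemma prob_space_posterior: "prob_space (posterior y)"
proof (cases "0 < L y r \<and> L y r < \<infinity>")
  case True
  show ?thesis
  proof (rule prob_spaceI)
    have "emeasure (posterior y) (space (posterior y)) = inverse (L y r) * L y r"
      using True by (simp add: posterior_def lik_def space_scale_measure)
    also have "\<dots> = L y r / L y r" by (simp add: divide_ennreal_def mult.commute)
    also have "\<dots> = 1" using True by (intro ennreal_divide_self) auto
    finally show "emeasure (posterior y) (space (posterior y)) = 1" .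
  qed
next
  case False
  then have "posterior y = return borel undefined" unfolding posterior_def by (rule if_not_P)
  then show ?thesis by (simp add: prob_space_return)
qed

lemma posterior_space [simp]: "posterior y \<in> space (prob_algebra borel)"
  by (simp add: space_prob_algebra prob_space_posterior)

lemma posterior_cong: "(\<And>i. i \<le> r \<Longrightarrow> y i = y' i) \<Longrightarrow> posterior y = posterior y'"
  unfolding posterior_def using lik_cong[of r y y' lam] lik_measure_cong[of r y y' lam] by simp

lemma nn_integral_posterior:
  assumes "0 < L y r" "L y r < \<infinity>" and [measurable]: "f \<in> borel_measurable borel"
  shows "(\<integral>\<^sup>+x. f x \<partial>posterior y) = inverse (L y r) * (\<integral>\<^sup>+x. f x \<partial>lik_measure K G lam y r)"
proof -
  have "f \<in> borel_measurable (lik_measure K G lam y r)"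
    by (simp add: measurable_cong_sets[OF sets_lik_measure[OF lam(1)] refl])
  then show ?thesis using assms by (simp add: posterior_def nn_integral_scale_measure)
qed

lemma measurable_nn_integral_lik [measurable]:
  "f \<in> borel_measurable borel \<Longrightarrow> (\<lambda>y. \<integral>\<^sup>+x. f x \<partial>lik_measure K G lam y n) \<in> borel_measurable obs_space"
  by (rule measurable_nn_integral_lik_measure[OF lam]) auto

lemma measurable_posterior [measurable]: "posterior \<in> obs_space \<rightarrow>\<^sub>M prob_algebra borel"
proof (rule measurable_prob_algebraI[OF prob_space_posterior], rule measurable_subprob_algebra)
  fix A :: "'x set" assume A [measurable]: "A \<in> sets borel"
  have "(\<lambda>y. if 0 < L y r \<and> L y r < \<infinity> then inverse (L y r) * (\<integral>\<^sup>+x. indicator A x \<partial>lik_measure K G lam y r)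
      else indicator A undefined) \<in> borel_measurable obs_space"
    by measurable
  then show "(\<lambda>y. emeasure (posterior y) A) \<in> borel_measurable obs_space"
    by (rule measurable_cong[THEN iffD1, rotated]) (simp add: posterior_def lam)
qed (auto simp: prob_space_posterior prob_space_imp_subprob_space)

text \<open>The prefix up to time \<open>r\<close> is kept and the rest is drawn from the model
  started at the filter. Mixed over \<open>Ps\<close>, this gives a law on sequences that is then
  recognized as the normalized one.\<close>

definition continuation :: "(nat \<Rightarrow> 'y) \<Rightarrow> (nat \<Rightarrow> 'y) measure" where
  "continuation y = distr (law (posterior y)) obs_space (\<lambda>\<omega>. comb_seq (Suc r) y (obs \<omega>))"

definition norm_law :: "(nat \<Rightarrow> 'y) measure" where
  "norm_law = Ps \<bind> continuation"

lemma measurable_continuation [measurable]: "continuation \<in> obs_space \<rightarrow>\<^sub>M prob_algebra obs_space"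
  unfolding continuation_def[abs_def] by measurable

lemma prob_space_norm_law: "prob_space norm_law" and sets_norm_law [simp]: "sets norm_law = sets obs_space"
  unfolding norm_law_def
  by (rule prob_space_bind'[OF Ps measurable_continuation], rule sets_bind'[OF Ps measurable_continuation])

lemma space_norm_law [simp]: "space norm_law = UNIV"
  using sets_eq_imp_space_eq[OF sets_norm_law] by (simp add: space_PiM)

lemma nn_integral_norm_law:
  assumes F [measurable]: "F \<in> borel_measurable obs_space"
  shows "(\<integral>\<^sup>+y. F y \<partial>norm_law) = (\<integral>\<^sup>+y. \<integral>\<^sup>+\<omega>. F (comb_seq (Suc r) y (obs \<omega>)) \<partial>law (posterior y) \<partial>Ps)"
  unfolding norm_law_def kernel_nn_integral[OF measurable_continuation F Ps]
proof (rule nn_integral_cong)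
  fix y assume y: "y \<in> space Ps"
  have y': "y \<in> space obs_space" by (simp add: space_PiM)
  have "(\<lambda>\<omega>. comb_seq (Suc r) y (obs \<omega>)) \<in> law (posterior y) \<rightarrow>\<^sub>M obs_space"
    using y' by measurable
  then show "(\<integral>\<^sup>+y. F y \<partial>continuation y) = (\<integral>\<^sup>+\<omega>. F (comb_seq (Suc r) y (obs \<omega>)) \<partial>law (posterior y))"
    unfolding continuation_def by (rule nn_integral_distr) (simp add: F)
qed

text \<open>The conditions on the likelihood hold almost surely under \<open>Ps\<close>, that is,
  almost everywhere where \<open>Ds\<close> is positive; only there may \<open>L y r / L y r\<close>
  be cancelled.\<close>

lemma AE_Ds: "AE y in PiM {..r} (\<lambda>_. \<mu>). Ds y = 0 \<or> (0 < L y r \<and> L y r < \<infinity>)"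
proof -
  note [measurable] = measurable_L_prefix[OF order_refl]
  define F where "F y = (if 0 < L y r \<and> L y r < \<infinity> then 0 else 1 :: ennreal)" for y
  have F [measurable]: "F \<in> borel_measurable (PiM {..r} (\<lambda>_. borel))"
    unfolding F_def[abs_def] by measurable
  have "(\<integral>\<^sup>+y. F y * Ds y \<partial>PiM {..r} (\<lambda>_. \<mu>)) = (\<integral>\<^sup>+y. F (restrict y {..r}) \<partial>Ps)"
    by (rule Ps_density[OF F, symmetric])
  also have "\<dots> = (\<integral>\<^sup>+y. 0 \<partial>Ps)"
    using lik_pos lik_finite by (intro nn_integral_cong_AE, eventually_elim) (simp add: F_def)
  finally have "(\<integral>\<^sup>+y. F y * Ds y \<partial>PiM {..r} (\<lambda>_. \<mu>)) = 0" by simp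
  moreover have "(\<lambda>y. F y * Ds y) \<in> borel_measurable (PiM {..r} (\<lambda>_. \<mu>))"
    unfolding measurable_cong_sets[OF sets_PiM_\<mu> refl] by measurable
  ultimately have "AE y in PiM {..r} (\<lambda>_. \<mu>). F y * Ds y = 0"
    by (simp add: nn_integral_0_iff_AE)
  then show ?thesis by eventually_elim (auto simp: F_def split: if_splits)
qed

text \<open>Given the prefix, the continuation has as density the likelihood started at the filter,
  and restarting the recursion shows that this is \<open>L y n / L y r\<close>. Multiplied by the
  density \<open>Ds\<close> of the prefix, it is the integrand that defines the normalized
  law.\<close>

lemma norm_law_prefix:
  assumes n: "r \<le> n" and A [measurable]: "A \<in> sets (PiM {..n} (\<lambda>_. borel))"
  shows "emeasure norm_law {y. restrict y {..n} \<in> A} =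
    (\<integral>\<^sup>+y. indicator A y * (L y n / L y r * Ds y) \<partial>PiM {..n} (\<lambda>_. \<mu>))"
proof -
  have res [measurable]: "(\<lambda>y. restrict y {..n}) \<in> obs_space \<rightarrow>\<^sub>M PiM {..n} (\<lambda>_. borel)"
    by (rule measurable_restrict_subset) simp
  have ind: "(\<lambda>y. indicator A (restrict y {..n}) :: ennreal) \<in> borel_measurable obs_space" by measurable
  have "{y \<in> space obs_space. restrict y {..n} \<in> A} \<in> sets obs_space" by measurable
  then have "emeasure norm_law {y. restrict y {..n} \<in> A} = (\<integral>\<^sup>+y. indicator {y. restrict y {..n} \<in> A} y \<partial>norm_law)"
    by (intro nn_integral_indicator[symmetric]) (simp add: space_PiM)
  also have "\<dots> = (\<integral>\<^sup>+y. indicator A (restrict y {..n}) \<partial>norm_law)"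
    by (intro nn_integral_cong) (simp add: indicator_def)
  also have "\<dots> = (\<integral>\<^sup>+y. \<integral>\<^sup>+\<omega>. indicator A (restrict (comb_seq (Suc r) y (obs \<omega>)) {..n}) \<partial>law (posterior y) \<partial>Ps)"
    by (rule nn_integral_norm_law[OF ind])
  also have "\<dots> = (\<integral>\<^sup>+y. indicator A y * (L y n / L y r * Ds y) \<partial>PiM {..n} (\<lambda>_. \<mu>))"
  proof (cases "n = r")
    \<comment> \<open>No continuation is left; the quotient \<open>L y r / L y r\<close> is either
      \<open>1\<close> or multiplied by \<open>0\<close>.\<close>
    case True
    have e: "restrict (comb_seq (Suc r) y y') {..n} = restrict y {..r}" for y y' :: "nat \<Rightarrow> 'y"
      by (auto simp: True fun_eq_iff comb_seq_def)
    have "(\<integral>\<^sup>+y. \<integral>\<^sup>+\<omega>. indicator A (restrict (comb_seq (Suc r) y (obs \<omega>)) {..n}) \<partial>law (posterior y) \<partial>Ps) =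
      (\<integral>\<^sup>+y. indicator A (restrict y {..r}) \<partial>Ps)"
      unfolding e using prob_space.emeasure_space_1[OF prob_space_law[OF posterior_space]] by simp
    also have "\<dots> = (\<integral>\<^sup>+y. indicator A y * Ds y \<partial>PiM {..r} (\<lambda>_. \<mu>))"
      by (rule Ps_density) (use A in \<open>simp add: True\<close>)
    also have "\<dots> = (\<integral>\<^sup>+y. indicator A y * (L y r / L y r * Ds y) \<partial>PiM {..r} (\<lambda>_. \<mu>))"
      using AE_Ds
    proof (intro nn_integral_cong_AE, eventually_elim)
      case (elim y)
      then show ?case by (auto simp: ennreal_divide_self)
    qed
    finally show ?thesis by (simp add: True)
  next
    case False
    \<comment> \<open>The prefix has \<open>r + 1\<close> observations and the continuation
      \<open>m + 1\<close>, indexed by \<open>{..m}\<close>.\<close>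
    then obtain m where nm: "n = r + Suc m"
      using n by (metis le_neq_implies_less less_iff_Suc_add add_Suc_right)
    have sets_n: "{..n} = {..<Suc r + Suc m}" "{..r} = {..<Suc r}" "{..m} = {..<Suc m}" by (auto simp: nm)
    interpret product_sigma_finite "\<lambda>_::nat. \<mu>" by standard
    interpret PN: sigma_finite_measure "PiM {..m} (\<lambda>_. \<mu>)" by (rule sigma_finite) simp
    let ?P = "\<lambda>k. PiM {..k} (\<lambda>_. borel) :: (nat \<Rightarrow> 'y) measure"
    have comb: "(\<lambda>(y, y'). comb_seq (Suc r) y y') \<in> ?P r \<Otimes>\<^sub>M ?P m \<rightarrow>\<^sub>M ?P n"
    proof (rule measurable_PiM_single')
      fix i assume i: "i \<in> {..n}"
      show "(\<lambda>p. (case p of (y, y') \<Rightarrow> comb_seq (Suc r) y y') i) \<in> ?P r \<Otimes>\<^sub>M ?P m \<rightarrow>\<^sub>M borel"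
      proof (cases "i < Suc r")
        case True
        then have "i \<in> {..r}" by simp
        then have "(\<lambda>p. fst p i) \<in> ?P r \<Otimes>\<^sub>M ?P m \<rightarrow>\<^sub>M borel" by measurable
        then show ?thesis using True by (simp add: split_beta comb_seq_def)
      next
        case F: False
        have "i - Suc r \<in> {..m}" using i by (auto simp: nm)
        then have "(\<lambda>p. snd p (i - Suc r)) \<in> ?P r \<Otimes>\<^sub>M ?P m \<rightarrow>\<^sub>M borel" by measurable
        then show ?thesis using F by (simp add: split_beta comb_seq_def)
      qed
    next
      show "(\<lambda>(y, y'). comb_seq (Suc r) y y') \<in> space (?P r \<Otimes>\<^sub>M ?P m) \<rightarrow> (\<Pi>\<^sub>E i\<in>{..n}. space borel)"
      proof (intro funcsetI, unfold PiE_iff, intro conjI)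
        fix p assume p: "p \<in> space (?P r \<Otimes>\<^sub>M ?P m)"
        have "snd p i = undefined" if "i > m" for i
          using p that by (auto simp: space_pair_measure space_PiM PiE_iff extensional_def)
        then show "(case p of (y, y') \<Rightarrow> comb_seq (Suc r) y y') \<in> extensional {..n}"
          by (auto simp: extensional_def comb_seq_def split_beta nm)
      qed simp
    qed
    note combm [measurable] = comb
    have e: "restrict (comb_seq (Suc r) y y') {..n} = comb_seq (Suc r) (restrict y {..r}) (restrict y' {..m})" for y y' :: "nat \<Rightarrow> 'y"
      by (auto simp: nm fun_eq_iff comb_seq_def)
    define \<Phi> where "\<Phi> z = (\<integral>\<^sup>+y'. indicator A (comb_seq (Suc r) z y') * (inverse (L z r) * L (comb_seq (Suc r) z y') n) \<partial>PiM {..m} (\<lambda>_. \<mu>))" for z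
    have post: "lik K G (posterior y) y' m = inverse (L y r) * L (comb_seq (Suc r) y y') n"
      if "0 < L y r" "L y r < \<infinity>" for y y'
    proof -
      have "lik_measure K G lam (comb_seq (Suc r) y y') r = lik_measure K G lam y r"
        by (rule lik_measure_cong) (simp add: comb_seq_def)
      then have "L (comb_seq (Suc r) y y') n = (\<integral>\<^sup>+x. 1 \<partial>lik_measure K G (lik_measure K G lam y r) y' m)"
        unfolding lik_eq[OF lam(1)] nm lik_measure_split by simp
      moreover have "lik K G (posterior y) y' m = inverse (L y r) * (\<integral>\<^sup>+x. 1 \<partial>lik_measure K G (lik_measure K G lam y r) y' m)"
        unfolding lik_eq[OF sets_posterior] using that nn_integral_lik_measure_scale[OF sets_lik_measure[OF lam(1)], of "\<lambda>_. 1"]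
        by (simp add: posterior_def)
      ultimately show ?thesis by simp
    qed
    have Ln [measurable]: "(\<lambda>y. L y n) \<in> borel_measurable (?P n)" by (rule measurable_L_prefix) simp
    have Lr [measurable]: "(\<lambda>y. L y r) \<in> borel_measurable (?P r)" by (rule measurable_L_prefix) simp
    have LrN [measurable]: "(\<lambda>y. L y r) \<in> borel_measurable (?P n)" by (rule measurable_L_prefix) (rule n)
    have Lc [measurable]: "(\<lambda>p. L (comb_seq (Suc r) (fst p) (snd p)) n) \<in> borel_measurable (?P r \<Otimes>\<^sub>M ?P m)"
      using measurable_compose[OF comb Ln] by (simp add: split_beta)
    have Ac [measurable]: "(\<lambda>p. indicator A (comb_seq (Suc r) (fst p) (snd p)) :: ennreal) \<in> borel_measurable (?P r \<Otimes>\<^sub>M ?P m)"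
      using measurable_compose[OF comb borel_measurable_indicator[OF A]] by (simp add: split_beta)
    have sm: "sets (?P r \<Otimes>\<^sub>M PiM {..m} (\<lambda>_. \<mu>)) = sets (?P r \<Otimes>\<^sub>M ?P m)"
      by (rule sets_pair_measure_cong) (simp_all add: sets_PiM_\<mu>)
    have int: "(\<lambda>p. indicator A (comb_seq (Suc r) (fst p) (snd p)) * (inverse (L (fst p) r) * L (comb_seq (Suc r) (fst p) (snd p)) n))
      \<in> borel_measurable (?P r \<Otimes>\<^sub>M PiM {..m} (\<lambda>_. \<mu>))"
      unfolding measurable_cong_sets[OF sm refl] by measurable
    have \<Phi>: "\<Phi> \<in> borel_measurable (?P r)"
      unfolding \<Phi>_def[abs_def] by (rule PN.borel_measurable_nn_integral) (use int in \<open>simp add: split_beta\<close>)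
    have "(\<integral>\<^sup>+y. \<integral>\<^sup>+\<omega>. indicator A (restrict (comb_seq (Suc r) y (obs \<omega>)) {..n}) \<partial>law (posterior y) \<partial>Ps) =
      (\<integral>\<^sup>+y. \<Phi> (restrict y {..r}) \<partial>Ps)"
      using lik_pos lik_finite
    proof (intro nn_integral_cong_AE, eventually_elim)
      case (elim y)
      let ?z = "restrict y {..r}"
      have z: "?z \<in> space (?P r)" by (simp add: space_PiM)
      have pz: "posterior y = posterior ?z" by (rule posterior_cong) simp
      have Lz: "0 < L ?z r" "L ?z r < \<infinity>" using elim by simp_all
      have "(\<lambda>y'. indicator A (comb_seq (Suc r) ?z y') :: ennreal) \<in> borel_measurable (?P m)"
        using measurable_Pair2[OF Ac z] by simp
      from nn_integral_obs_prefix[OF posterior_space this, of ?z]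
      show ?case
        unfolding e pz \<Phi>_def post[OF Lz] by simp
    qed
    also have "\<dots> = (\<integral>\<^sup>+z. \<Phi> z * Ds z \<partial>PiM {..r} (\<lambda>_. \<mu>))"
      by (rule Ps_density[OF \<Phi>])
    also have "\<dots> = (\<integral>\<^sup>+z. \<integral>\<^sup>+y'. indicator A (comb_seq (Suc r) z y') * (L (comb_seq (Suc r) z y') n / L (comb_seq (Suc r) z y') r * Ds (comb_seq (Suc r) z y'))
        \<partial>PiM {..m} (\<lambda>_. \<mu>) \<partial>PiM {..r} (\<lambda>_. \<mu>))"
    proof (rule nn_integral_cong)
      fix z assume "z \<in> space (PiM {..r} (\<lambda>_. \<mu>))"
      then have z: "z \<in> space (?P r)" by (simp add: sets_eq_imp_space_eq[OF sets_PiM_\<mu>])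
      have c: "L (comb_seq (Suc r) z y') r = L z r" "Ds (comb_seq (Suc r) z y') = Ds z" for y'
        by (auto intro!: lik_cong Ds_cong simp: comb_seq_def)
      have m: "(\<lambda>y'. indicator A (comb_seq (Suc r) z y') * (inverse (L z r) * L (comb_seq (Suc r) z y') n)) \<in> borel_measurable (PiM {..m} (\<lambda>_. \<mu>))"
        using measurable_Pair2[OF int z] by simp
      show "\<Phi> z * Ds z = (\<integral>\<^sup>+y'. indicator A (comb_seq (Suc r) z y') * (L (comb_seq (Suc r) z y') n / L (comb_seq (Suc r) z y') r * Ds (comb_seq (Suc r) z y'))
        \<partial>PiM {..m} (\<lambda>_. \<mu>))"
        unfolding \<Phi>_def c nn_integral_multc[OF m, symmetric]
        by (intro nn_integral_cong) (simp add: divide_ennreal_def mult_ac)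
    qed
    also have "\<dots> = (\<integral>\<^sup>+y. indicator A y * (L y n / L y r * Ds y) \<partial>PiM {..n} (\<lambda>_. \<mu>))"
      unfolding sets_n
    proof (rule nn_integral_PiM_comb_seq[OF sigma_finite_\<mu>, symmetric])
      have "(\<lambda>y. restrict y {..r}) \<in> ?P n \<rightarrow>\<^sub>M ?P r" using n by (intro measurable_restrict_subset) auto
      from measurable_compose[OF this Ds]
      have "(\<lambda>y. Ds (restrict y {..r})) \<in> borel_measurable (?P n)" .
      then have [measurable]: "Ds \<in> borel_measurable (?P n)"
        by (rule measurable_cong[THEN iffD1, rotated]) (rule Ds_cong, simp)
      have "(\<lambda>y. indicator A y * (L y n / L y r * Ds y)) \<in> borel_measurable (?P n)"
        by measurable
      then show "(\<lambda>y. indicator A y * (L y n / L y r * Ds y)) \<in> borel_measurable (PiM {..<Suc r + Suc m} (\<lambda>_. \<mu>))"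
        unfolding measurable_cong_sets[OF sets_PiM_\<mu> refl] sets_n .
    qed
    finally show ?thesis .
  qed
  finally show ?thesis .
qed

text \<open>Existence of the described law is \<open>norm_law_prefix\<close>, uniqueness is
  \<open>prefix_determines_law\<close>.\<close>

theorem normalized_law_eq:
  assumes "\<And>y. Ds y = lik Ks Gs (stationary_dist Ks) y r"
  shows "normalized_law K G lam r Ks Gs \<mu> = norm_law"
  unfolding normalized_law_def assms[symmetric]
proof (rule the_equality)
  show "prob_space norm_law \<and> sets norm_law = sets obs_space \<and>
    (\<forall>n\<ge>r. \<forall>A\<in>sets (PiM {..n} (\<lambda>_. borel)). emeasure norm_law {y \<in> space norm_law. restrict y {..n} \<in> A} =
      (\<integral>\<^sup>+y. indicator A y * (L y n / L y r * Ds y) \<partial>PiM {..n} (\<lambda>_. \<mu>)))"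
    by (simp add: prob_space_norm_law norm_law_prefix)
  fix P assume P: "prob_space P \<and> sets P = sets obs_space \<and>
    (\<forall>n\<ge>r. \<forall>A\<in>sets (PiM {..n} (\<lambda>_. borel)). emeasure P {y \<in> space P. restrict y {..n} \<in> A} =
      (\<integral>\<^sup>+y. indicator A y * (L y n / L y r * Ds y) \<partial>PiM {..n} (\<lambda>_. \<mu>)))"
  then have "space P = UNIV" using sets_eq_imp_space_eq[of P obs_space] by (simp add: space_PiM)
  with P show "P = norm_law"
    by (intro prefix_determines_law[where r=r]) (auto simp: prob_space_norm_law norm_law_prefix)
qed

text \<open>The integral of \<open>V\<close> under the filter, wherever the likelihood is positive
  and finite; the default branch of \<open>posterior\<close> is bypassed.\<close>

definition weight :: "('x \<Rightarrow> real) \<Rightarrow> (nat \<Rightarrow> 'y) \<Rightarrow> ennreal" where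
  "weight V y = inverse (L y r) * (\<integral>\<^sup>+x. ennreal (V x) \<partial>lik_measure K G lam y r)"

lemma measurable_weight [measurable]:
  "V \<in> borel_measurable borel \<Longrightarrow> weight V \<in> borel_measurable obs_space"
  unfolding weight_def[abs_def] by measurable

lemma weight_cong: "(\<And>i. i \<le> r \<Longrightarrow> y i = y' i) \<Longrightarrow> weight V y = weight V y'"
  unfolding weight_def using lik_cong[of r y y' lam] lik_measure_cong[of r y y' lam] by simp

text \<open>After conditioning on the prefix, the bound applies with the filter as start law, and
  \<open>weight V y \<le> W\<close> makes its integral of \<open>V\<close> at most \<open>W\<close>.
  A bound for one fixed start law would not do, as the filter varies with the data.\<close>

lemma emeasure_norm_law_le:
  assumes V [measurable]: "V \<in> borel_measurable borel" and V0: "\<And>x. 0 \<le> V x" and \<eta>: "0 \<le> \<eta>" and W: "0 \<le> W"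
    and B [measurable]: "B \<in> sets obs_space"
    and bound: "\<And>\<nu>. \<nu> \<in> space (prob_algebra borel) \<Longrightarrow>
      emeasure (law \<nu>) {\<omega>. obs \<omega> \<in> B} \<le> e * (\<integral>\<^sup>+x. ennreal (1 + \<eta> * V x) \<partial>\<nu>)"
  shows "emeasure norm_law {y. weight V y \<le> ennreal W \<and> seq_shift (Suc r) y \<in> B} \<le> e * ennreal (1 + \<eta> * W)"
proof -
  let ?E = "{y. weight V y \<le> ennreal W \<and> seq_shift (Suc r) y \<in> B}"
  have "{y \<in> space obs_space. weight V y \<le> ennreal W \<and> seq_shift (Suc r) y \<in> B} \<in> sets obs_space" by measurable
  then have E [measurable]: "?E \<in> sets obs_space" by (simp add: space_PiM)
  have wc: "weight V (comb_seq (Suc r) y y') = weight V y" for y y'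
    by (rule weight_cong) (simp add: comb_seq_def)
  have "emeasure norm_law ?E = (\<integral>\<^sup>+y. indicator ?E y \<partial>norm_law)" by simp
  also have "\<dots> = (\<integral>\<^sup>+y. \<integral>\<^sup>+\<omega>. indicator ?E (comb_seq (Suc r) y (obs \<omega>)) \<partial>law (posterior y) \<partial>Ps)"
    by (rule nn_integral_norm_law) simp
  also have "\<dots> \<le> (\<integral>\<^sup>+y. e * ennreal (1 + \<eta> * W) \<partial>Ps)"
    using lik_pos lik_finite
  proof (intro nn_integral_mono_AE, eventually_elim)
    case (elim y)
    show ?case
    proof (cases "weight V y \<le> ennreal W")
      case True
      have "{\<omega> \<in> space paths. obs \<omega> \<in> B} \<in> sets paths" by measurable
      then have "(\<integral>\<^sup>+\<omega>. indicator {\<omega>. obs \<omega> \<in> B} \<omega> \<partial>law (posterior y)) = emeasure (law (posterior y)) {\<omega>. obs \<omega> \<in> B}"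
        by (intro nn_integral_indicator) simp
      moreover have "(indicator ?E (comb_seq (Suc r) y (obs \<omega>)) :: ennreal) = indicator {\<omega>. obs \<omega> \<in> B} \<omega>" for \<omega> :: "nat \<Rightarrow> 'x \<times> 'y"
        using True by (simp add: indicator_def wc)
      ultimately have "(\<integral>\<^sup>+\<omega>. indicator ?E (comb_seq (Suc r) y (obs \<omega>)) \<partial>law (posterior y)) = emeasure (law (posterior y)) {\<omega>. obs \<omega> \<in> B}"
        by simp
      also have "\<dots> \<le> e * (\<integral>\<^sup>+x. ennreal (1 + \<eta> * V x) \<partial>posterior y)" by (rule bound) simp
      also have "\<dots> \<le> e * ennreal (1 + \<eta> * W)"
      proof (rule mult_left_mono)
        have m: "(\<lambda>x. ennreal (V x)) \<in> borel_measurable (posterior y)"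
          by (simp add: measurable_cong_sets[OF sets_posterior refl])
        have "(\<integral>\<^sup>+x. ennreal (1 + \<eta> * V x) \<partial>posterior y) = (\<integral>\<^sup>+x. 1 + ennreal \<eta> * ennreal (V x) \<partial>posterior y)"
          using \<eta> V0 by (intro nn_integral_cong) (simp add: ennreal_mult)
        also have "\<dots> = 1 + ennreal \<eta> * weight V y"
          using m prob_space.emeasure_space_1[OF prob_space_posterior[of y]] nn_integral_posterior[OF elim(3,4), of "\<lambda>x. ennreal (V x)"]
          by (simp add: nn_integral_add nn_integral_cmult weight_def)
        also have "\<dots> \<le> 1 + ennreal \<eta> * ennreal W" by (intro add_left_mono mult_left_mono True) simp
        also have "\<dots> = ennreal (1 + \<eta> * W)"
          using \<eta> W by (simp add: ennreal_mult)
        finally show "(\<integral>\<^sup>+x. ennreal (1 + \<eta> * V x) \<partial>posterior y) \<le> ennreal (1 + \<eta> * W)" .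
      qed simp
      finally show ?thesis .
    qed (simp add: wc)
  qed
  also have "\<dots> = e * ennreal (1 + \<eta> * W)"
    by (simp add: Ps.emeasure_space_1)
  finally show ?thesis .
qed

end

section \<open>Exponential separation\<close>

text \<open>Different laws differ on the event that some finite prefix lies in a set. Its indicator,
  shifted and scaled to have means \<open>0\<close> and \<open>1\<close>, is the statistic; the two
  probabilities differ by at most \<open>1\<close>, whence \<open>C \<ge> 1\<close>.\<close>

lemma separating_statistic:
  fixes P P' :: "(nat \<Rightarrow> 'y::topological_space) measure"
  assumes P: "prob_space P" "sets P = sets (PiM UNIV (\<lambda>_. borel))"
    and P': "prob_space P'" "sets P' = sets (PiM UNIV (\<lambda>_. borel))" and neq: "P \<noteq> P'"
  obtains h :: "(nat \<Rightarrow> 'y) \<Rightarrow> real" and C s where "h \<in> borel_measurable (PiM UNIV (\<lambda>_. borel))"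
    "\<And>y. \<bar>h y\<bar> \<le> C" "1 \<le> C" "depends_on s h" "(\<integral>y. h y \<partial>P) = 0" "(\<integral>y. h y \<partial>P') = 1"
proof -
  interpret P: prob_space P by fact
  interpret P': prob_space P' by fact
  have "\<exists>n A. 0 \<le> n \<and> A \<in> sets (PiM {..n} (\<lambda>_. borel)) \<and>
      emeasure P {y. restrict y {..n} \<in> A} \<noteq> emeasure P' {y. restrict y {..n} \<in> A}"
    using prefix_determines_law[OF P P', of 0] neq by blast
  then obtain n and A :: "(nat \<Rightarrow> 'y) set" where A: "A \<in> sets (PiM {..n} (\<lambda>_. borel))"
    and ne: "emeasure P {y. restrict y {..n} \<in> A} \<noteq> emeasure P' {y. restrict y {..n} \<in> A}"
    by blast
  let ?E = "{y. restrict y {..n} \<in> A}"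
  define p where "p = measure P ?E"
  define p' where "p' = measure P' ?E"
  have pp: "p \<noteq> p'" using ne by (simp add: p_def p'_def P.emeasure_eq_measure P'.emeasure_eq_measure)
  have p01: "0 \<le> p" "p \<le> 1" "0 \<le> p'" "p' \<le> 1" by (simp_all add: p_def p'_def)
  have "(\<lambda>y. restrict y {..n}) \<in> PiM UNIV (\<lambda>_. borel) \<rightarrow>\<^sub>M PiM {..n} (\<lambda>_. borel :: 'y measure)"
    by (rule measurable_restrict_subset) simp
  from measurable_sets[OF this A] have E [measurable]: "?E \<in> sets (PiM UNIV (\<lambda>_. borel))"
    by (simp add: vimage_def space_PiM)
  have iE: "integrable P (indicator ?E :: _ \<Rightarrow> real)" "integrable P' (indicator ?E :: _ \<Rightarrow> real)"
    using E P(2) P'(2) by (simp_all add: P.emeasure_eq_measure P'.emeasure_eq_measure)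
  have mE: "(\<integral>y. indicator ?E y \<partial>P) = p" "(\<integral>y. indicator ?E y \<partial>P') = p'"
    using E P(2) P'(2) sets_eq_imp_space_eq[OF P(2)] sets_eq_imp_space_eq[OF P'(2)]
    by (simp_all add: p_def p'_def space_PiM)
  define h where "h y = (indicator ?E y - p) / (p' - p)" for y
  show thesis
  proof (rule that[of h "1 / \<bar>p' - p\<bar>" "Suc n"])
    show "h \<in> borel_measurable (PiM UNIV (\<lambda>_. borel))" unfolding h_def[abs_def] by measurable
    show "\<bar>h y\<bar> \<le> 1 / \<bar>p' - p\<bar>" for y
    proof -
      have "\<bar>indicator ?E y - p\<bar> \<le> 1" using p01 by (auto simp: indicator_def)
      then show ?thesis by (simp add: h_def abs_divide divide_right_mono)
    qed
    show "1 \<le> 1 / \<bar>p' - p\<bar>" using pp p01 by (simp add: field_simps)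
    show "depends_on (Suc n) h"
      unfolding depends_on_def
    proof (intro allI impI)
      fix y y' :: "nat \<Rightarrow> 'y" assume "\<forall>i<Suc n. y i = y' i"
      then have "restrict y {..n} = restrict y' {..n}" by (auto simp: fun_eq_iff)
      then show "h y = h y'" by (simp add: h_def indicator_def)
    qed
    show "(\<integral>y. h y \<partial>P) = 0" "(\<integral>y. h y \<partial>P') = 1"
      using iE mE pp by (simp_all add: h_def P.prob_space P'.prob_space)
  qed
qed

text \<open>Each block drops \<open>s\<close> window positions, and each dropped term is at most
  \<open>C\<close>.\<close>

lemma window_sum_le_block_sum:
  assumes C: "\<And>y. \<bar>h y\<bar> \<le> C" and sb: "s \<le> b"
  shows "window_sum h (J * b) y - real J * (real s * C) \<le> block_sum h s b J y"
proof (induction J arbitrary: y)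
  case 0 then show ?case by (simp add: window_sum_def block_sum_def)
next
  case (Suc J)
  have "window_sum h (Suc J * b) y = window_sum h ((b - s) + s + J * b) y"
    using sb by (simp add: algebra_simps)
  also have "\<dots> = window_sum h (b - s) y + window_sum h s (seq_shift (b - s) y) + window_sum h (J * b) (seq_shift b y)"
    using sb by (simp only: window_sum_add) simp
  also have "window_sum h s (seq_shift (b - s) y) \<le> real s * C"
    using abs_window_sum_le[of h C s "seq_shift (b - s) y", OF C] by linarith
  finally show ?case using Suc[of "seq_shift b y"] by (simp add: block_sum_Suc algebra_simps)
qed

text \<open>Used to see that the event is decided by the observations up to time
  \<open>n\<close>.\<close>

lemma depends_on_block_sum:
  assumes h: "depends_on s h" and sb: "s \<le> b" shows "depends_on (J * b) (block_sum h s b J)"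
proof (induction J)
  case 0 then show ?case by (simp add: depends_on_def block_sum_def)
next
  case (Suc J)
  have 1: "depends_on (Suc J * b) (window_sum h (b - s))"
    using depends_on_mono[OF depends_on_window_sum[OF h, of "b - s"]] sb by simp
  have 2: "depends_on (Suc J * b) (\<lambda>y. block_sum h s b J (seq_shift b y))"
    using depends_on_seq_shift[OF Suc, of b] by (simp add: add.commute)
  show ?case
    using 1 2 unfolding depends_on_def block_sum_Suc by metis
qed

lemma window_sum_minus_const: "window_sum (\<lambda>y. h y - a) n y = window_sum h n y - real n * a"
  by (simp add: window_sum_def sum_subtractf)

lemma log_ennreal_le:
  assumes "x \<le> ennreal (exp a)" shows "log_ennreal x \<le> ereal a"
proof (cases "x = 0")
  case False
  have fin: "x \<noteq> \<infinity>" using assms by (auto simp: top_unique)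
  then obtain u where u: "0 \<le> u" "x = ennreal u" by (cases x) auto
  with False have u0: "0 < u" by (simp add: less_le)
  have "u \<le> exp a" using assms u by (simp add: ennreal_le_iff)
  then have "ln u \<le> a" using u0 ln_le_cancel_iff[of u "exp a"] by simp
  then show ?thesis using False fin u by (simp add: log_ennreal_def)
qed (simp add: log_ennreal_def)

lemma log_pos_infinity: "log_pos \<infinity> = \<infinity>"
  by (simp add: log_pos_def log_ennreal_def)

lemma div_mult_at_top:
  fixes b r :: nat assumes "0 < b"
  shows "filterlim (\<lambda>n. (n - r) div b * b) at_top sequentially"
  unfolding filterlim_at_top
proof
  fix Z
  show "\<forall>\<^sub>F n in sequentially. Z \<le> (n - r) div b * b"
    using eventually_ge_at_top[of "Z + r + b"]
  proof eventually_elim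
    case (elim n)
    have "(n - r) div b * b + (n - r) mod b = n - r" by simp
    moreover have "(n - r) mod b < b" using assms by simp
    ultimately show ?case using elim by linarith
  qed
qed

text \<open>The number of blocks is at least \<open>(n - r) / b - 1\<close>, so the exponent is
  linear in \<open>n\<close> with slope \<open>- c / b\<close>; \<open>M\<close> and the boundary
  terms vanish after division by \<open>n\<close>.\<close>

lemma limsup_log_neg:
  fixes x :: "nat \<Rightarrow> ennreal" and b r :: nat
  assumes b: "0 < b" and c: "0 < c" and M: "1 \<le> M"
    and x: "\<And>n. r \<le> n \<Longrightarrow> x n \<le> ennreal (exp (- c * real ((n - r) div b))) * ennreal M"
  shows "limsup (\<lambda>n. ereal (1 / real n) * log_ennreal (x n)) < 0"
proof -
  define f where "f n = (1 / real n) * (- c * ((real n - real r) / real b - 1) + ln M)" for n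
  have le: "\<forall>\<^sub>F n in sequentially. ereal (1 / real n) * log_ennreal (x n) \<le> ereal (f n)"
    using eventually_ge_at_top[of r] eventually_gt_at_top[of 0]
  proof eventually_elim
    case (elim n)
    let ?J = "(n - r) div b"
    have "real (n - r) = real (?J * b + (n - r) mod b)" by simp
    also have "\<dots> = real ?J * real b + real ((n - r) mod b)" by (simp only: of_nat_add of_nat_mult)
    also have "\<dots> \<le> real ?J * real b + real b" using b by (simp add: less_imp_le)
    finally have "(real n - real r) / real b - 1 \<le> real ?J"
      using b elim by (simp add: field_simps of_nat_diff)
    then have le: "- c * real ?J + ln M \<le> - c * ((real n - real r) / real b - 1) + ln M"
      using c by (simp add: mult_left_mono)
    have "x n \<le> ennreal (exp (- c * real ?J)) * ennreal M" using x elim by blast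
    also have "\<dots> = ennreal (exp (- c * real ?J + ln M))"
    proof -
      have "exp (- c * real ?J + ln M) = exp (- c * real ?J) * M" using M by (subst exp_add) simp
      then show ?thesis using M by (simp only: ennreal_mult'')
    qed
    finally have "log_ennreal (x n) \<le> ereal (- c * real ?J + ln M)" by (rule log_ennreal_le)
    also have "\<dots> \<le> ereal (- c * ((real n - real r) / real b - 1) + ln M)" using le by simp
    finally have "ereal (1 / real n) * log_ennreal (x n) \<le> ereal (1 / real n) * ereal (- c * ((real n - real r) / real b - 1) + ln M)"
      by (intro ereal_mult_left_mono) auto
    then show ?case by (simp add: f_def)
  qed
  have "f \<longlonglongrightarrow> - c / real b"
  proof -
    have "(\<lambda>n. - c / real b + (c * (real r / real b + 1) + ln M) / real n) \<longlonglongrightarrow> - c / real b + 0"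
      by (intro tendsto_add tendsto_const lim_const_over_n)
    moreover have "\<forall>\<^sub>F n in sequentially. - c / real b + (c * (real r / real b + 1) + ln M) / real n = f n"
      using eventually_gt_at_top[of 0] by eventually_elim (use b in \<open>simp add: f_def field_simps\<close>)
    ultimately show ?thesis by (simp add: tendsto_cong)
  qed
  then have "limsup (\<lambda>n. ereal (f n)) = ereal (- c / real b)"
    by (intro lim_imp_Limsup) auto
  moreover have "limsup (\<lambda>n. ereal (1 / real n) * log_ennreal (x n)) \<le> limsup (\<lambda>n. ereal (f n))"
    by (rule Limsup_mono[OF le])
  moreover have "ereal (- c / real b) < 0" using b c by simp
  ultimately show ?thesis by (metis order_le_less_trans)
qed

lemma measurable_Pair_kernel:
  assumes "(\<lambda>(\<theta>, x). Q \<theta> x) \<in> borel \<Otimes>\<^sub>M borel \<rightarrow>\<^sub>M prob_algebra borel"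
  shows "Q \<theta> \<in> borel \<rightarrow>\<^sub>M prob_algebra borel"
  using measurable_Pair2[OF assms, of \<theta>] by simp

theorem theorem2:
  fixes Q :: "'t::metric_space \<Rightarrow> 'x::polish_space \<Rightarrow> 'x measure"
    and g :: "'t \<Rightarrow> 'x \<Rightarrow> 'y::polish_space \<Rightarrow> real"
    and \<mu> :: "'y measure"
    and eqv :: "'t \<Rightarrow> 't \<Rightarrow> bool"  (infix "\<sim>" 50)
    and \<theta>s :: 't
    and l :: nat
    and q :: "'t \<Rightarrow> 'x \<Rightarrow> 'x \<Rightarrow> real"
    and lam :: "'x measure"
    and r :: "'t \<Rightarrow> nat"
  assumes compact: "compact (UNIV :: 't set)"
    and Q: "(\<lambda>(\<theta>, x). Q \<theta> x) \<in> borel \<Otimes>\<^sub>M borel \<rightarrow>\<^sub>M prob_algebra borel"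
    and \<mu>: "sets \<mu> = sets borel" "sigma_finite_measure \<mu>"
    and g_meas: "(\<lambda>(\<theta>, x, y). g \<theta> x y) \<in> borel_measurable (borel \<Otimes>\<^sub>M borel \<Otimes>\<^sub>M borel)"
    and g_nonneg: "\<And>\<theta> x y. 0 \<le> g \<theta> x y"
    and g_int: "\<And>\<theta> x. (\<integral>\<^sup>+y. ennreal (g \<theta> x y) \<partial>\<mu>) = 1"
    and unique_inv: "\<exists>!\<pi>. invariant_prob (Q \<theta>s) \<pi>"
    and l: "1 \<le> l"
    and lam: "sets lam = sets borel" "sigma_finite_measure lam"
    and q_meas: "(\<lambda>(\<theta>, x, x'). q \<theta> x x') \<in> borel_measurable (borel \<Otimes>\<^sub>M borel \<Otimes>\<^sub>M borel)"
    and q_nonneg: "\<And>\<theta> x x'. 0 \<le> q \<theta> x x'"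
    and q_bounded: "\<And>\<theta>. \<not> \<theta> \<sim> \<theta>s \<Longrightarrow> (SUP x. SUP x'. ennreal (q \<theta> x x')) < \<infinity>"
    and q_density: "\<And>\<theta> x A. \<not> \<theta> \<sim> \<theta>s \<Longrightarrow> A \<in> sets borel \<Longrightarrow>
          emeasure (kernel_iter (Q \<theta>) l x) A = (\<integral>\<^sup>+x'. indicator A x' * ennreal (q \<theta> x x') \<partial>lam)"
    and A1: "positive_harris_recurrent (Q \<theta>s)"
    and A4: "\<And>\<theta>. \<not> \<theta> \<sim> \<theta>s \<Longrightarrow>
          \<exists>U. open U \<and> \<theta> \<in> U \<and>
            (SUP \<theta>'\<in>U. SUP x. SUP x'. ennreal (q \<theta>' x x')) < \<infinity> \<and>
            (\<integral>\<^sup>+\<omega>. (SUP \<theta>'\<in>U. SUP x. log_pos (ennreal (g \<theta>' x (obs \<omega> 0))))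
               \<partial>completion (hmm_stat (Q \<theta>s) \<mu> (g \<theta>s))) < \<infinity> \<and>
            (\<integral>\<^sup>+\<omega>. (SUP \<theta>'\<in>U. log_pos (lik (Q \<theta>') (g \<theta>') lam (obs \<omega>) (r \<theta>)))
               \<partial>completion (hmm_stat (Q \<theta>s) \<mu> (g \<theta>s))) < \<infinity>"
    and A6': "\<And>\<theta>. \<not> \<theta> \<sim> \<theta>s \<Longrightarrow>
          (AE \<omega> in hmm_stat (Q \<theta>s) \<mu> (g \<theta>s). 0 < lik (Q \<theta>) (g \<theta>) lam (obs \<omega>) (r \<theta>)) \<Longrightarrow>
          \<exists>V. V_uniformly_ergodic (Q \<theta>) V \<and>
            hmm_stat_obs (Q \<theta>) \<mu> (g \<theta>) \<noteq> hmm_stat_obs (Q \<theta>s) \<mu> (g \<theta>s) \<and>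
            \<P>(\<omega> in hmm_stat (Q \<theta>s) \<mu> (g \<theta>s).
               (\<integral>\<^sup>+x. ennreal (V x) \<partial>lik_measure (Q \<theta>) (g \<theta>) lam (obs \<omega>) (r \<theta>)) < \<infinity>) > 0"
  shows "\<forall>\<theta>. \<not> \<theta> \<sim> \<theta>s \<longrightarrow>
          (AE \<omega> in hmm_stat (Q \<theta>s) \<mu> (g \<theta>s). 0 < lik (Q \<theta>) (g \<theta>) lam (obs \<omega>) (r \<theta>)) \<longrightarrow>
          (\<exists>A :: nat \<Rightarrow> (nat \<Rightarrow> 'y) set.
             (\<forall>n. A n \<in> sets (PiM {..n} (\<lambda>_. borel))) \<and>
             liminf (\<lambda>n. ereal \<P>(\<omega> in hmm_stat (Q \<theta>s) \<mu> (g \<theta>s). restrict (obs \<omega>) {..n} \<in> A n)) > 0 \<and>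
             limsup (\<lambda>n. ereal (1 / real n) *
               log_ennreal
                 (emeasure (normalized_law (Q \<theta>) (g \<theta>) lam (r \<theta>) (Q \<theta>s) (g \<theta>s) \<mu>)
                   {y. restrict y {..n} \<in> A n})) < 0)"
proof (intro allI impI)
  fix \<theta>
  assume neq: "\<not> \<theta> \<sim> \<theta>s" and pos: "AE \<omega> in hmm_stat (Q \<theta>s) \<mu> (g \<theta>s). 0 < lik (Q \<theta>) (g \<theta>) lam (obs \<omega>) (r \<theta>)"
  have hmm: "hmm (Q \<theta>) \<mu> (g \<theta>)" for \<theta>
  proof (rule hmm.intro)
    show "Q \<theta> \<in> borel \<rightarrow>\<^sub>M prob_algebra borel" by (rule measurable_Pair_kernel[OF Q])
    show "(\<lambda>(x, y). g \<theta> x y) \<in> borel_measurable (borel \<Otimes>\<^sub>M borel)"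
      using measurable_Pair2[OF g_meas, of \<theta>] by simp
  qed (simp_all add: \<mu> g_nonneg g_int)
  interpret S: hmm "Q \<theta>s" \<mu> "g \<theta>s" by (rule hmm)
  interpret T: hmm "Q \<theta>" \<mu> "g \<theta>" by (rule hmm)
  define \<pi>s where "\<pi>s = stationary_dist (Q \<theta>s)"
  have \<pi>s: "invariant_prob (Q \<theta>s) \<pi>s"
    unfolding \<pi>s_def stationary_dist_def using unique_inv by (rule theI')
  have unique_s: "invariant_prob (Q \<theta>s) \<pi>' \<Longrightarrow> \<pi>' = \<pi>s" for \<pi>'
    using unique_inv \<pi>s by blast
  note ps [simp] = invariant_probD[OF \<pi>s]
  have stat: "hmm_stat (Q \<theta>s) \<mu> (g \<theta>s) = S.law \<pi>s" by (simp add: hmm_stat_def \<pi>s_def)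
  interpret PS: prob_space "S.law \<pi>s" by (rule S.prob_space_law) simp
  have sPS: "space (S.law \<pi>s) = UNIV" by simp
  obtain V where V: "V_uniformly_ergodic (Q \<theta>) V"
    and obs_neq: "hmm_stat_obs (Q \<theta>) \<mu> (g \<theta>) \<noteq> hmm_stat_obs (Q \<theta>s) \<mu> (g \<theta>s)"
    and V_pos: "\<P>(\<omega> in S.law \<pi>s. (\<integral>\<^sup>+x. ennreal (V x) \<partial>lik_measure (Q \<theta>) (g \<theta>) lam (obs \<omega>) (r \<theta>)) < \<infinity>) > 0"
    using A6'[OF neq pos] unfolding stat by blast
  from V obtain \<pi> R \<alpha> where VV: "uniformly_ergodic (Q \<theta>) V \<pi> R \<alpha>"
    unfolding V_uniformly_ergodic_def uniformly_ergodic_def using T.kernel by blast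
  interpret E: uniformly_ergodic "Q \<theta>" V \<pi> R \<alpha> by (rule VV)
  note pt [simp] = invariant_probD[OF E.\<pi>]
  interpret PT: prob_space "T.law \<pi>" by (rule T.prob_space_law) simp
  let ?O = "PiM UNIV (\<lambda>_. borel) :: (nat \<Rightarrow> 'y) measure"
  define Pt where "Pt = distr (T.law \<pi>) ?O obs"
  define Ps where "Ps = distr (S.law \<pi>s) ?O obs"
  have Pt: "prob_space Pt" "sets Pt = sets ?O" unfolding Pt_def by (auto intro!: PT.prob_space_distr)
  have Ps: "prob_space Ps" "sets Ps = sets ?O" unfolding Ps_def by (auto intro!: PS.prob_space_distr)
  \<comment> \<open>Both stationary distributions resolve to the invariant laws at hand, so this is
    the identifiability assumption in \<open>A6'\<close>.\<close>
  have "Pt \<noteq> Ps"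
    using obs_neq by (simp add: hmm_stat_obs_def hmm_stat_def Pt_def Ps_def \<pi>s_def E.stationary_dist_eq)
  then obtain h :: "(nat \<Rightarrow> 'y) \<Rightarrow> real" and C s where h [measurable]: "h \<in> borel_measurable ?O" and C: "\<And>y. \<bar>h y\<bar> \<le> C" and C1: "1 \<le> C"
    and dep: "depends_on s h" and h0: "(\<integral>y. h y \<partial>Pt) = 0" and h1: "(\<integral>y. h y \<partial>Ps) = 1"
    by (rule separating_statistic[OF Pt Ps]) blast
  have h0': "(\<integral>\<omega>. h (obs \<omega>) \<partial>T.law \<pi>) = 0"
    using h0 unfolding Pt_def by (subst (asm) integral_distr) auto
  have h1': "(\<integral>\<omega>. h (obs \<omega>) \<partial>S.law \<pi>s) = 1"
    using h1 unfolding Ps_def by (subst (asm) integral_distr) auto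
  interpret H: hmm_ergodic "Q \<theta>" \<mu> "g \<theta>" V \<pi> R \<alpha> h C s
    by standard (use h C C1 dep h0' in auto)
  \<comment> \<open>Makes the loss \<open>s * C\<close> per block at most \<open>b / 4\<close>,
    which leaves a mean of at least \<open>3 * b / 4\<close> against the threshold
    \<open>b / 2\<close>.\<close>
  obtain b0 :: nat where b0: "4 * (real s * C) \<le> real b0" using real_arch_simple by blast
  obtain b c \<eta> where b: "s + b0 \<le> b" "0 < b" and c: "0 < c" and \<eta>: "0 \<le> \<eta>"
    and dev: "\<And>\<nu> J. \<nu> \<in> space (prob_algebra borel) \<Longrightarrow>
      emeasure (T.law \<nu>) {\<omega>. real J * real b / 2 \<le> block_sum h s b J (obs \<omega>)}
        \<le> ennreal (exp (- c * real J)) * (\<integral>\<^sup>+x. ennreal (1 + \<eta> * V x) \<partial>\<nu>)"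
    by (rule H.block_sum_deviation[of "s + b0"]) blast
  have sb: "s \<le> b" using b by simp
  define Ds where "Ds y = lik (Q \<theta>s) (g \<theta>s) \<pi>s y (r \<theta>)" for y
  have \<pi>s_sf: "sets \<pi>s = sets borel" "sigma_finite_measure \<pi>s"
    using \<pi>s by (auto simp: invariant_prob_def prob_space_imp_sigma_finite)
  have likm [measurable]: "(\<lambda>y. lik (Q \<theta>) (g \<theta>) lam y (r \<theta>)) \<in> borel_measurable ?O"
    by (rule T.measurable_lik[OF lam]) simp
  \<comment> \<open>Where the likelihood at \<open>\<theta>\<close> is infinite, the supremum in the
    last part of \<open>A4\<close> is infinite too, so its finite expectation makes this event null.
    The event is Borel, which lets its integral pass between the law and its completion.\<close>
  have lik_fin: "AE \<omega> in S.law \<pi>s. lik (Q \<theta>) (g \<theta>) lam (obs \<omega>) (r \<theta>) < \<infinity>"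
  proof -
    obtain U where U: "\<theta> \<in> U" and fin: "(\<integral>\<^sup>+\<omega>. (SUP \<theta>'\<in>U. log_pos (lik (Q \<theta>') (g \<theta>') lam (obs \<omega>) (r \<theta>))) \<partial>completion (S.law \<pi>s)) < \<infinity>"
      using A4[OF neq] unfolding stat by blast
    let ?I = "{\<omega>. lik (Q \<theta>) (g \<theta>) lam (obs \<omega>) (r \<theta>) = \<infinity>}"
    have "{\<omega> \<in> space S.paths. lik (Q \<theta>) (g \<theta>) lam (obs \<omega>) (r \<theta>) = \<infinity>} \<in> sets S.paths" by measurable
    then have I: "?I \<in> sets (S.law \<pi>s)" by simp
    have "\<infinity> * emeasure (S.law \<pi>s) ?I = (\<integral>\<^sup>+\<omega>. \<infinity> * indicator ?I \<omega> \<partial>S.law \<pi>s)"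
      using I by (simp add: nn_integral_cmult_indicator)
    also have "\<dots> = (\<integral>\<^sup>+\<omega>. \<infinity> * indicator ?I \<omega> \<partial>completion (S.law \<pi>s))"
      by (rule nn_integral_completion[symmetric])
    also have "\<dots> \<le> (\<integral>\<^sup>+\<omega>. (SUP \<theta>'\<in>U. log_pos (lik (Q \<theta>') (g \<theta>') lam (obs \<omega>) (r \<theta>))) \<partial>completion (S.law \<pi>s))"
    proof (rule nn_integral_mono)
      fix \<omega> :: "nat \<Rightarrow> 'x \<times> 'y"
      have "\<infinity> * indicator ?I \<omega> \<le> log_pos (lik (Q \<theta>) (g \<theta>) lam (obs \<omega>) (r \<theta>))"
        using log_pos_infinity by (auto simp: indicator_def)
      also have "\<dots> \<le> (SUP \<theta>'\<in>U. log_pos (lik (Q \<theta>') (g \<theta>') lam (obs \<omega>) (r \<theta>)))"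
        by (rule SUP_upper[OF U])
      finally show "\<infinity> * indicator ?I \<omega> \<le> (SUP \<theta>'\<in>U. log_pos (lik (Q \<theta>') (g \<theta>') lam (obs \<omega>) (r \<theta>)))" .
    qed
    also note fin
    finally have "emeasure (S.law \<pi>s) ?I = 0" by (auto simp: ennreal_top_mult split: if_splits)
    moreover have "x = top" if "\<not> x < top" for x :: ennreal
      using that by (metis top.not_eq_extremum)
    ultimately show ?thesis
      using I by (intro AE_I[of _ _ ?I]) auto
  qed
  interpret N: normalized_hmm "Q \<theta>" \<mu> "g \<theta>" lam "r \<theta>" Ps Ds
  proof (intro normalized_hmm.intro normalized_hmm_axioms.intro)
    show "hmm (Q \<theta>) \<mu> (g \<theta>)" by (rule hmm)
    show "sets lam = sets borel" "sigma_finite_measure lam" by (fact lam)+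
    show "Ps \<in> space (prob_algebra ?O)" using Ps by (simp add: space_prob_algebra)
    show "Ds \<in> borel_measurable (PiM {..r \<theta>} (\<lambda>_. borel))"
      unfolding Ds_def[abs_def] by (rule S.measurable_lik[OF \<pi>s_sf]) simp
    show "(\<And>i. i \<le> r \<theta> \<Longrightarrow> y i = y' i) \<Longrightarrow> Ds y = Ds y'" for y y'
      unfolding Ds_def by (rule S.lik_cong)
    show "(\<integral>\<^sup>+y. F (restrict y {..r \<theta>}) \<partial>Ps) = (\<integral>\<^sup>+y. F y * Ds y \<partial>PiM {..r \<theta>} (\<lambda>_. \<mu>))"
      if F: "F \<in> borel_measurable (PiM {..r \<theta>} (\<lambda>_. borel))" for F
    proof -
      have "(\<lambda>y. restrict y {..r \<theta>}) \<in> ?O \<rightarrow>\<^sub>M PiM {..r \<theta>} (\<lambda>_. borel)" by (rule measurable_restrict_subset) simp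
      from measurable_compose[OF this F] have "(\<lambda>y. F (restrict y {..r \<theta>})) \<in> borel_measurable ?O" .
      then have "(\<integral>\<^sup>+y. F (restrict y {..r \<theta>}) \<partial>Ps) = (\<integral>\<^sup>+\<omega>. F (restrict (obs \<omega>) {..r \<theta>}) \<partial>S.law \<pi>s)"
        unfolding Ps_def by (intro nn_integral_distr) auto
      also have "\<dots> = (\<integral>\<^sup>+y. F y * Ds y \<partial>PiM {..r \<theta>} (\<lambda>_. \<mu>))"
        unfolding Ds_def by (rule S.nn_integral_obs_prefix[OF ps F])
      finally show ?thesis .
    qed
    show "AE y in Ps. 0 < lik (Q \<theta>) (g \<theta>) lam y (r \<theta>)"
      using pos unfolding Ps_def stat by (subst AE_distr_iff) auto
    show "AE y in Ps. lik (Q \<theta>) (g \<theta>) lam y (r \<theta>) < \<infinity>"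
      using lik_fin unfolding Ps_def by (subst AE_distr_iff) auto
  qed
  have norm_eq: "normalized_law (Q \<theta>) (g \<theta>) lam (r \<theta>) (Q \<theta>s) (g \<theta>s) \<mu> = N.norm_law"
    by (rule N.normalized_law_eq) (simp add: Ds_def \<pi>s_def)
  note wm [measurable] = N.measurable_weight[OF E.V]
  \<comment> \<open>\<open>V_pos\<close> gives a finite weight with positive probability; countably
    many levels exhaust this event, so some level \<open>k\<close> has positive probability.\<close>
  obtain k :: nat where k: "PS.prob {\<omega>. N.weight V (obs \<omega>) \<le> ennreal (real k)} > 0"
  proof (rule ccontr)
    assume "\<not> thesis"
    have null: "PS.prob {\<omega>. N.weight V (obs \<omega>) \<le> ennreal (real k)} = 0" for k :: nat
    proof (rule ccontr)
      assume "PS.prob {\<omega>. N.weight V (obs \<omega>) \<le> ennreal (real k)} \<noteq> 0"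
      then have "0 < PS.prob {\<omega>. N.weight V (obs \<omega>) \<le> ennreal (real k)}"
        by (simp add: zero_less_measure_iff)
      from that[OF this] \<open>\<not> thesis\<close> show False by blast
    qed
    have "AE \<omega> in S.law \<pi>s. \<not> N.weight V (obs \<omega>) \<le> ennreal (real k)" for k :: nat
    proof (rule AE_I[of _ _ "{\<omega>. N.weight V (obs \<omega>) \<le> ennreal (real k)}"])
      have "{\<omega> \<in> space S.paths. N.weight V (obs \<omega>) \<le> ennreal (real k)} \<in> sets S.paths" by measurable
      then show "{\<omega>. N.weight V (obs \<omega>) \<le> ennreal (real k)} \<in> sets (S.law \<pi>s)" by simp
      show "emeasure (S.law \<pi>s) {\<omega>. N.weight V (obs \<omega>) \<le> ennreal (real k)} = 0"
        using null[of k] by (simp add: PS.emeasure_eq_measure)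
    qed auto
    then have "AE \<omega> in S.law \<pi>s. \<forall>k::nat. \<not> N.weight V (obs \<omega>) \<le> ennreal (real k)"
      by (simp add: AE_all_countable)
    then have "AE \<omega> in S.law \<pi>s. \<not> (\<integral>\<^sup>+x. ennreal (V x) \<partial>lik_measure (Q \<theta>) (g \<theta>) lam (obs \<omega>) (r \<theta>)) < \<infinity>"
      using pos unfolding stat
    proof eventually_elim
      case (elim \<omega>)
      show ?case
      proof
        assume "(\<integral>\<^sup>+x. ennreal (V x) \<partial>lik_measure (Q \<theta>) (g \<theta>) lam (obs \<omega>) (r \<theta>)) < \<infinity>"
        then have "N.weight V (obs \<omega>) < \<infinity>"
          using elim(2) unfolding N.weight_def
          by (auto simp: ennreal_mult_eq_top_iff less_top[symmetric])
        then obtain w where "0 \<le> w" "N.weight V (obs \<omega>) = ennreal w"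
          by (cases "N.weight V (obs \<omega>)") auto
        moreover obtain k :: nat where "w \<le> real k" using real_arch_simple by blast
        ultimately show False using elim(1) by (auto simp: ennreal_leI)
      qed
    qed
    then have "PS.prob {\<omega> \<in> space (S.law \<pi>s). (\<integral>\<^sup>+x. ennreal (V x) \<partial>lik_measure (Q \<theta>) (g \<theta>) lam (obs \<omega>) (r \<theta>)) < \<infinity>} = 0"
      by (intro PS.prob_eq_0_AE) auto
    with V_pos show False by simp
  qed
  define W where "W = real k"
  have W: "0 \<le> W" by (simp add: W_def)
  \<comment> \<open>The number of complete blocks among the \<open>n - r \<theta>\<close>
    observations that follow time \<open>r \<theta>\<close>, up to time \<open>n\<close>.\<close>
  define J where "J n = (n - r \<theta>) div b" for n
  define B where "B n = {y :: nat \<Rightarrow> 'y. real (J n) * real b / 2 \<le> block_sum h s b (J n) y}" for n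
  have Bm [measurable]: "B n \<in> sets ?O" for n
  proof -
    have "{y \<in> space ?O. real (J n) * real b / 2 \<le> block_sum h s b (J n) y} \<in> sets ?O" by measurable
    then show ?thesis by (simp add: B_def space_PiM)
  qed
  define D where "D n = {y. N.weight V y \<le> ennreal W \<and> seq_shift (Suc (r \<theta>)) y \<in> B n}" for n
  have Dm [measurable]: "D n \<in> sets ?O" for n
  proof -
    have "{y \<in> space ?O. N.weight V y \<le> ennreal W \<and> seq_shift (Suc (r \<theta>)) y \<in> B n} \<in> sets ?O" by measurable
    then show ?thesis by (simp add: D_def space_PiM)
  qed
  \<comment> \<open>The limits ignore the finitely many \<open>n < r \<theta>\<close>. For the
    others \<open>A n\<close> is \<open>D n\<close> read on prefixes, whose points are
    \<open>undefined\<close> beyond \<open>n\<close>.\<close>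
  define A where "A n = (if n < r \<theta> then {} else D n \<inter> space (PiM {..n} (\<lambda>_. borel)))" for n
  have Am: "A n \<in> sets (PiM {..n} (\<lambda>_. borel))" for n
    using measurable_sets[OF measurable_extend_PiM[of "{..n}"] Dm[of n]] by (simp add: A_def vimage_def)
  have A_iff: "restrict y {..n} \<in> A n \<longleftrightarrow> y \<in> D n" if n: "r \<theta> \<le> n" for y n
  proof -
    have "N.weight V (restrict y {..n}) = N.weight V y" by (rule N.weight_cong) (use n in simp)
    moreover have "block_sum h s b (J n) (seq_shift (Suc (r \<theta>)) (restrict y {..n})) = block_sum h s b (J n) (seq_shift (Suc (r \<theta>)) y)"
    proof -
      \<comment> \<open>The last index read is at most \<open>r \<theta> + J n * b\<close>, hence at
        most \<open>n\<close>.\<close>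
      have "J n * b \<le> n - r \<theta>" by (simp add: J_def)
      then have "\<forall>i<J n * b. seq_shift (Suc (r \<theta>)) (restrict y {..n}) i = seq_shift (Suc (r \<theta>)) y i"
        using n by (auto simp: seq_shift_def)
      then show ?thesis using depends_on_block_sum[OF dep sb, of "J n"] unfolding depends_on_def by blast
    qed
    ultimately show ?thesis using n by (auto simp: A_def D_def B_def space_PiM)
  qed

  \<comment> \<open>Exponential decay under the normalized law\<close>
  have upper: "emeasure N.norm_law {y. restrict y {..n} \<in> A n} \<le> ennreal (exp (- c * real ((n - r \<theta>) div b))) * ennreal (1 + \<eta> * W)"
    if n: "r \<theta> \<le> n" for n
  proof -
    have "emeasure N.norm_law (D n) \<le> ennreal (exp (- c * real (J n))) * ennreal (1 + \<eta> * W)"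
      unfolding D_def
    proof (rule N.emeasure_norm_law_le[OF E.V E.V_nonneg \<eta> W Bm])
      fix \<nu> :: "'x measure" assume "\<nu> \<in> space (prob_algebra borel)"
      from dev[OF this, of "J n"]
      show "emeasure (T.law \<nu>) {\<omega>. obs \<omega> \<in> B n} \<le> ennreal (exp (- c * real (J n))) * (\<integral>\<^sup>+x. ennreal (1 + \<eta> * V x) \<partial>\<nu>)"
        by (simp add: B_def)
    qed
    moreover have "{y. restrict y {..n} \<in> A n} = D n" using A_iff[OF n] by auto
    ultimately show ?thesis by (simp add: J_def)
  qed
  have "1 \<le> 1 + \<eta> * W" using \<eta> W by simp
  from limsup_log_neg[OF b(2) c this upper]
  have limsup: "limsup (\<lambda>n. ereal (1 / real n) * log_ennreal (emeasure N.norm_law {y. restrict y {..n} \<in> A n})) < 0"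
    by simp

  \<comment> \<open>Positive probability at the true parameter\<close>
  define p where "p = PS.prob {\<omega>. N.weight V (obs \<omega>) \<le> ennreal W}"
  have p: "0 < p" using k by (simp add: p_def W_def)
  \<comment> \<open>The quarter is what failure of the block event costs: a block sum below
    \<open>1 / 2\<close> per observation plus a loss of \<open>1 / 4\<close> keep the window average
    at or below \<open>3 / 4\<close>, while its mean is \<open>1\<close>.\<close>
  define q' where "q' N = PS.prob {\<omega>. 1 / 4 * real N \<le> \<bar>window_sum (\<lambda>y. h y - 1) N (obs \<omega>)\<bar>}" for N
  have q': "q' \<longlonglongrightarrow> 0"
    unfolding q'_def[abs_def]
  proof (rule S.weak_law[OF \<pi>s unique_s])
    show "(\<lambda>y. h y - 1) \<in> borel_measurable ?O" by measurable
    show "\<bar>h y - 1\<bar> \<le> C + 1" for y using C[of y] by linarith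
    show "depends_on s (\<lambda>y. h y - 1)" using dep by (simp add: depends_on_def)
    have "integrable (S.law \<pi>s) (\<lambda>\<omega>. h (obs \<omega>))"
      by (rule S.integral_law_bounded(1)[OF ps _ C]) measurable
    then show "(\<integral>\<omega>. h (obs \<omega>) - 1 \<partial>S.law \<pi>s) = 0" using PS.prob_space by (simp add: h1')
  qed simp_all
  have lower: "p - q' (J n * b) \<le> \<P>(\<omega> in S.law \<pi>s. restrict (obs \<omega>) {..n} \<in> A n)" if n: "r \<theta> \<le> n" for n
  proof -
    let ?G = "{\<omega> :: nat \<Rightarrow> 'x \<times> 'y. N.weight V (obs \<omega>) \<le> ennreal W}"
    let ?Bad = "{\<omega> :: nat \<Rightarrow> 'x \<times> 'y. obs \<omega> \<notin> B n}"
    let ?Bad' = "{\<omega> :: nat \<Rightarrow> 'x \<times> 'y. obs (seq_shift (Suc (r \<theta>)) \<omega>) \<notin> B n}"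
    have "{\<omega> \<in> space S.paths. N.weight V (obs \<omega>) \<le> ennreal W} \<in> sets S.paths"
      "{\<omega> \<in> space S.paths. obs \<omega> \<notin> B n} \<in> sets S.paths"
      "{\<omega> \<in> space S.paths. obs (seq_shift (Suc (r \<theta>)) \<omega>) \<notin> B n} \<in> sets S.paths"
      "{\<omega> \<in> space S.paths. obs \<omega> \<in> D n} \<in> sets S.paths"
      by measurable
    then have m: "?G \<in> PS.events" "?Bad \<in> PS.events" "?Bad' \<in> PS.events" "{\<omega>. obs \<omega> \<in> D n} \<in> PS.events" by simp_all
    have m4: "{\<omega> :: nat \<Rightarrow> 'x \<times> 'y. 1 / 4 * real (J n * b) \<le> \<bar>window_sum (\<lambda>y. h y - 1) (J n * b) (obs \<omega>)\<bar>} \<in> PS.events"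
    proof -
      have "{\<omega> \<in> space S.paths. 1 / 4 * real (J n * b) \<le> \<bar>window_sum (\<lambda>y. h y - 1) (J n * b) (obs \<omega>)\<bar>} \<in> sets S.paths" by measurable
      then show ?thesis by simp
    qed
    \<comment> \<open>By stationarity the window sums after time \<open>r \<theta>\<close> have the
      law of those from time \<open>0\<close>.\<close>
    have "PS.prob ?Bad' = PS.prob ?Bad"
    proof -
      have "measure (distr (S.law \<pi>s) S.paths (seq_shift (Suc (r \<theta>)))) ?Bad = PS.prob ?Bad'"
        using m(2) by (subst measure_distr) (auto simp: vimage_def)
      then show ?thesis by (simp add: S.distr_law_seq_shift[OF \<pi>s])
    qed
    also have "\<dots> \<le> q' (J n * b)"
      unfolding q'_def
    proof (rule PS.finite_measure_mono[OF _ m4], rule subsetI)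
      fix \<omega> :: "nat \<Rightarrow> 'x \<times> 'y" assume "\<omega> \<in> ?Bad"
      then have small: "block_sum h s b (J n) (obs \<omega>) < real (J n) * real b / 2" by (simp add: B_def)
      have "real (J n) * (real s * C) \<le> real (J n) * (real b / 4)"
        using b0 b by (intro mult_left_mono) auto
      with small window_sum_le_block_sum[of h C s b "J n" "obs \<omega>", OF C sb]
      have "window_sum h (J n * b) (obs \<omega>) \<le> 3 / 4 * (real (J n) * real b)" by linarith
      then have "1 / 4 * (real (J n) * real b) \<le> \<bar>window_sum h (J n * b) (obs \<omega>) - real (J n) * real b\<bar>" by linarith
      then show "\<omega> \<in> {\<omega>. 1 / 4 * real (J n * b) \<le> \<bar>window_sum (\<lambda>y. h y - 1) (J n * b) (obs \<omega>)\<bar>}"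
        by (simp add: window_sum_minus_const)
    qed
    finally have bad: "PS.prob ?Bad' \<le> q' (J n * b)" .
    \<comment> \<open>A union bound: the filter event and the block sums may be dependent, but the
      failure probability tends to \<open>0\<close> while \<open>p\<close> is fixed.\<close>
    have "p \<le> PS.prob ({\<omega>. obs \<omega> \<in> D n} \<union> ?Bad')"
      unfolding p_def using m by (intro PS.finite_measure_mono) (auto simp: D_def obs_seq_shift)
    also have "\<dots> \<le> PS.prob {\<omega>. obs \<omega> \<in> D n} + PS.prob ?Bad'"
      using m by (intro measure_Un_le) auto
    finally show ?thesis using bad A_iff[OF n] by (simp add: sPS)
  qed
  have "(\<lambda>n. p - q' (J n * b)) \<longlonglongrightarrow> p - 0"
    unfolding J_def by (intro tendsto_diff tendsto_const filterlim_compose[OF q' div_mult_at_top[OF b(2)]])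
  then have "liminf (\<lambda>n. ereal (p - q' (J n * b))) = ereal p"
    by (intro lim_imp_Liminf) auto
  then have "0 < liminf (\<lambda>n. ereal (p - q' (J n * b)))" using p by simp
  also have "\<dots> \<le> liminf (\<lambda>n. ereal \<P>(\<omega> in S.law \<pi>s. restrict (obs \<omega>) {..n} \<in> A n))"
    using eventually_ge_at_top[of "r \<theta>"] by (intro Liminf_mono, eventually_elim) (use lower in simp)
  finally have liminf: "0 < liminf (\<lambda>n. ereal \<P>(\<omega> in S.law \<pi>s. restrict (obs \<omega>) {..n} \<in> A n))" .
  show "\<exists>A :: nat \<Rightarrow> (nat \<Rightarrow> 'y) set.
             (\<forall>n. A n \<in> sets (PiM {..n} (\<lambda>_. borel))) \<and>
             liminf (\<lambda>n. ereal \<P>(\<omega> in hmm_stat (Q \<theta>s) \<mu> (g \<theta>s). restrict (obs \<omega>) {..n} \<in> A n)) > 0 \<and>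
             limsup (\<lambda>n. ereal (1 / real n) *
               log_ennreal
                 (emeasure (normalized_law (Q \<theta>) (g \<theta>) lam (r \<theta>) (Q \<theta>s) (g \<theta>s) \<mu>)
                   {y. restrict y {..n} \<in> A n})) < 0"
    unfolding stat norm_eq using Am liminf limsup by (intro exI[of _ A] conjI allI)
qed

end
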